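(* Let $k\in\mathbb N$ (including $k=0$), and let $s_k$ be the substitution over the alphabet $\{a,b,c\}$ defined by $$s_k:\quad a\mapsto a^kbc,\qquad b\mapsto c,\qquad c\mapsto a,$$ where $a^k$ means that the letter $a$ is repeated $k$ times. The subshift generated by the substitution $s_k$ is measurably conjugate to a translation on the torus $\mathbb T^2$.
   Context: A substitution is a morphism of the monoid of finite words over the alphabet, extended to infinite words. The subshift generated by a primitive substitution $s$ over $A$ is $(\overline{S^{\mathbb N}u},S)$, where $S$ is the shift on $A^{\mathbb N}$ (product topology), $S^{\mathbb N}u=\{S^nu:n\in\mathbb N\}$ and $u\in A^{\mathbb N}$ is any periodic point of $s$ (i.e. $s^m(u)=u$ for some $m\ge1$); it does not depend on the choice of $u$. It is considered with its unique shift-invariant probability measure, and the torus $\mathbb T^2=\mathbb R^2/\mathbb Z^2$ with Lebesgue measure. *)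

theory Defs
  imports "HOL-Probability.Probability"
begin

section \<open>Substitutions and their subshifts\<close>

type_synonym 'a substitution = "'a \<Rightarrow> 'a list"

definition subst_word :: "'a substitution \<Rightarrow> 'a list \<Rightarrow> 'a list" where
  "subst_word s w = concat (map s w)"

text \<open>The extension to infinite words, \<open>s(u) = s(u\<^sub>0) s(u\<^sub>1) s(u\<^sub>2) \<dots>\<close>.  It is meant for non-erasing
  substitutions, for which the first \<open>i + 1\<close> letters of \<open>u\<close> already determine the letter of \<open>s(u)\<close>
  at position \<open>i\<close>; see \<open>subst_inf_prefix\<close>.\<close>

definition subst_inf :: "'a substitution \<Rightarrow> (nat \<Rightarrow> 'a) \<Rightarrow> (nat \<Rightarrow> 'a)" where
  "subst_inf s u = (\<lambda>i. subst_word s (map u [0..<Suc i]) ! i)"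

lemma subst_inf_prefix:
  assumes "\<And>x. s x \<noteq> []"
  defines "w \<equiv> \<lambda>n u. subst_word s (map u [0..<n])"
  shows "map (subst_inf s u) [0..<length (w n u)] = w n u"
proof -
  have len: "n \<le> length (w n u)" for n
  proof (induction n)
    case (Suc n)
    have "length (s (u n)) \<ge> 1" using assms(1)[of "u n"] by (cases "s (u n)") auto
    then show ?case using Suc by (simp add: w_def subst_word_def)
  qed (simp add: w_def)
  have mono: "\<exists>z. w m u = w n u @ z" if "n \<le> m" for n m
  proof -
    from that obtain d where "m = n + d" using le_Suc_ex by blast
    then have "[0..<m] = [0..<n] @ [n..<m]" using upt_add_eq_append[of 0 n d] by simp
    then show ?thesis by (simp add: w_def subst_word_def)
  qed
  have inf: "subst_inf s u i = w (Suc i) u ! i" for i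
    by (simp only: subst_inf_def w_def)
  have "subst_inf s u i = w n u ! i" if i: "i < length (w n u)" for i
  proof (cases "Suc i \<le> n")
    case True
    obtain z where z: "w n u = w (Suc i) u @ z" using mono[OF True] by blast
    have "i < length (w (Suc i) u)" using len[of "Suc i"] by linarith
    then show ?thesis unfolding inf z nth_append by (simp only: if_True)
  next
    case False
    then obtain z where z: "w (Suc i) u = w n u @ z" using mono[of n "Suc i"] by auto
    show ?thesis unfolding inf z nth_append using i by (simp only: if_True)
  qed
  then show ?thesis by (intro nth_equalityI) (simp_all del: upt_Suc)
qed

definition periodic_point :: "'a substitution \<Rightarrow> (nat \<Rightarrow> 'a) \<Rightarrow> bool" where
  "periodic_point s u \<longleftrightarrow> (\<exists>m\<ge>1. (subst_inf s ^^ m) u = u)"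

definition word_shift :: "(nat \<Rightarrow> 'a) \<Rightarrow> (nat \<Rightarrow> 'a)" where
  "word_shift u = (\<lambda>n. u (Suc n))"

text \<open>The closure is taken in the product topology on \<open>nat \<Rightarrow> 'a\<close>, the alphabet being discrete.
  For a primitive substitution the resulting set is the same for all periodic points, which is why
  a definite description is meaningful.\<close>

definition subshift_of :: "'a::discrete_topology substitution \<Rightarrow> (nat \<Rightarrow> 'a) set" where
  "subshift_of s =
     (THE X. \<exists>u. periodic_point s u \<and> X = closure (range (\<lambda>n. (word_shift ^^ n) u)))"


section \<open>Measure-preserving systems\<close>

definition measure_preserving :: "'a measure \<Rightarrow> 'b measure \<Rightarrow> ('a \<Rightarrow> 'b) \<Rightarrow> bool" where
  "measure_preserving M N f \<longleftrightarrow> f \<in> measurable M N \<and> distr M N f = N"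

text \<open>The unique shift-invariant Borel probability measure on a uniquely ergodic subshift \<open>X\<close>;
  subshifts of primitive substitutions are uniquely ergodic.\<close>

definition invariant_measure :: "(nat \<Rightarrow> 'a::discrete_topology) set \<Rightarrow> (nat \<Rightarrow> 'a) measure" where
  "invariant_measure X =
     (THE \<mu>. sets \<mu> = sets (restrict_space borel X) \<and> prob_space \<mu> \<and> measure_preserving \<mu> \<mu> word_shift)"

text \<open>Isomorphism modulo null sets: after discarding null sets, a bimeasurable measure-preserving
  bijection between forward invariant sets that intertwines the two transformations.\<close>

definition measurably_conjugate ::
    "'a measure \<Rightarrow> ('a \<Rightarrow> 'a) \<Rightarrow> 'b measure \<Rightarrow> ('b \<Rightarrow> 'b) \<Rightarrow> bool" where
  "measurably_conjugate M T N R \<longleftrightarrow>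
     measure_preserving M M T \<and> measure_preserving N N R \<and>
     (\<exists>M\<^sub>0 N\<^sub>0 \<phi>.
        M\<^sub>0 \<in> sets M \<and> space M - M\<^sub>0 \<in> null_sets M \<and> T ` M\<^sub>0 \<subseteq> M\<^sub>0 \<and>
        N\<^sub>0 \<in> sets N \<and> space N - N\<^sub>0 \<in> null_sets N \<and> R ` N\<^sub>0 \<subseteq> N\<^sub>0 \<and>
        bij_betw \<phi> M\<^sub>0 N\<^sub>0 \<and>
        measure_preserving (restrict_space M M\<^sub>0) (restrict_space N N\<^sub>0) \<phi> \<and>
        inv_into M\<^sub>0 \<phi> \<in> measurable (restrict_space N N\<^sub>0) (restrict_space M M\<^sub>0) \<and>
        (\<forall>x\<in>M\<^sub>0. \<phi> (T x) = R (\<phi> x)))"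


section \<open>The two-dimensional torus\<close>

definition lattice_equiv :: "real^2 \<Rightarrow> real^2 \<Rightarrow> bool" where
  "lattice_equiv x y \<longleftrightarrow> (\<forall>i. x $ i - y $ i \<in> \<int>)"

quotient_type torus2 = "real^2" / lattice_equiv
  morphisms rep_torus2 torus2_proj
proof (rule equivpI)
  show "reflp lattice_equiv" by (auto simp: reflp_def lattice_equiv_def)
  show "symp lattice_equiv"
    unfolding symp_def lattice_equiv_def by (metis Ints_minus minus_diff_eq)
  show "transp lattice_equiv"
  proof (rule transpI, unfold lattice_equiv_def, rule allI)
    fix x y z :: "real^2" and i
    assume "\<forall>i. x $ i - y $ i \<in> \<int>" "\<forall>i. y $ i - z $ i \<in> \<int>"
    then have "(x $ i - y $ i) + (y $ i - z $ i) \<in> \<int>" by (intro Ints_add) auto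
    then show "x $ i - z $ i \<in> \<int>" by simp
  qed
qed

instantiation torus2 :: ab_group_add
begin

lift_definition zero_torus2 :: torus2 is 0 .

lift_definition plus_torus2 :: "torus2 \<Rightarrow> torus2 \<Rightarrow> torus2" is "(+)"
proof (unfold lattice_equiv_def, rule allI)
  fix x x' y y' :: "real^2" and i
  assume "\<forall>i. x $ i - x' $ i \<in> \<int>" "\<forall>i. y $ i - y' $ i \<in> \<int>"
  then have "(x $ i - x' $ i) + (y $ i - y' $ i) \<in> \<int>" by (intro Ints_add) auto
  then show "(x + y) $ i - (x' + y') $ i \<in> \<int>" by (simp add: algebra_simps)
qed

lift_definition uminus_torus2 :: "torus2 \<Rightarrow> torus2" is uminus
proof (unfold lattice_equiv_def, rule allI)
  fix x x' :: "real^2" and i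
  assume "\<forall>i. x $ i - x' $ i \<in> \<int>"
  then have "- (x $ i - x' $ i) \<in> \<int>" by (intro Ints_minus) auto
  then show "(- x) $ i - (- x') $ i \<in> \<int>" by simp
qed

definition minus_torus2 :: "torus2 \<Rightarrow> torus2 \<Rightarrow> torus2" where
  "minus_torus2 x y = x + - y"

instance
proof
  fix x y z :: torus2
  show "x + y + z = x + (y + z)"
    by transfer (simp add: lattice_equiv_def algebra_simps)
  show "x + y = y + x"
    by transfer (simp add: lattice_equiv_def algebra_simps)
  show "0 + x = x" by transfer (simp add: lattice_equiv_def)
  show "- x + x = 0" by transfer (simp add: lattice_equiv_def)
  show "x - y = x + - y" by (rule minus_torus2_def)
qed

end

instantiation torus2 :: topological_space
begin

text \<open>The quotient topology.\<close>

definition open_torus2 :: "torus2 set \<Rightarrow> bool" where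
  "open_torus2 U \<longleftrightarrow> open (torus2_proj -` U)"

instance
  by standard (auto simp: open_torus2_def vimage_Union)

end

text \<open>Lebesgue measure on the Borel sets of the torus: the image of Lebesgue measure on the
  fundamental domain \<open>[0,1)\<^sup>2\<close>.\<close>

definition lebesgue_torus2 :: "torus2 measure" where
  "lebesgue_torus2 =
     distr (restrict_space lborel {x. \<forall>i. 0 \<le> x $ i \<and> x $ i < 1}) borel torus2_proj"

text \<open>\<open>distr\<close> yields junk for non-measurable maps; the projection is measurable.\<close>

lemma torus2_proj_measurable: "torus2_proj \<in> borel_measurable borel"
  by (intro borel_measurable_continuous_onI)
     (auto simp: continuous_on_open_vimage open_torus2_def)


section \<open>The substitutions\<close>

datatype letter = La | Lb | Lc

instantiation letter :: discrete_topology
begin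

definition open_letter :: "letter set \<Rightarrow> bool" where
  "open_letter U \<longleftrightarrow> True"

instance
  by standard (auto simp: open_letter_def)

end

fun sk :: "nat \<Rightarrow> letter substitution" where
  "sk k La = replicate k La @ [Lb, Lc]"
| "sk k Lb = [Lc]"
| "sk k Lc = [La]"

end

(*
  Let lam be the dominant root of x^3 = k x^2 + x + 1 and bet one of the two complex conjugate roots, so that
  |bet|^2 = 1 / lam.  Giving the letters a, b, c the weights bet^2, 1, bet, inflation by s_k multiplies weights
  by bet.  Weights of prefixes are therefore bounded, and since s_k is recognizable they extend to a continuous
  map from the subshift to the plane.  Modulo the lattice spanned by the differences of the letter weights it is a
  factor map to a rotation of the torus with dense orbits.  Such a rotation is uniquely ergodic, so it suffices to show that
  almost every fibre is a single point.

  Two points of a fibre give two tilings of the line by intervals of lengths lam^2, 1, lam, and a pair of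
  overlapping tiles corresponds to an intersection of translated Rauzy fractal pieces.  Inflation multiplies the
  length of an overlap by lam and divides areas by lam; hence the finite set of non-coincident overlaps of
  positive area is closed under passing to children.  Following the left ends of tiles in this set one always
  meets a coincidence, so the set is empty: for k >= 2 by a maximum argument for one integer coordinate, for
  k = 0 and k = 1 by a finite search.
*)
theory Submission
  imports Defs
begin

section \<open>Words and abelianizations\<close>

text \<open>Everything rests on \<open>lam * |bet|^2 = 1\<close>. Overlap lengths and intersection
  areas are vectors on the same graph of overlaps, with the same factor \<open>lam\<close>, one on
  each side of its incidence matrix; pairing them shows that no overlapping child of a
  non-coincident overlap of positive area can coincide or lose its area. This takes the place of a
  proof that the fractal pieces tile the plane. Displacements stay integer vectors, with
  \<open>el\<close> and \<open>zt\<close> as their real and complex images, so coincidence is an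
  exact equality. Modulo differences of letter weights all letters have weight 1, hence the shift
  becomes translation by one vector whatever the letter read. The obstacle is uniformity in
  \<open>k\<close>: the maximum argument uses \<open>lam^2 > 2 * lam + 1\<close>, which fails for
  \<open>k = 0\<close> and \<open>k = 1\<close>, where the walk of left ends even has cycles
  avoiding displacement 0. Unique ergodicity of the rotation, combined with almost everywhere
  injectivity, also yields the uniqueness that the definite description
  \<open>invariant_measure\<close> asks for.\<close>

type_synonym vec3 = "int \<times> int \<times> int"

primrec letter_vec :: "letter \<Rightarrow> vec3" where
  "letter_vec La = (1, 0, 0)"
| "letter_vec Lb = (0, 1, 0)"
| "letter_vec Lc = (0, 0, 1)"

definition word_vec :: "letter list \<Rightarrow> vec3" where
  "word_vec w = sum_list (map letter_vec w)"

lemma word_vec_simps [simp]: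
  "word_vec [] = 0" "word_vec (x # w) = letter_vec x + word_vec w"
  "word_vec (v @ w) = word_vec v + word_vec w"
  by (simp_all add: word_vec_def)

lemma subst_word_simps [simp]:
  "subst_word s [] = []" "subst_word s (x # w) = s x @ subst_word s w"
  "subst_word s (v @ w) = subst_word s v @ subst_word s w"
  by (simp_all add: subst_word_def)

lemma subst_word_pow_append:
  "(subst_word s ^^ n) (v @ w) = (subst_word s ^^ n) v @ (subst_word s ^^ n) w"
  by (induction n arbitrary: v w) (simp_all)

text \<open>The block that contains the first letter of \<open>r\<close> is the image of
  \<open>y\<close>. As \<open>r\<close> and \<open>r0\<close> are nonempty, a cut at a block
  boundary is attributed to the block on its right, with \<open>p0 = []\<close>.\<close>

lemma subst_word_prefixE:
  assumes "subst_word s v = p @ r" "r \<noteq> []"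
  obtains v1 y v2 p0 r0 where "v = v1 @ y # v2" "p = subst_word s v1 @ p0" "s y = p0 @ r0"
    "r0 \<noteq> []" "r = r0 @ subst_word s v2"
proof -
  have "\<exists>v1 y v2 p0 r0. v = v1 @ y # v2 \<and> p = subst_word s v1 @ p0 \<and> s y = p0 @ r0 \<and>
      r0 \<noteq> [] \<and> r = r0 @ subst_word s v2"
    using assms
  proof (induction v arbitrary: p)
    case Nil
    then show ?case by simp
  next
    case (Cons x v)
    show ?case
    proof (cases "length p < length (s x)")
      case True
      then obtain r0 where "s x = p @ r0"
        using Cons.prems(1) by (metis append_eq_append_conv_if append_take_drop_id less_imp_le_nat subst_word_simps(2) append_eq_conv_conj take_append)
      moreover from this have "r0 \<noteq> []" using True by auto
      ultimately show ?thesis using Cons.prems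
        by (intro exI[of _ "[]"] exI[of _ x] exI[of _ v] exI[of _ p] exI[of _ r0]) auto
    next
      case False
      then obtain p' where p': "p = s x @ p'"
        using Cons.prems(1)
        by (metis append_eq_append_conv_if append_take_drop_id linorder_not_less subst_word_simps(2) append_eq_conv_conj)
      with Cons.prems have "subst_word s v = p' @ r" by simp
      from Cons.IH[OF this Cons.prems(2)] obtain v1 y v2 p0 r0 where
        "v = v1 @ y # v2" "p' = subst_word s v1 @ p0" "s y = p0 @ r0" "r0 \<noteq> []" "r = r0 @ subst_word s v2"
        by blast
      then show ?thesis using p'
        by (intro exI[of _ "x # v1"] exI[of _ y] exI[of _ v2] exI[of _ p0] exI[of _ r0]) auto
    qed
  qed
  then show ?thesis using that by blast
qed

context fixes k :: nat begin

definition iter :: "nat \<Rightarrow> letter list" where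
  "iter m = (subst_word (sk k) ^^ m) [La]"

text \<open>An occurrence is located by the prefix before it, because the weight of this prefix is
  the point of the plane attached to the occurrence.\<close>

definition occurs :: "letter list \<Rightarrow> letter list \<Rightarrow> bool" where
  "occurs p w \<longleftrightarrow> (\<exists>m q. iter m = p @ w @ q)"

text \<open>The incidence matrix of the substitution, acting on letter counts.\<close>

fun inc :: "vec3 \<Rightarrow> vec3" where
  "inc (x, y, z) = (int k * x + z, x, x + y)"

lemma inc_add: "inc (g + h) = inc g + inc h"
  by (cases g; cases h) (simp add: algebra_simps)

lemma inc_zero [simp]: "inc 0 = 0"
  by (simp add: zero_prod_def)

lemma word_vec_replicate: "word_vec (replicate n La) = (int n, 0, 0)"
  by (induction n) (simp_all add: zero_prod_def)

lemma word_vec_subst: "word_vec (subst_word (sk k) w) = inc (word_vec w)"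
proof (induction w)
  case (Cons x w)
  have "word_vec (sk k x) = inc (letter_vec x)"
    by (cases x) (simp_all add: word_vec_replicate zero_prod_def)
  with Cons show ?case by (simp add: inc_add)
qed simp

lemma sk_neq_Nil [simp]: "sk k x \<noteq> []"
  by (cases x) auto

lemma length_sk: "length (sk k x) \<le> k + 2"
  by (cases x) auto

lemma length_subst_ge: "length w \<le> length (subst_word (sk k) w)"
proof (induction w)
  case (Cons x w)
  have "length (sk k x) \<ge> 1" by (cases x) auto
  with Cons show ?case by simp
qed simp

lemma length_subst_pow_ge: "length w \<le> length ((subst_word (sk k) ^^ n) w)"
  by (induction n) (auto intro: order_trans length_subst_ge)

lemma iter_Suc: "iter (Suc m) = subst_word (sk k) (iter m)"
  by (simp add: iter_def)

lemma iter_add: "iter (m + n) = (subst_word (sk k) ^^ m) (iter n)"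
  by (simp add: iter_def funpow_add)

section \<open>Recognizability\<close>

text \<open>A letter b is always preceded by the k letters a of its own block; images of c can only
  lengthen the run.\<close>

lemma run_before_b:
  assumes "subst_word (sk k) v = replicate j La @ Lb # q"
  shows "j \<ge> k"
  using assms
proof (induction v arbitrary: j)
  case (Cons x v)
  show ?case
  proof (cases x)
    case La
    show ?thesis
    proof (rule ccontr)
      assume "\<not> k \<le> j"
      then have "(replicate k La @ [Lb, Lc] @ subst_word (sk k) v) ! j = La"
        by (simp add: nth_append)
      moreover have "(replicate j La @ Lb # q) ! j = Lb" by (simp add: nth_append)
      ultimately show False using Cons.prems La by simp
    qed
  next
    case Lb
    then show ?thesis using Cons.prems by (cases j) auto
  next
    case Lc
    then obtain j' where "j = Suc j'" using Cons.prems by (cases j) auto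
    then show ?thesis using Cons Lc by (auto intro: le_SucI)
  qed
qed simp

text \<open>A factor of length at least \<open>k + 2\<close> determines the next block boundary after its first letter:
  a letter \<open>b\<close> occurs only in the block \<open>a\<^sup>k b c\<close>, a \<open>c\<close> ends a block, and an \<open>a\<close> followed by \<open>a\<^sup>k\<close>
  is not in a block \<open>a\<^sup>k b c\<close>.\<close>

definition sync_pos :: "letter list \<Rightarrow> nat" where
  "sync_pos w = (if take (Suc k) w = replicate (Suc k) La then 1
     else (let j = length (takeWhile (\<lambda>x. x = La) w) in if w ! j = Lb then j + 2 else j + 1))"

end

lemma takeWhile_La_decomp:
  assumes "take (Suc k) w \<noteq> replicate (Suc k) La" "length w \<ge> Suc k"
  obtains j x r where "w = replicate j La @ x # r" "x \<noteq> La" "j \<le> k"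
    "length (takeWhile (\<lambda>x. x = La) w) = j"
proof -
  let ?t = "takeWhile (\<lambda>x. x = La) w"
  have t: "?t = replicate (length ?t) La"
    by (metis (mono_tags, lifting) replicate_eqI set_takeWhileD)
  have w: "w = ?t @ dropWhile (\<lambda>x. x = La) w" by simp
  have lt: "length ?t \<le> k"
  proof (rule ccontr)
    assume "\<not> length ?t \<le> k"
    then have "take (Suc k) w = take (Suc k) ?t" by (metis append_take_drop_id not_less_eq_eq take_append takeWhile_dropWhile_id append.right_neutral diff_is_0_eq take0)
    also have "\<dots> = replicate (Suc k) La" using \<open>\<not> length ?t \<le> k\<close> by (subst t) (simp add: min_def del: replicate_Suc)
    finally show False using assms(1) by contradiction
  qed
  have "dropWhile (\<lambda>x. x = La) w \<noteq> []" 
    using lt assms(2) by (metis Suc_n_not_le_n append.right_neutral order_trans w)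
  then obtain x r where xr: "dropWhile (\<lambda>x. x = La) w = x # r" by (meson neq_Nil_conv)
  then have "x \<noteq> La" by (metis (mono_tags) dropWhile_eq_Cons_conv)
  with that[of "length ?t" x r] lt t w xr show ?thesis by metis
qed

text \<open>If \<open>w\<close> starts with k + 1 letters a, the first of them is the image of a c.
  Otherwise the first letter different from a has index at most k: a c ends a block, and a b is
  followed by the c that ends its block.\<close>

lemma sync_pos_cut:
  assumes "subst_word (sk k) v = p @ w @ q" "length w \<ge> k + 2"
  shows "\<exists>v1 v2. v = v1 @ v2 \<and> subst_word (sk k) v1 = p @ take (sync_pos k w) w"
proof (cases "take (Suc k) w = replicate (Suc k) La")
  case True
  then obtain w' where w': "w = replicate (Suc k) La @ w'" by (metis append_take_drop_id)
  then have e: "subst_word (sk k) v = p @ (La # replicate k La @ w' @ q)" using assms by simp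
  from subst_word_prefixE[OF e] obtain v1 y v2 p0 r0 where *: "v = v1 @ y # v2"
    "p = subst_word (sk k) v1 @ p0" "sk k y = p0 @ r0" "r0 \<noteq> []"
    "La # replicate k La @ w' @ q = r0 @ subst_word (sk k) v2" by blast
  \<comment> \<open>\<open>r0\<close> is the part of the block of \<open>y\<close> from the first
    letter of \<open>w\<close> on. Inside a block a^k b c it would show a letter b or c within the
    first k + 1 letters.\<close>
  have "r0 = [La]"
  proof (cases y)
    case La
    with * have r: "r0 = drop (length p0) (replicate k La @ [Lb, Lc])" by (metis append_eq_conv_conj sk.simps(1))
    show ?thesis
    proof (cases "length p0 \<le> k")
      case True
      then have "r0 = replicate (k - length p0) La @ [Lb, Lc]" using r by simp
      then have "(r0 @ subst_word (sk k) v2) ! (k - length p0) = Lb" by (simp add: nth_append)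
      moreover have "(replicate (Suc k) La @ w' @ q) ! (k - length p0) = La"
        using le_imp_less_Suc[OF diff_le_self[of k "length p0"]] by (simp only: nth_append length_replicate if_True nth_replicate)
      ultimately show ?thesis using *(5) by simp
    next
      case False
      then have "length p0 - k \<ge> 1" by simp
      then have "set r0 \<subseteq> {Lc}" using r 
        by (cases "length p0 - k") (auto simp: drop_Cons' split: if_splits)
      then show ?thesis using *(4,5) by (cases r0) auto
    qed
  next
    case Lb
    then have "r0 = [Lc]" using * by (simp add: Cons_eq_append_conv)
    then show ?thesis using * by auto
  next
    case Lc
    then show ?thesis using * by (simp add: Cons_eq_append_conv)
  qed
  moreover have "sync_pos k w = 1" using True by (simp add: sync_pos_def)
  moreover have "take 1 w = [La]" using w' by simp
  ultimately show ?thesis using * by (intro exI[of _ "v1 @ [y]"] exI[of _ v2]) auto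
next
  case False
  with assms(2) obtain j x r where j: "w = replicate j La @ x # r" "x \<noteq> La" "j \<le> k"
    "length (takeWhile (\<lambda>x. x = La) w) = j" by (elim takeWhile_La_decomp) auto
  have e: "subst_word (sk k) v = (p @ replicate j La) @ (x # r @ q)" using assms j by simp
  from subst_word_prefixE[OF e] obtain v1 y v2 p0 r0 where *: "v = v1 @ y # v2"
    "p @ replicate j La = subst_word (sk k) v1 @ p0" "sk k y = p0 @ r0" "r0 \<noteq> []"
    "x # r @ q = r0 @ subst_word (sk k) v2" by blast
  have x: "w ! j = x" using j by (simp add: nth_append)
  have r0: "(x = Lb \<and> r0 = [Lb, Lc]) \<or> (x = Lc \<and> r0 = [Lc])"
  proof (cases y)
    case La
    with * have r: "r0 = drop (length p0) (replicate k La @ [Lb, Lc])" by (metis append_eq_conv_conj sk.simps(1))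
    show ?thesis
    proof (cases "length p0 < k")
      case True
      then obtain l where "k - length p0 = Suc l" by (metis Suc_diff_Suc)
      then have "r0 = La # replicate l La @ [Lb, Lc]" using r True by simp
      then show ?thesis using *(5) j by simp
    next
      case False
      have "length (p0 @ r0) = k + 2" using *(3) La by (simp flip: *(3))
      then have "length p0 = k \<or> length p0 = Suc k" using False *(4) by (cases r0) auto
      then show ?thesis using r *(5) by auto
    qed
  next
    case Lb
    then show ?thesis using * by (auto simp: Cons_eq_append_conv)
  next
    case Lc
    then show ?thesis using * j by (auto simp: Cons_eq_append_conv)
  qed
  have "p @ take (sync_pos k w) w = p @ replicate j La @ r0"
  proof (cases "x = Lb")
    case True
    \<comment> \<open>The b has index at most k and \<open>w\<close> has at least k + 2 letters, so
      the c after it is still visible.\<close>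
    have "length r \<ge> 1" using assms(2) j by simp
    then obtain r' c where r': "r = c # r'" by (cases r) auto
    have "c = Lc" using *(5) r0 True r' by auto
    then have "take (j + 2) w = replicate j La @ [Lb, Lc]" using j r' True by simp
    then show ?thesis using False j x r0 True by (simp add: sync_pos_def)
  next
    case f: False
    then have "take (j + 1) w = replicate j La @ [Lc]" using j r0 by simp
    then show ?thesis using False j x r0 f by (simp add: sync_pos_def)
  qed
  also have "\<dots> = subst_word (sk k) (v1 @ [y])" using * by simp
  finally show ?thesis using * by (intro exI[of _ "v1 @ [y]"] exI[of _ v2]) auto
qed

lemma sync_pos_le: "length w \<ge> k + 2 \<Longrightarrow> sync_pos k w \<le> k + 2"
proof (cases "take (Suc k) w = replicate (Suc k) La")
  case False
  assume "length w \<ge> k + 2"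
  with False obtain j where "length (takeWhile (\<lambda>x. x = La) w) = j" "j \<le> k"
    by (elim takeWhile_La_decomp) auto
  then show ?thesis using False by (simp add: sync_pos_def)
qed (simp add: sync_pos_def)

text \<open>The longest block a^k b c has k + 2 letters and is seen completely. Were it cut
  differently, its b would be preceded by fewer than k letters a in the image of the rest, against
  \<open>run_before_b\<close>. The images of b and c differ in their first letter.\<close>

lemma first_letter_determined:
  assumes "subst_word (sk k) (x # v) = w @ q" "subst_word (sk k) (x' # v') = w @ q'" "length w \<ge> k + 2"
  shows "x = x'"
proof -
  have main: False
    if e: "subst_word (sk k) (x # v) = w @ q" "subst_word (sk k) (x' # v') = w @ q'" and
       a: "x = La" and b: "x' \<noteq> La" for x v q x' v' q'
  proof -
    have "take (k + 2) w = replicate k La @ [Lb, Lc]"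
    proof -
      have "take (k + 2) (w @ q) = replicate k La @ [Lb, Lc]" using e(1) a by (simp flip: e(1))
      then show ?thesis using assms(3) by simp
    qed
    then obtain w' where w: "w = replicate k La @ Lb # Lc # w'"
      by (metis append_take_drop_id append.assoc append_Cons append_Nil)
    show False
    proof (cases x')
      case Lb
      then show ?thesis using e(2) w by (cases k) auto
    next
      case Lc
      then obtain l where l: "k = Suc l" using e(2) w by (cases k) auto
      then have "subst_word (sk k) v' = replicate l La @ Lb # (Lc # w' @ q')" using e(2) w Lc by simp
      from run_before_b[OF this] l show ?thesis by simp
    qed (use b in auto)
  qed
  show ?thesis
  proof (cases "x = La \<or> x' = La")
    case True
    then show ?thesis using main[OF assms(1,2)] main[OF assms(2,1)] by blast
  next
    case False
    have "w \<noteq> []" using assms(3) by auto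
    with False assms show ?thesis by (cases x; cases x'; cases w) auto
  qed
qed

text \<open>Each block read off consumes at most k + 2 letters of the common word.\<close>

lemma common_desubstitution:
  assumes "subst_word (sk k) v = w @ q" "subst_word (sk k) v' = w @ q'" "length w \<ge> (k + 2) * l"
  shows "length v \<ge> l \<and> length v' \<ge> l \<and> take l v = take l v'"
  using assms
proof (induction l arbitrary: v v' w)
  case (Suc l)
  have lw: "length w \<ge> k + 2" using Suc.prems(3) by simp
  then have "v \<noteq> []" "v' \<noteq> []" using Suc.prems(1,2) by (auto simp: subst_word_def)
  then obtain x u x' u' where v: "v = x # u" "v' = x' # u'" by (meson neq_Nil_conv)
  have x: "x = x'" using first_letter_determined Suc.prems(1,2) lw v by metis
  have le: "length (sk k x) \<le> length w" using length_sk lw order_trans by blast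
  obtain w' where w': "w = sk k x @ w'"
    using Suc.prems(1) v le by (metis append_eq_append_conv_if append_take_drop_id subst_word_simps(2) append_eq_conv_conj)
  have "length w' \<ge> (k + 2) * l" using Suc.prems(3) length_sk[of k x] w' by simp
  with Suc.IH[of u w' u'] Suc.prems(1,2) v w' x show ?case by simp
qed simp

text \<open>The cut given by \<open>sync_pos\<close> depends on \<open>w\<close> alone, so both
  occurrences are cut at the same place of \<open>w\<close>. The part \<open>h\<close> of
  \<open>w\<close> before the cut is common to both and will cancel in differences of
  weights.\<close>

lemma occurs_desubst:
  assumes "occurs k p w" "occurs k p' w" "length w \<ge> (k + 2) * (l + 2)"
  shows "\<exists>h w1 p1 p1'. length w1 = l \<and> occurs k p1 w1 \<and> occurs k p1' w1 \<and>
     p @ h = subst_word (sk k) p1 \<and> p' @ h = subst_word (sk k) p1'"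
proof -
  have lw: "length w \<ge> k + 2" using assms(3) by simp
  have ex: "\<exists>m v1 v2 q. iter k m = v1 @ v2 \<and> subst_word (sk k) v1 = p @ take (sync_pos k w) w \<and>
      subst_word (sk k) v2 = drop (sync_pos k w) w @ q" if o: "occurs k p w" for p
  proof -
    from o obtain m q where m: "iter k m = p @ w @ q" by (auto simp: occurs_def)
    have "m \<noteq> 0"
    proof
      assume "m = 0"
      then have "length (p @ w @ q) = 1" using m by (simp add: iter_def flip: m)
      then show False using lw by simp
    qed
    then obtain m' where m': "m = Suc m'" by (cases m) auto
    then have e: "subst_word (sk k) (iter k m') = p @ w @ q" using m by (simp add: iter_Suc)
    from sync_pos_cut[OF this lw] obtain v1 v2 where
      v: "iter k m' = v1 @ v2" "subst_word (sk k) v1 = p @ take (sync_pos k w) w" by blast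
    have "subst_word (sk k) v1 @ subst_word (sk k) v2 = p @ w @ q" using v(1) e by simp
    then have "subst_word (sk k) v2 = drop (sync_pos k w) w @ q" unfolding v(2)
      by (metis append.assoc append_same_eq append_take_drop_id same_append_eq)
    then show ?thesis using v by blast
  qed
  obtain m v1 v2 q where a: "iter k m = v1 @ v2" "subst_word (sk k) v1 = p @ take (sync_pos k w) w"
      "subst_word (sk k) v2 = drop (sync_pos k w) w @ q" using ex[OF assms(1)] by blast
  obtain m' v1' v2' q' where b: "iter k m' = v1' @ v2'" "subst_word (sk k) v1' = p' @ take (sync_pos k w) w"
      "subst_word (sk k) v2' = drop (sync_pos k w) w @ q'" using ex[OF assms(2)] by blast
  have "(k + 2) * l + (k + 2) + (k + 2) = (k + 2) * (l + 2)" by (simp add: algebra_simps)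
  then have "length (drop (sync_pos k w) w) \<ge> (k + 2) * l" using assms(3) sync_pos_le[OF lw] unfolding length_drop by linarith
  from common_desubstitution[OF a(3) b(3) this] have c: "l \<le> length v2" "l \<le> length v2'" "take l v2 = take l v2'" by auto
  have "occurs k v1 (take l v2)" unfolding occurs_def using a(1) by (metis append_take_drop_id)
  moreover have "occurs k v1' (take l v2)" unfolding occurs_def using b(1) c(3) by (metis append_take_drop_id)
  ultimately show ?thesis using a(2) b(2) c by (metis length_take min.absorb2)
qed

section \<open>The subshift\<close>

lemma open_cylinder: "open {y :: nat \<Rightarrow> 'a::discrete_topology. \<forall>i<n. y i = x i}"
proof -
  have "open ((\<lambda>y :: nat \<Rightarrow> 'a. y i) -` {x i})" for i
    by (intro open_vimage Topological_Spaces.open_discrete continuous_on_product_coordinates)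
  then have "open (\<Inter>i\<in>{..<n}. (\<lambda>y :: nat \<Rightarrow> 'a. y i) -` {x i})"
    by (intro open_INT) auto
  also have "(\<Inter>i\<in>{..<n}. (\<lambda>y. y i) -` {x i}) = {y. \<forall>i<n. y i = x i}" by auto
  finally show ?thesis .
qed

lemma open_contains_cylinder:
  fixes U :: "(nat \<Rightarrow> 'a::discrete_topology) set"
  assumes "open U" "x \<in> U"
  obtains n where "{y. \<forall>i<n. y i = x i} \<subseteq> U"
proof -
  have "openin (product_topology (\<lambda>i. euclidean) UNIV) U"
    using assms(1) by (simp add: open_fun_def)
  from product_topology_open_contains_basis[OF this assms(2)] obtain Y where
    Y: "x \<in> PiE UNIV Y" "finite {i. Y i \<noteq> UNIV}" "PiE UNIV Y \<subseteq> U" by auto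
  define n where "n = Suc (Max (insert 0 {i. Y i \<noteq> UNIV}))"
  have "Y i = UNIV" if "i \<ge> n" for i
  proof (rule ccontr)
    assume "Y i \<noteq> UNIV"
    then have "i \<le> Max (insert 0 {i. Y i \<noteq> UNIV})" using Y(2) by (intro Max_ge) auto
    then show False using that by (simp add: n_def)
  qed
  then have "y i \<in> Y i" if "\<forall>i<n. y i = x i" for y i
    using Y(1) that by (cases "i < n") (auto simp: PiE_iff)
  then have "{y. \<forall>i<n. y i = x i} \<subseteq> PiE UNIV Y" by (auto simp: PiE_iff)
  from that[OF subset_trans[OF this Y(3)]] show ?thesis .
qed

lemma closure_cylinder:
  fixes A :: "(nat \<Rightarrow> 'a::discrete_topology) set"
  shows "x \<in> closure A \<longleftrightarrow> (\<forall>n. \<exists>y\<in>A. \<forall>i<n. y i = x i)"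
proof
  assume x: "x \<in> closure A"
  show "\<forall>n. \<exists>y\<in>A. \<forall>i<n. y i = x i"
  proof
    fix n
    have "{y. \<forall>i<n. y i = x i} \<inter> A \<noteq> {}"
      using open_Int_closure_eq_empty[OF open_cylinder[of n x], of A] x by auto
    then show "\<exists>y\<in>A. \<forall>i<n. y i = x i" by auto
  qed
next
  assume *: "\<forall>n. \<exists>y\<in>A. \<forall>i<n. y i = x i"
  show "x \<in> closure A"
  proof (rule ccontr)
    assume "x \<notin> closure A"
    then have "open (- closure A)" "x \<in> - closure A" by auto
    then obtain n where n: "{y. \<forall>i<n. y i = x i} \<subseteq> - closure A" by (rule open_contains_cylinder)
    from * obtain y where "y \<in> A" "\<forall>i<n. y i = x i" by blast
    then have "y \<in> - closure A" using n by auto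
    then show False using closure_subset \<open>y \<in> A\<close> by auto
  qed
qed

lemma compact_UNIV_letter_seq: "compact (UNIV :: (nat \<Rightarrow> letter) set)"
proof -
  have "finite (UNIV :: letter set)"
    by (rule finite_subset[of _ "{La, Lb, Lc}"]) (auto intro: letter.exhaust)
  then have "compact (UNIV :: letter set)" by (rule finite_imp_compact)
  then have "compact_space (product_topology (\<lambda>i::nat. euclidean :: letter topology) UNIV)"
    unfolding compact_space_product_topology by (simp add: compact_space_def)
  then have "compact_space (euclidean :: (nat \<Rightarrow> letter) topology)"
    by (simp only: euclidean_product_topology)
  then show ?thesis by (simp add: compact_space_def)
qed

lemma word_shift_pow: "(word_shift ^^ n) u i = u (n + i)"
  by (induction n arbitrary: u i) (simp_all add: word_shift_def funpow_swap1)

lemma map_word_shift_pow: "map ((word_shift ^^ j) u) [0..<n] = map u [j..<j + n]"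
  by (intro nth_equalityI) (auto simp: word_shift_pow)

context fixes k :: nat begin

text \<open>A description of the subshift that mentions no periodic point; the definite description
  in \<open>subshift_of\<close> is evaluated by showing that every periodic point leads to this
  set.\<close>

definition language_shift :: "(nat \<Rightarrow> letter) set" where
  "language_shift = {x. \<forall>n. \<exists>p. occurs k p (map x [0..<n])}"

lemma occurs_prefix: "occurs k p (v @ w) \<Longrightarrow> occurs k p v"
  unfolding occurs_def by (metis append.assoc)

lemma occurs_suffix: "occurs k p (v @ w) \<Longrightarrow> occurs k (p @ v) w"
  unfolding occurs_def by (metis append.assoc)

lemma occurs_take: "occurs k p w \<Longrightarrow> occurs k p (take n w)"
  by (metis append_take_drop_id occurs_prefix)

lemma closed_language_shift: "closed language_shift"
proof -
  have "x \<in> language_shift" if "x \<in> closure language_shift" for x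
  proof -
    have "\<exists>p. occurs k p (map x [0..<n])" for n
    proof -
      from that obtain y where y: "y \<in> language_shift" "\<forall>i<n. y i = x i"
        by (auto simp: closure_cylinder)
      then have e: "map x [0..<n] = map y [0..<n]" by auto
      show ?thesis unfolding e using y(1) by (simp add: language_shift_def)
    qed
    then show ?thesis by (simp add: language_shift_def)
  qed
  then show ?thesis by (metis closure_subset_eq subsetI)
qed

lemma compact_language_shift: "compact language_shift"
  using compact_Int_closed[OF compact_UNIV_letter_seq closed_language_shift] by simp

section \<open>Primitivity and periodic points\<close>

text \<open>The letter a returns after 2 steps through c and after 3 steps through b, hence after
  every number of steps except possibly 1. Starting from c or b costs 1 or 2 further steps, and 4 is
  the first exponent from which the exception never occurs.\<close>

lemma La_in_subst_pow:
  assumes "m \<ge> 4"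
  shows "La \<in> set ((subst_word (sk k) ^^ m) [x])"
proof -
  let ?s = "\<lambda>n. subst_word (sk k) ^^ n"
  have c: "?s (Suc n) [Lc] = ?s n [La]" for n by (simp add: funpow_swap1)
  have b: "?s (Suc (Suc n)) [Lb] = ?s n [La]" for n by (simp add: funpow_swap1)
  have a: "?s (Suc n) [La] = ?s n (replicate k La) @ ?s n [Lb] @ ?s n [Lc]" for n
    by (simp add: funpow_swap1 subst_word_pow_append[of n "sk k" "[Lb]" "[Lc]", simplified] subst_word_pow_append)
  have step: "La \<in> set (?s n [La]) \<Longrightarrow> La \<in> set (?s (n + 2) [La])" for n
    using a[of "Suc n"] c[of n] by simp
  have step3: "La \<in> set (?s n [La]) \<Longrightarrow> La \<in> set (?s (n + 3) [La])" for n
    using a[of "Suc (Suc n)"] b[of n] by (simp add: numeral_3_eq_3)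
  have "La \<in> set (?s n [La])" if "n \<noteq> 1" for n
    using that
  proof (induction n rule: less_induct)
    case (less n)
    consider "n = 0" | "n = 2" | "n = 3" | "n \<ge> 4" using less.prems by linarith
    then show ?case
    proof cases
      case 1 then show ?thesis by simp
    next
      case 2 then show ?thesis using step[of 0] by (simp add: numeral_2_eq_2)
    next
      case 3 then show ?thesis using step3[of 0] by (simp add: numeral_3_eq_3)
    next
      case 4
      then have e: "n - 2 + 2 = n" by simp
      have "La \<in> set (?s (n - 2 + 2) [La])" by (rule step, rule less.IH) (use 4 in auto)
      then show ?thesis unfolding e .
    qed
  qed
  note main = this
  show ?thesis
  proof (cases x)
    case La then show ?thesis using main[of m] assms by simp
  next
    case Lb
    have "m = Suc (Suc (m - 2))" "m - 2 \<noteq> 1" using assms by auto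
    then obtain n where "m = Suc (Suc n)" "n \<noteq> 1" by blast
    then show ?thesis using Lb b main by simp
  next
    case Lc
    have "m = Suc (m - 1)" "m - 1 \<noteq> 1" using assms by auto
    then obtain n where "m = Suc n" "n \<noteq> 1" by blast
    then show ?thesis using Lc c main by simp
  qed
qed

lemma letter_in_iter: "\<exists>n p q. iter k n = p @ [x] @ q"
proof (cases x)
  case La
  have "iter k 0 = [] @ [x] @ []" by (simp add: iter_def La)
  then show ?thesis by blast
next
  case Lb
  have "iter k 1 = replicate k La @ [x] @ [Lc]" by (simp add: iter_def Lb)
  then show ?thesis by blast
next
  case Lc
  have "iter k 1 = (replicate k La @ [Lb]) @ [x] @ []" by (simp add: iter_def Lc)
  then show ?thesis by blast
qed

lemma subst_pow_occurs: "\<exists>p. occurs k p ((subst_word (sk k) ^^ n) [x])"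
proof -
  obtain m p q where "iter k m = p @ [x] @ q" using letter_in_iter by blast
  then have "iter k (n + m) = (subst_word (sk k) ^^ n) p @ (subst_word (sk k) ^^ n) [x] @ (subst_word (sk k) ^^ n) q"
    unfolding iter_add by (simp only: subst_word_pow_append)
  then show ?thesis unfolding occurs_def by blast
qed

text \<open>The exponent 3 is needed only for \<open>k = 0\<close>.\<close>

lemma iter_three: "\<exists>r. iter k 3 = La # r \<and> r \<noteq> []"
  by (cases k) (simp_all add: iter_def numeral_3_eq_3 subst_word_def)

lemma iter_mult_three_extend: "\<exists>r. iter k (3 * Suc m) = iter k (3 * m) @ r \<and> r \<noteq> []"
proof -
  obtain r where r: "iter k 3 = La # r" "r \<noteq> []" using iter_three by blast
  have "iter k (3 * Suc m) = (subst_word (sk k) ^^ (3 * m)) (iter k 3)"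
    using iter_add[of k "3 * m" 3] by (simp add: add.commute)
  also have "\<dots> = (subst_word (sk k) ^^ (3 * m)) [La] @ (subst_word (sk k) ^^ (3 * m)) r"
    using subst_word_pow_append[of "3 * m" "sk k" "[La]" r] r by simp
  finally have "iter k (3 * Suc m) = iter k (3 * m) @ (subst_word (sk k) ^^ (3 * m)) r"
    by (simp add: iter_def)
  moreover have "(subst_word (sk k) ^^ (3 * m)) r \<noteq> []"
    using length_subst_pow_ge[where k=k and w=r and n="3*m"] r(2) by auto
  ultimately show ?thesis by blast
qed

lemma iter_mult_three_prefix: "m \<le> n \<Longrightarrow> \<exists>r. iter k (3 * n) = iter k (3 * m) @ r"
proof (induction n rule: dec_induct)
  case (step n)
  then show ?case using iter_mult_three_extend[of n] by (metis append.assoc)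
qed simp

lemma length_iter_mult_three: "length (iter k (3 * m)) > m"
proof (induction m)
  case (Suc m)
  obtain r where "iter k (3 * Suc m) = iter k (3 * m) @ r" "r \<noteq> []" using iter_mult_three_extend by blast
  with Suc show ?case by (cases r) auto
qed (simp add: iter_def)

lemma subst_inf_word:
  assumes "map u [0..<length w] = w"
  shows "map (subst_inf (sk k) u) [0..<length (subst_word (sk k) w)] = subst_word (sk k) w"
  using subst_inf_prefix[of "sk k" u "length w"] assms by simp

lemma subst_inf_pow_word:
  assumes "map u [0..<length w] = w"
  shows "map ((subst_inf (sk k) ^^ n) u) [0..<length ((subst_word (sk k) ^^ n) w)] = (subst_word (sk k) ^^ n) w"
  by (induction n) (use assms subst_inf_word in simp_all)

lemma periodic_point_exists: "\<exists>u. periodic_point (sk k) u"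
proof -
  \<comment> \<open>The words \<open>iter k (3 * m)\<close> are nested and have more than m letters,
    so \<open>u\<close> is their limit and the value at i can be read in the i-th word.\<close>
  define u where "u i = iter k (3 * i) ! i" for i
  have u: "u i = iter k (3 * m) ! i" if "i < length (iter k (3 * m))" for i m
  proof (cases "i \<le> m")
    case True
    then obtain r where "iter k (3 * m) = iter k (3 * i) @ r" using iter_mult_three_prefix by blast
    then show ?thesis using length_iter_mult_three[of i] by (simp add: u_def nth_append)
  next
    case False
    then obtain r where "iter k (3 * i) = iter k (3 * m) @ r" using iter_mult_three_prefix[of m i] by auto
    then show ?thesis using that by (simp add: u_def nth_append)
  qed
  have pre: "map u [0..<length (iter k (3 * m))] = iter k (3 * m)" for m
    by (intro nth_equalityI) (use u in auto)
  have "(subst_inf (sk k) ^^ 3) u i = u i" for i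
  proof -
    have e: "(subst_word (sk k) ^^ 3) (iter k (3 * i)) = iter k (3 * Suc i)"
      using iter_add[of k 3 "3 * i"] by simp
    have "map ((subst_inf (sk k) ^^ 3) u) [0..<length (iter k (3 * Suc i))] = iter k (3 * Suc i)"
      using subst_inf_pow_word[OF pre[of i], of 3] unfolding e .
    then have "map ((subst_inf (sk k) ^^ 3) u) [0..<length (iter k (3 * Suc i))] ! i = iter k (3 * Suc i) ! i" by simp
    moreover have "i < length (iter k (3 * Suc i))" using length_iter_mult_three[of "Suc i"] by simp
    ultimately show ?thesis using u[of i "Suc i"] by simp
  qed
  then have "(subst_inf (sk k) ^^ 3) u = u" by auto
  then show ?thesis unfolding periodic_point_def by (intro exI[of _ u] exI[of _ 3]) simp
qed

lemma length_subst_pow_unbounded: "\<exists>m0. \<forall>m\<ge>m0. length ((subst_word (sk k) ^^ m) [x]) \<ge> n"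
proof -
  have "La \<in> set ((subst_word (sk k) ^^ 4) [x])" by (rule La_in_subst_pow) simp
  \<comment> \<open>The a found after four steps generates the words \<open>iter\<close>, whose
    lengths are unbounded; further substitution never shortens a word.\<close>
  then obtain p q where pq: "(subst_word (sk k) ^^ 4) [x] = p @ [La] @ q" by (metis append_Cons append_Nil split_list)
  have "length ((subst_word (sk k) ^^ m) [x]) \<ge> n" if mge: "m \<ge> 3 * n + 4" for m
  proof -
    obtain d where d: "m = d + (3 * n + 4)" using le_add_diff_inverse2[OF mge] by metis
    have "(subst_word (sk k) ^^ m) [x] = (subst_word (sk k) ^^ d) ((subst_word (sk k) ^^ (3 * n)) (p @ [La] @ q))"
      unfolding d pq[symmetric] by (simp only: funpow_add o_apply)
    moreover have "length ((subst_word (sk k) ^^ (3 * n)) (p @ [La] @ q)) \<ge> length (iter k (3 * n))"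
      by (simp only: subst_word_pow_append length_append iter_def)
    ultimately show ?thesis using length_iter_mult_three[of n]
      using length_subst_pow_ge[where k=k and n=d and w="(subst_word (sk k) ^^ (3 * n)) (p @ [La] @ q)"] by simp
  qed
  then show ?thesis by blast
qed

text \<open>The words s^(m t)(v 0) are prefixes of \<open>v\<close>. They occur in iterates of a,
  which gives one inclusion. For large t they contain any prescribed iterate of a, by primitivity,
  which gives the other.\<close>

lemma periodic_closure:
  assumes "periodic_point (sk k) v"
  shows "closure (range (\<lambda>n. (word_shift ^^ n) v)) = language_shift"
proof -
  obtain m where m: "m \<ge> 1" "(subst_inf (sk k) ^^ m) v = v" using assms by (auto simp: periodic_point_def)
  have mt: "(subst_inf (sk k) ^^ (m * t)) v = v" for t
    by (induction t) (simp_all add: funpow_add m(2))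
  have pre: "map v [0..<length ((subst_word (sk k) ^^ (m * t)) [v 0])] = (subst_word (sk k) ^^ (m * t)) [v 0]" for t
    using subst_inf_pow_word[of v "[v 0]" "m * t"] by (simp add: mt)
  have mtge: "m * t \<ge> t" for t using m(1) by simp
  show ?thesis
  proof (intro set_eqI iffI)
    fix x assume x: "x \<in> closure (range (\<lambda>n. (word_shift ^^ n) v))"
    have "\<exists>p. occurs k p (map x [0..<n])" for n
    proof -
      obtain j where j: "\<forall>i<n. (word_shift ^^ j) v i = x i" using x by (auto simp: closure_cylinder)
      then have e: "map x [0..<n] = map v [j..<j + n]"
        by (metis (no_types, lifting) map_word_shift_pow atLeastLessThan_iff map_cong set_upt)
      obtain m0 where m0: "\<And>m. m \<ge> m0 \<Longrightarrow> length ((subst_word (sk k) ^^ m) [v 0]) \<ge> j + n"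
        using length_subst_pow_unbounded by meson
      let ?w = "(subst_word (sk k) ^^ (m * m0)) [v 0]"
      obtain d where d: "length ?w = j + n + d" using m0[OF mtge] le_Suc_ex by blast
      have "[0..<length ?w] = [0..<j] @ [j..<j + n] @ [j + n..<length ?w]"
        unfolding d using upt_add_eq_append[of 0 "j + n" d] upt_add_eq_append[of 0 j n] by simp
      then have "?w = map v [0..<j] @ map v [j..<j + n] @ map v [j + n..<length ?w]"
        using pre[of m0] by (metis map_append)
      moreover obtain p where "occurs k p ?w" using subst_pow_occurs by blast
      ultimately show ?thesis unfolding e by (metis occurs_prefix occurs_suffix)
    qed
    then show "x \<in> language_shift" by (simp add: language_shift_def)
  next
    fix x assume x: "x \<in> language_shift"
    have "\<exists>j. \<forall>i<n. (word_shift ^^ j) v i = x i" for n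
    proof -
      obtain p M q where pq: "iter k M = p @ map x [0..<n] @ q"
        using x unfolding language_shift_def occurs_def by blast
      let ?t = "M + 4"
      from mtge[of ?t] obtain d where "m * ?t = M + 4 + d" using le_Suc_ex by blast
      then have d: "m * ?t = M + (d + 4)" by simp
      obtain p' q' where "(subst_word (sk k) ^^ (d + 4)) [v 0] = p' @ [La] @ q'"
        using La_in_subst_pow[of "d + 4" "v 0"] by (metis append_Cons append_Nil split_list le_add2)
      then have "(subst_word (sk k) ^^ (m * ?t)) [v 0] =
          (subst_word (sk k) ^^ M) p' @ iter k M @ (subst_word (sk k) ^^ M) q'"
        unfolding d funpow_add o_apply iter_def by (simp only: subst_word_pow_append)
      then obtain P Q where PQ: "(subst_word (sk k) ^^ (m * ?t)) [v 0] = P @ map x [0..<n] @ Q"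
        using pq by (metis append.assoc)
      have "v (length P + i) = x i" if "i < n" for i
      proof -
        have "map v [0..<length (P @ map x [0..<n] @ Q)] ! (length P + i) = (P @ map x [0..<n] @ Q) ! (length P + i)"
          using pre[of ?t] unfolding PQ by simp
        then show ?thesis using that by (simp add: nth_append)
      qed
      then show ?thesis by (intro exI[of _ "length P"]) (simp add: word_shift_pow)
    qed
    then show "x \<in> closure (range (\<lambda>n. (word_shift ^^ n) v))"
      unfolding closure_cylinder by blast
  qed
qed

lemma subshift_of_sk: "subshift_of (sk k) = language_shift"
  unfolding subshift_of_def
  using periodic_point_exists periodic_closure by (intro the_equality) auto

lemma language_shift_nonempty: "language_shift \<noteq> {}"
  using periodic_point_exists periodic_closure by (metis closure_eq_empty empty_not_UNIV image_is_empty)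

text \<open>The second image of a ends in c a, so \<open>iter k (n + 2)\<close> ends in
  \<open>iter k n\<close> with a nonempty word before it.\<close>

lemma occurs_left_extend:
  assumes "occurs k p w"
  shows "\<exists>i p'. occurs k p' (i # w)"
proof -
  obtain n q where n: "iter k n = p @ w @ q" using assms by (auto simp: occurs_def)
  have "subst_word (sk k) (sk k La) = subst_word (sk k) (replicate k La) @ [Lc, La]" by simp
  then have "iter k 2 = (subst_word (sk k) (replicate k La) @ [Lc]) @ [La]"
    by (simp add: iter_def numeral_2_eq_2)
  then have e: "iter k (n + 2) = (subst_word (sk k) ^^ n) (subst_word (sk k) (replicate k La) @ [Lc]) @ iter k n"
    unfolding iter_add by (simp only: subst_word_pow_append iter_def)
  let ?v = "(subst_word (sk k) ^^ n) (subst_word (sk k) (replicate k La) @ [Lc])"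
  have "length ?v \<ge> length (subst_word (sk k) (replicate k La) @ [Lc])" by (rule length_subst_pow_ge)
  then have "?v @ p \<noteq> []" by auto
  then obtain v i where "?v @ p = v @ [i]" by (metis rev_exhaust)
  then have "iter k (n + 2) = v @ (i # w) @ q" unfolding e n by (metis append.assoc append_Cons append_Nil)
  then show ?thesis unfolding occurs_def by blast
qed

lemma word_shift_language_shift: "word_shift ` language_shift = language_shift"
proof
  have map_eq: "map x [0..<Suc n] = x 0 # map (word_shift x) [0..<n]" for x :: "nat \<Rightarrow> letter" and n
    by (intro nth_equalityI) (auto simp: word_shift_def nth_Cons split: nat.split simp del: upt_Suc)
  show "word_shift ` language_shift \<subseteq> language_shift"
  proof clarify
    fix x assume x: "x \<in> language_shift"
    have "\<exists>p. occurs k p (map (word_shift x) [0..<n])" for n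
    proof -
      obtain p where "occurs k p (map x [0..<Suc n])" using x by (auto simp: language_shift_def simp del: upt_Suc)
      then show ?thesis unfolding map_eq using occurs_suffix[of p "[x 0]"] by auto
    qed
    then show "word_shift x \<in> language_shift" by (simp add: language_shift_def)
  qed
  show "language_shift \<subseteq> word_shift ` language_shift"
  proof
    fix y assume y: "y \<in> language_shift"
    define P where "P i n \<longleftrightarrow> (\<exists>p. occurs k p (i # map y [0..<n]))" for i n
    have ex: "\<exists>i. P i n" for n
      using y occurs_left_extend unfolding P_def language_shift_def by blast
    have down: "P i m" if "P i n" "m \<le> n" for i m n
    proof -
      from that(1) obtain p where "occurs k p (i # map y [0..<n])" by (auto simp: P_def)
      then have "occurs k p (take (Suc m) (i # map y [0..<n]))" by (rule occurs_take)
      then show ?thesis using that(2) by (auto simp: P_def take_map)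
    qed
    \<comment> \<open>Compactness for a finite alphabet: if every letter failed at some length, the
      sum of the three lengths would admit no left extension at all.\<close>
    have "\<exists>i. \<forall>n. P i n"
    proof (rule ccontr)
      assume "\<nexists>i. \<forall>n. P i n"
      then obtain f where f: "\<And>i. \<not> P i (f i)" by metis
      obtain i where "P i (f La + f Lb + f Lc)" using ex by blast
      then have "P i (f i)" by (rule down) (cases i; simp)
      then show False using f by simp
    qed
    then obtain i where i: "\<And>n. P i n" by blast
    define x where "x = case_nat i y"
    have sx: "word_shift x = y" by (auto simp: x_def word_shift_def)
    have "\<exists>p. occurs k p (map x [0..<n])" for n
    proof -
      obtain p where "occurs k p (map x [0..<Suc n])" using i[of n] unfolding map_eq P_def sx by (auto simp: x_def)
      then have "occurs k p (map x [0..<n] @ [x n])" by simp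
      then show ?thesis using occurs_prefix by blast
    qed
    then have "x \<in> language_shift" by (simp add: language_shift_def)
    then show "y \<in> word_shift ` language_shift" using sx by blast
  qed
qed

end

section \<open>The map to the plane\<close>

instance letter :: finite
proof
  show "finite (UNIV :: letter set)"
    by (rule finite_subset[of _ "{La, Lb, Lc}"]) (auto intro: letter.exhaust)
qed

fun splits :: "'a list \<Rightarrow> ('a list \<times> 'a) set" where
  "splits [] = {}"
| "splits (y # w) = insert ([], y) ((\<lambda>(p, x). (y # p, x)) ` splits w)"

lemma finite_splits [simp]: "finite (splits w)"
  by (induction w) auto

lemma splits_iff: "(p, x) \<in> splits w \<longleftrightarrow> (\<exists>q. w = p @ x # q)"
  by (induction w arbitrary: p) (auto simp: Cons_eq_append_conv image_iff split: prod.splits)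

section \<open>The dominant root and its complex conjugates\<close>

text \<open>\<open>bet_square\<close> is the quadratic factor left when X^3 - k X^2 - X - 1 is
  divided by X - lam. \<open>Im_bet\<close> selects one of its two roots and makes 1 and
  \<open>bet\<close> a real basis of the plane.\<close>

locale pisot =
  fixes k :: nat and lam :: real and bet :: complex
  assumes lam_gt_1: "lam > 1"
    and lam_eq: "lam ^ 3 = real k * lam ^ 2 + lam + 1"
    and bet_square: "bet ^ 2 = of_real (real k - lam) * bet - of_real (1 / lam)"
    and norm_bet_square: "cmod bet ^ 2 = 1 / lam"
    and Im_bet: "Im bet > 0"

text \<open>The quadratic factor has linear coefficient s = lam - k = (lam + 1) / lam^2 and constant
  term 1 / lam. Its discriminant is negative because (lam + 1)^2 < 4 lam^3, which follows from lam >
  1.\<close>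

lemma pisot_exists: "\<exists>lam bet. pisot k lam bet"
proof -
  define f where "f x = x ^ 3 - real k * x ^ 2 - x - 1" for x :: real
  have "f (real k + 2) > 0" by (simp add: f_def power2_eq_square power3_eq_cube algebra_simps)
      (intro add_pos_nonneg; simp)
  moreover have "f 1 < 0" by (simp add: f_def)
  moreover have "continuous_on {1..real k + 2} f" unfolding f_def by (intro continuous_intros)
  ultimately obtain lam where lam: "1 \<le> lam" "f lam = 0" using IVT'[of f 1 0 "real k + 2"] by auto
  with \<open>f 1 < 0\<close> have gt: "lam > 1" by (cases "lam = 1") auto
  have eq: "lam ^ 3 = real k * lam ^ 2 + lam + 1" using lam(2) by (simp add: f_def)
  define s where "s = lam - real k"
  have "s * lam ^ 2 = lam + 1" using eq by (simp add: s_def power2_eq_square power3_eq_cube algebra_simps)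
  then have s: "s = (lam + 1) / lam ^ 2" using gt by (simp add: field_simps)
  have "(lam + 1) ^ 2 < (2 * lam) ^ 2" using gt by (intro power_strict_mono) auto
  also have "\<dots> \<le> 4 * lam ^ 3" using gt by (simp add: power2_eq_square power3_eq_cube)
  finally have "(lam + 1) ^ 2 < 4 * lam ^ 3" .
  then have disc: "s ^ 2 / 4 < 1 / lam" using gt
    by (simp add: s power_divide divide_simps power2_eq_square power3_eq_cube)
  define bet where "bet = Complex (- s / 2) (sqrt (1 / lam - s ^ 2 / 4))"
  have sq: "(sqrt (1 / lam - s ^ 2 / 4)) ^ 2 = 1 / lam - s ^ 2 / 4" using disc by simp
  have "cmod bet ^ 2 = 1 / lam" unfolding cmod_power2 bet_def using sq by (simp add: power2_eq_square)
  moreover have "bet ^ 2 = of_real (real k - lam) * bet - of_real (1 / lam)"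
  proof (rule complex_eqI)
    show "Re (bet ^ 2) = Re (of_real (real k - lam) * bet - of_real (1 / lam))"
      using sq by (simp add: bet_def power2_eq_square flip: s_def) (simp add: s_def algebra_simps)
    show "Im (bet ^ 2) = Im (of_real (real k - lam) * bet - of_real (1 / lam))"
      by (simp add: bet_def power2_eq_square s_def algebra_simps)
  qed
  moreover have "Im bet > 0" using disc by (simp add: bet_def)
  ultimately show ?thesis using gt eq by (intro exI[of _ lam] exI[of _ bet]) (simp add: pisot_def)
qed

context pisot begin

lemma lam_pos: "lam > 0" using lam_gt_1 by simp

lemma lam_minus_k: "lam - real k = 1 / lam + 1 / lam ^ 2"
proof -
  have "(lam - real k) * lam ^ 2 = lam + 1" using lam_eq by (simp add: power2_eq_square power3_eq_cube algebra_simps)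
  then show ?thesis using lam_pos by (simp add: field_simps power2_eq_square)
qed

lemma bet_cube: "bet ^ 3 = of_nat k * bet ^ 2 + bet + 1"
proof -
  define L where "L = complex_of_real lam"
  have L0: "L \<noteq> 0" using lam_pos by (simp add: L_def)
  have L: "L ^ 3 = of_nat k * L ^ 2 + L + 1"
    unfolding L_def using arg_cong[OF lam_eq, of complex_of_real] by simp
  have sq: "bet ^ 2 = (of_nat k - L) * bet - 1 / L" using bet_square by (simp add: L_def)
  then have 1: "L * bet ^ 2 + (L * L - of_nat k * L) * bet + 1 = 0" using L0 by (simp add: field_simps)
  have "L * (bet ^ 3 - of_nat k * bet ^ 2 - bet - 1) =
      (bet - L) * (L * bet ^ 2 + (L * L - of_nat k * L) * bet + 1) + (L ^ 3 - of_nat k * L ^ 2 - L - 1) * bet"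
    by (simp add: power2_eq_square power3_eq_cube algebra_simps)
  also have "\<dots> = 0" using 1 L by simp
  finally have "bet ^ 3 - of_nat k * bet ^ 2 - bet - 1 = 0" using L0 by (simp only: mult_eq_0_iff) simp
  then show ?thesis by (simp add: algebra_simps)
qed

lemma norm_bet_less_1: "cmod bet < 1"
proof (rule ccontr)
  assume "\<not> cmod bet < 1"
  then have "cmod bet ^ 2 \<ge> 1" by simp
  then show False unfolding norm_bet_square using lam_gt_1 by (simp add: field_simps)
qed

lemma norm_bet_pos: "cmod bet > 0" using Im_bet by auto

text \<open>The weights \<open>bet\<^sup>2, 1, bet\<close> of the letters form the left eigenvector of the incidence matrix for \<open>bet\<close>.\<close>

fun zt :: "vec3 \<Rightarrow> complex" where
  "zt (x, y, z) = of_int x * bet ^ 2 + of_int y + of_int z * bet"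

lemma zt_zero [simp]: "zt 0 = 0" by (simp add: zero_prod_def)

lemma zt_add: "zt (g + h) = zt g + zt h"
  by (cases g; cases h) (simp add: algebra_simps)

lemma zt_diff: "zt (g - h) = zt g - zt h"
  by (cases g; cases h) (simp add: algebra_simps)

lemma zt_uminus: "zt (- g) = - zt g"
  by (cases g) (simp add: algebra_simps)

lemma zt_inc: "zt (inc k g) = bet * zt g"
proof (cases g)
  case (fields x y z)
  have "bet * zt g = of_int x * bet ^ 3 + of_int y * bet + of_int z * bet ^ 2"
    by (simp add: fields power2_eq_square power3_eq_cube algebra_simps)
  then show ?thesis by (simp add: fields bet_cube algebra_simps)
qed

lemma norm_zt_letter: "cmod (zt (letter_vec x)) \<le> 1"
  using norm_bet_less_1 by (cases x) (auto simp: norm_power power_le_one)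

lemma norm_zt_word: "cmod (zt (word_vec w)) \<le> length w"
proof (induction w)
  case (Cons x w)
  have "cmod (zt (word_vec (x # w))) \<le> cmod (zt (letter_vec x)) + cmod (zt (word_vec w))"
    by (simp add: zt_add norm_triangle_ineq)
  with Cons norm_zt_letter[of x] show ?case by simp
qed simp

text \<open>The fixed point of C = |bet| C + (k + 2). Passing to the image multiplies a prefix
  weight by \<open>bet\<close>, and the incomplete block at its end adds at most k + 2 letters of
  weight at most 1 in modulus.\<close>

definition bound :: real where
  "bound = (real k + 2) / (1 - cmod bet)"

lemma bound_pos: "bound > 0"
  using norm_bet_less_1 by (simp add: bound_def)

lemma bound_fix: "cmod bet * bound + (real k + 2) = bound"
proof -
  have "(1 - cmod bet) * bound = real k + 2" using norm_bet_less_1 by (simp add: bound_def)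
  then show ?thesis by (simp add: algebra_simps)
qed

lemma norm_zt_prefix_iter: "iter k m = p @ r \<Longrightarrow> cmod (zt (word_vec p)) \<le> bound"
proof (induction m arbitrary: p r)
  case 0
  then have "length p \<le> 1" by (cases p) (auto simp: iter_def)
  moreover have "1 \<le> bound"
    using norm_bet_less_1 norm_bet_pos by (simp add: bound_def field_simps)
  ultimately show ?case using norm_zt_word[of p] by linarith
next
  case (Suc m)
  have e: "subst_word (sk k) (iter k m) = p @ r" using Suc.prems by (simp add: iter_Suc)
  have "\<exists>v1 v2 p0. iter k m = v1 @ v2 \<and> p = subst_word (sk k) v1 @ p0 \<and> length p0 \<le> k + 2"
  proof (cases "r = []")
    case True
    then show ?thesis using e by (intro exI[of _ "iter k m"] exI[of _ "[]"]) simp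
  next
    case False
    from subst_word_prefixE[OF e False] obtain v1 y v2 p0 r0 where
      *: "iter k m = v1 @ y # v2" "p = subst_word (sk k) v1 @ p0" "sk k y = p0 @ r0"
      "r0 \<noteq> []" "r = r0 @ subst_word (sk k) v2" by blast
    have "length p0 \<le> k + 2" using length_sk[of k y] *(3) by simp
    with *(1,2) show ?thesis by (intro exI[of _ v1] exI[of _ "y # v2"] exI[of _ p0]) simp
  qed
  then obtain v1 v2 p0 where *: "iter k m = v1 @ v2" "p = subst_word (sk k) v1 @ p0" "length p0 \<le> k + 2" by blast
  have "cmod (zt (word_vec p)) \<le> cmod (bet * zt (word_vec v1)) + cmod (zt (word_vec p0))"
    by (simp add: * word_vec_subst zt_add zt_inc norm_triangle_ineq)
  also have "\<dots> \<le> cmod bet * bound + (real k + 2)"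
    using Suc.IH[OF *(1)] norm_zt_word[of p0] *(3) by (intro add_mono) (simp_all add: norm_mult mult_left_mono)
  finally show ?case by (simp add: bound_fix)
qed

lemma norm_zt_occurs: "occurs k p w \<Longrightarrow> cmod (zt (word_vec p)) \<le> bound"
  unfolding occurs_def using norm_zt_prefix_iter by blast

section \<open>Convergence of prefix weights\<close>

primrec sync_len :: "nat \<Rightarrow> nat" where
  "sync_len 0 = 0"
| "sync_len (Suc j) = (k + 2) * (sync_len j + 2)"

text \<open>A word of length \<open>sync_len j\<close> can be desubstituted j times in common for
  both occurrences. Each time the common part cancels and the difference of the two weights is
  divided by \<open>bet\<close>; at the end it is at most twice \<open>bound\<close>.\<close>

lemma zt_occurs_close:
  "occurs k p w \<Longrightarrow> occurs k p' w \<Longrightarrow> length w \<ge> sync_len j \<Longrightarrow>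
    cmod (zt (word_vec p) - zt (word_vec p')) \<le> 2 * bound * cmod bet ^ j"
proof (induction j arbitrary: p p' w)
  case 0
  then have "cmod (zt (word_vec p)) \<le> bound" "cmod (zt (word_vec p')) \<le> bound"
    using norm_zt_occurs by blast+
  then show ?case using norm_triangle_ineq4[of "zt (word_vec p)" "zt (word_vec p')"] by simp
next
  case (Suc j)
  obtain h w1 p1 p1' where *: "length w1 = sync_len j" "occurs k p1 w1" "occurs k p1' w1"
    "p @ h = subst_word (sk k) p1" "p' @ h = subst_word (sk k) p1'"
    using occurs_desubst[OF Suc.prems(1,2), of "sync_len j"] Suc.prems(3) by auto
  have a: "zt (word_vec p) + zt (word_vec h) = bet * zt (word_vec p1)"
    using arg_cong[OF *(4), of "\<lambda>w. zt (word_vec w)"] by (simp add: zt_add word_vec_subst zt_inc)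
  have b: "zt (word_vec p') + zt (word_vec h) = bet * zt (word_vec p1')"
    using arg_cong[OF *(5), of "\<lambda>w. zt (word_vec w)"] by (simp add: zt_add word_vec_subst zt_inc)
  have "zt (word_vec p) - zt (word_vec p') = bet * (zt (word_vec p1) - zt (word_vec p1'))"
    unfolding right_diff_distrib a[symmetric] b[symmetric] by simp
  then show ?case using Suc.IH[OF *(2,3)] *(1) norm_bet_pos
    by (simp add: norm_mult mult_left_mono mult.left_commute)
qed

definition address :: "(nat \<Rightarrow> letter) \<Rightarrow> nat \<Rightarrow> letter list" where
  "address x n = (SOME p. occurs k p (map x [0..<n]))"

text \<open>The prefixes chosen by \<open>address\<close> for different n are unrelated; the limit
  exists and is independent of the choices because of \<open>zt_occurs_close\<close>.\<close>

definition rz :: "(nat \<Rightarrow> letter) \<Rightarrow> complex" where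
  "rz x = lim (\<lambda>n. zt (word_vec (address x n)))"

lemma occurs_address: "x \<in> language_shift k \<Longrightarrow> occurs k (address x n) (map x [0..<n])"
  unfolding address_def language_shift_def by (rule someI_ex) blast

lemma occurs_shorter: "occurs k p (map x [0..<n]) \<Longrightarrow> m \<le> n \<Longrightarrow> occurs k p (map x [0..<m])"
  using occurs_take[of k p "map x [0..<n]" m] by (simp add: take_map)

lemma bet_pow_small: "c > 0 \<Longrightarrow> e > 0 \<Longrightarrow> \<exists>j. c * cmod bet ^ j < e"
proof -
  assume "c > 0" "e > 0"
  then obtain j where "cmod bet ^ j < e / c" using real_arch_pow_inv[of "e / c" "cmod bet"] norm_bet_less_1 by auto
  then show ?thesis using \<open>c > 0\<close> by (auto simp: field_simps)
qed

text \<open>Any prefix before a long initial word of \<open>x\<close> approximates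
  \<open>rz x\<close>, with an error that depends only on the length of that word. Continuity and
  the shift relation both follow from this uniformity.\<close>

lemma rz_close:
  assumes x: "x \<in> language_shift k" and p: "occurs k p (map x [0..<sync_len j])"
  shows "cmod (zt (word_vec p) - rz x) \<le> 2 * bound * cmod bet ^ j"
proof -
  let ?a = "\<lambda>n. zt (word_vec (address x n))"
  have close: "cmod (zt (word_vec p) - ?a n) \<le> 2 * bound * cmod bet ^ j"
    if "occurs k p (map x [0..<sync_len j])" "n \<ge> sync_len j" for p n j
    using that occurs_shorter[OF occurs_address[OF x]] by (intro zt_occurs_close[of _ "map x [0..<sync_len j]"]) auto
  have "Cauchy ?a"
  proof (rule metric_CauchyI)
    fix e :: real assume "e > 0"
    then obtain j where j: "2 * bound * cmod bet ^ j < e" using bet_pow_small[of "2 * bound" e] bound_pos by auto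
    have "dist (?a m) (?a n) < e" if "m \<ge> sync_len j" "n \<ge> sync_len j" for m n
      using close[OF occurs_shorter[OF occurs_address[OF x] that(1)] that(2)] j unfolding dist_norm by linarith
    then show "\<exists>M. \<forall>m\<ge>M. \<forall>n\<ge>M. dist (?a m) (?a n) < e" by blast
  qed
  then have "?a \<longlonglongrightarrow> rz x" unfolding rz_def by (simp add: Cauchy_convergent_iff convergent_LIMSEQ_iff)
  then have "(\<lambda>n. cmod (zt (word_vec p) - ?a n)) \<longlonglongrightarrow> cmod (zt (word_vec p) - rz x)"
    by (intro tendsto_intros)
  then show ?thesis using close[OF p] by (intro LIMSEQ_le_const2) auto
qed

lemma continuous_on_rz: "continuous_on (language_shift k) rz"
  unfolding continuous_on_def
proof (intro ballI tendstoI)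
  fix x e assume x: "x \<in> language_shift k" and e: "(0::real) < e"
  then obtain j where j: "4 * bound * cmod bet ^ j < e" using bet_pow_small[of "4 * bound" e] bound_pos by auto
  have "dist (rz y) (rz x) < e" if y: "y \<in> language_shift k" "\<forall>i<sync_len j. y i = x i" for y
  proof -
    have e: "map y [0..<sync_len j] = map x [0..<sync_len j]" using y(2) by auto
    have "occurs k (address x (sync_len j)) (map x [0..<sync_len j])" by (rule occurs_address[OF x])
    from rz_close[OF x this] rz_close[OF y(1), of "address x (sync_len j)" j, unfolded e, OF this]
    have "dist (rz y) (rz x) \<le> 2 * bound * cmod bet ^ j + 2 * bound * cmod bet ^ j"
      by (metis add_mono dist_commute dist_norm dist_triangle_le)
    then show ?thesis using j by simp
  qed
  then show "\<forall>\<^sub>F y in at x within language_shift k. dist (rz y) (rz x) < e"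
    unfolding eventually_at_topological using open_cylinder[of "sync_len j" x]
    by (intro exI[of _ "{y. \<forall>i<sync_len j. y i = x i}"]) auto
qed

lemma rz_word_shift:
  assumes x: "x \<in> language_shift k"
  shows "rz (word_shift x) = rz x + zt (letter_vec (x 0))"
proof (rule ccontr)
  let ?d = "cmod (rz (word_shift x) - (rz x + zt (letter_vec (x 0))))"
  assume "rz (word_shift x) \<noteq> rz x + zt (letter_vec (x 0))"
  then obtain j where j: "4 * bound * cmod bet ^ j < ?d" using bet_pow_small[of "4 * bound" ?d] bound_pos by auto
  \<comment> \<open>One letter more than \<open>sync_len j\<close>, since the shifted sequence loses
    the first.\<close>
  let ?p = "address x (Suc (sync_len j))"
  have o: "occurs k ?p (map x [0..<Suc (sync_len j)])" by (rule occurs_address[OF x])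
  have "map x [0..<Suc (sync_len j)] = [x 0] @ map (word_shift x) [0..<sync_len j]"
    by (intro nth_equalityI) (auto simp: word_shift_def nth_Cons split: nat.split simp del: upt_Suc)
  with o have "occurs k (?p @ [x 0]) (map (word_shift x) [0..<sync_len j])" by (metis occurs_suffix)
  moreover have "word_shift x \<in> language_shift k" using x word_shift_language_shift by blast
  ultimately have 1: "cmod (zt (word_vec (?p @ [x 0])) - rz (word_shift x)) \<le> 2 * bound * cmod bet ^ j"
    by (intro rz_close)
  have 2: "cmod (zt (word_vec ?p) - rz x) \<le> 2 * bound * cmod bet ^ j"
    using o by (intro rz_close x occurs_shorter[OF o]) auto
  have "?d = cmod ((zt (word_vec ?p) - rz x) - (zt (word_vec (?p @ [x 0])) - rz (word_shift x)))"
    by (simp add: zt_add algebra_simps)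
  also have "\<dots> \<le> 4 * bound * cmod bet ^ j" 
    by (rule order_trans[OF norm_triangle_ineq4]) (use 1 2 in linarith)
  finally show False using j by simp
qed

section \<open>Rauzy fractal pieces\<close>

definition tile :: "letter \<Rightarrow> complex set" where
  "tile i = closure {zt (word_vec p) | p. occurs k p [i]}"

lemma norm_tile: "z \<in> tile i \<Longrightarrow> cmod z \<le> bound"
proof -
  have "tile i \<subseteq> cball 0 bound" unfolding tile_def
    by (intro closure_minimal) (auto simp: norm_zt_occurs)
  then show "z \<in> tile i \<Longrightarrow> cmod z \<le> bound" by auto
qed

lemma compact_tile: "compact (tile i)"
  using norm_tile by (auto simp: compact_eq_bounded_closed tile_def bounded_iff)

lemma rz_in_tile:
  assumes x: "x \<in> language_shift k"
  shows "rz x \<in> tile (x 0)"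
  unfolding tile_def closure_approachable
proof (intro allI impI)
  fix e :: real assume "e > 0"
  then obtain j where j: "2 * bound * cmod bet ^ j < e" using bet_pow_small[of "2 * bound" e] bound_pos by auto
  have o: "occurs k (address x (Suc (sync_len j))) (map x [0..<Suc (sync_len j)])" by (rule occurs_address[OF x])
  have "occurs k (address x (Suc (sync_len j))) [x 0]" using occurs_shorter[OF o, of 1] by simp
  moreover have "cmod (zt (word_vec (address x (Suc (sync_len j)))) - rz x) < e"
    using rz_close[OF x occurs_shorter[OF o, of "sync_len j"]] j by auto
  ultimately show "\<exists>y\<in>{zt (word_vec p) |p. occurs k p [x 0]}. dist y (rz x) < e" unfolding dist_norm by blast
qed

text \<open>One half of the graph-directed self-similarity of the pieces: desubstituting a prefix
  before i gives a prefix before some j and a position of i in the image of j. The right-hand side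
  is closed, so it suffices to treat prefix weights.\<close>

lemma tile_subset:
  "tile i \<subseteq> (\<Union>j. \<Union>(p, x)\<in>{s \<in> splits (sk k j). snd s = i}. (\<lambda>z. bet * z + zt (word_vec p)) ` tile j)"
    (is "_ \<subseteq> ?R")
proof -
  have "compact ?R"
    by (intro compact_UN finite_subset[OF _ finite_splits] finite_UNIV)
      (auto simp: split_beta intro!: compact_continuous_image compact_tile continuous_intros)
  then have "closed ?R" by (rule compact_imp_closed)
  moreover have "zt (word_vec p) \<in> ?R" if p: "occurs k p [i]" for p
  proof -
    obtain m q where mq: "iter k (Suc m) = p @ i # q"
    proof -
      from p obtain m q where m: "iter k m = p @ i # q" by (auto simp: occurs_def)
      show ?thesis
      proof (cases m)
        case 0
        \<comment> \<open>The word \<open>iter k 0\<close> has no preimage; the same occurrence,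
          with empty prefix, is found again at the beginning of \<open>iter k 3\<close>.\<close>
        then have "p = []" "i = La" using m by (auto simp: iter_def Cons_eq_append_conv)
        then show ?thesis using iter_three[of k] that[of 2] by (metis append_Nil numeral_3_eq_3 numeral_2_eq_2)
      qed (use m that in blast)
    qed
    then have "subst_word (sk k) (iter k m) = p @ (i # q)" by (simp add: iter_Suc)
    from subst_word_prefixE[OF this] obtain v1 y v2 p0 r0 where *: "iter k m = v1 @ y # v2"
      "p = subst_word (sk k) v1 @ p0" "sk k y = p0 @ r0" "r0 \<noteq> []" "i # q = r0 @ subst_word (sk k) v2" by blast
    then obtain r1 where "r0 = i # r1" by (cases r0) auto
    then have "(p0, i) \<in> splits (sk k y)" using * by (auto simp: splits_iff)
    moreover have "occurs k v1 [y]" unfolding occurs_def using *(1) by auto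
    then have "zt (word_vec v1) \<in> tile y" 
      unfolding tile_def by (intro subsetD[OF closure_subset] CollectI exI[of _ v1] conjI refl)
    moreover have "zt (word_vec p) = bet * zt (word_vec v1) + zt (word_vec p0)"
      by (simp add: * word_vec_subst zt_add zt_inc)
    ultimately show ?thesis by (intro UN_I[of y] UN_I[of "(p0, i)"]) auto
  qed
  ultimately show ?thesis unfolding tile_def[of i] by (intro closure_minimal subsetI) (elim CollectE exE conjE; simp only:)
qed

end

section \<open>Overlaps of tiles\<close>

text \<open>Passage to cartesian vectors, where a linear map acts on volume through the determinant
  of its matrix.\<close>

definition plane :: "complex \<Rightarrow> real^2" where
  "plane z = vector [Re z, Im z]"

lemma linear_plane: "linear plane"
  by (rule linearI) (simp_all add: plane_def vec_eq_iff forall_2)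

definition area :: "complex set \<Rightarrow> real" where
  "area S = measure lebesgue (plane ` S)"

lemma compact_plane_image: "compact S \<Longrightarrow> compact (plane ` S)"
  by (intro compact_continuous_image linear_continuous_on linear_plane[unfolded linear_conv_bounded_linear])

lemma lmeasurable_plane_image: "compact S \<Longrightarrow> plane ` S \<in> lmeasurable"
  by (intro lmeasurable_compact compact_plane_image)

lemma area_nonneg: "area S \<ge> 0" by (simp add: area_def)

lemma area_translate: "area ((\<lambda>z. z + c) ` S) = area S"
proof -
  have "plane ` (\<lambda>z. z + c) ` S = (+) (plane c) ` (plane ` S)"
    by (simp add: image_image linear_add[OF linear_plane] add.commute)
  then show ?thesis by (simp add: area_def measure_translation)
qed

lemma area_scale:
  assumes "compact S"
  shows "area ((\<lambda>z. b * z + c) ` S) = cmod b ^ 2 * area S"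
proof -
  \<comment> \<open>The matrix of multiplication by b; its determinant is |b|^2.\<close>
  define A :: "real^2^2" where "A = vector [vector [Re b, - Im b], vector [Im b, Re b]]"
  have "plane (b * z) = A *v plane z" for z
    by (simp add: plane_def A_def vec_eq_iff forall_2 matrix_vector_mult_def sum_2)
  then have "plane ` (*) b ` S = (*v) A ` (plane ` S)" by (simp add: image_image)
  then have "area ((*) b ` S) = \<bar>det (matrix ((*v) A))\<bar> * area S"
    unfolding area_def using measure_linear_image[OF matrix_vector_mul_linear lmeasurable_plane_image[OF assms], of A] by simp
  also have "det (matrix ((*v) A)) = (Re b)\<^sup>2 + (Im b)\<^sup>2"
    by (simp add: matrix_of_matrix_vector_mul det_2 A_def power2_eq_square)
  also have "\<bar>\<dots>\<bar> = cmod b ^ 2" by (simp add: cmod_power2)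
  finally show ?thesis using area_translate[of c "(*) b ` S"] by (simp add: image_image)
qed

lemma area_mono: "compact S \<Longrightarrow> compact T \<Longrightarrow> S \<subseteq> T \<Longrightarrow> area S \<le> area T"
  unfolding area_def by (intro measure_mono_fmeasurable image_mono lmeasurable_plane_image fmeasurableD) auto

lemma area_UN_le:
  assumes "finite I" "\<And>i. i \<in> I \<Longrightarrow> compact (F i)"
  shows "area (\<Union>i\<in>I. F i) \<le> (\<Sum>i\<in>I. area (F i))"
  unfolding area_def image_UN
  by (intro measure_UNION_le assms fmeasurableD lmeasurable_plane_image)

definition seg_overlap :: "real \<Rightarrow> real \<Rightarrow> real \<Rightarrow> real \<Rightarrow> real" where
  "seg_overlap a b c d = max 0 (min b d - max a c)"

lemma seg_overlap_split:
  assumes "c \<le> d" "a \<le> b" "b \<le> e"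
  shows "seg_overlap a e c d = seg_overlap a b c d + seg_overlap b e c d"
  using assms unfolding seg_overlap_def by (auto simp: max_def min_def)

lemma seg_overlap_commute: "seg_overlap a b c d = seg_overlap c d a b"
  by (simp add: seg_overlap_def min.commute max.commute)

text \<open>The incidence matrix is unimodular, so the displacement of a parent overlap is again an
  integer vector.\<close>

fun dec :: "nat \<Rightarrow> vec3 \<Rightarrow> vec3" where
  "dec k (x, y, z) = (y, z - y, x - int k * y)"

lemma inc_dec [simp]: "inc k (dec k g) = g" by (cases g) simp

lemma dec_inc [simp]: "dec k (inc k g) = g" by (cases g) simp

text \<open>The edges of the prefix automaton read backwards: all ways in which a tile x arises in
  an inflated tile i.\<close>

definition occs :: "nat \<Rightarrow> letter \<Rightarrow> (letter \<times> letter list) set" where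
  "occs k x = {(i, p). (p, x) \<in> splits (sk k i)}"

lemma finite_occs [simp]: "finite (occs k x)"
proof -
  have "occs k x \<subseteq> (\<Union>i. Pair i ` fst ` splits (sk k i))" by (force simp: occs_def)
  then show ?thesis by (rule finite_subset) auto
qed

type_synonym overlap = "vec3 \<times> letter \<times> letter"

context pisot begin

text \<open>The counterpart of \<open>zt\<close> for the conjugate \<open>lam\<close>; the weights
  lam^2, 1, lam of the letters are the tile lengths.\<close>

fun el :: "vec3 \<Rightarrow> real" where
  "el (x, y, z) = of_int x * lam ^ 2 + of_int y + of_int z * lam"

abbreviation len :: "letter \<Rightarrow> real" where
  "len i \<equiv> el (letter_vec i)"

lemma el_zero [simp]: "el 0 = 0" by (simp add: zero_prod_def)

lemma el_add: "el (g + h) = el g + el h"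
  by (cases g; cases h) (simp add: algebra_simps)

lemma el_diff: "el (g - h) = el g - el h"
  by (cases g; cases h) (simp add: algebra_simps)

lemma el_uminus: "el (- g) = - el g"
  by (cases g) (simp add: algebra_simps)

lemma el_inc: "el (inc k g) = lam * el g"
proof (cases g)
  case (fields x y z)
  have "lam * el g = of_int x * lam ^ 3 + of_int y * lam + of_int z * lam ^ 2"
    by (simp add: fields power2_eq_square power3_eq_cube algebra_simps)
  then show ?thesis by (simp add: fields lam_eq algebra_simps)
qed

lemma len_pos: "len i > 0" using lam_pos by (cases i) auto

lemma el_word_nonneg: "el (word_vec w) \<ge> 0"
proof (induction w)
  case (Cons x w)
  then show ?case using len_pos[of x] by (simp add: el_add)
qed simp

lemma len_subst: "el (word_vec (sk k i)) = lam * len i"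
  using el_inc[of "letter_vec i"] word_vec_subst[of k "[i]"] by simp

text \<open>The overlap \<open>(g, i, j)\<close> is a tile \<open>i\<close> whose left end is at distance \<open>el g\<close> from that of a tile \<open>j\<close>.\<close>

fun olen :: "overlap \<Rightarrow> real" where
  "olen (g, i, j) = seg_overlap (el g) (el g + len i) 0 (len j)"

fun coincident :: "overlap \<Rightarrow> bool" where
  "coincident (g, i, j) \<longleftrightarrow> g = 0 \<and> i = j"

fun mass :: "overlap \<Rightarrow> real" where
  "mass (g, i, j) = area (tile i \<inter> (\<lambda>z. z + zt g) ` tile j)"

fun children :: "overlap \<Rightarrow> ((letter list \<times> letter) \<times> (letter list \<times> letter)) set" where
  "children (g, i, j) = splits (sk k i) \<times> splits (sk k j)"

fun child :: "overlap \<Rightarrow> (letter list \<times> letter) \<times> (letter list \<times> letter) \<Rightarrow> overlap" where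
  "child (g, i, j) ((p, x), (q, y)) = (inc k g + word_vec p - word_vec q, x, y)"

lemma olen_nonneg: "olen ov \<ge> 0" by (cases ov) (simp add: seg_overlap_def)

lemma olen_pos_iff: "olen (g, i, j) > 0 \<longleftrightarrow> - len i < el g \<and> el g < len j"
  using len_pos[of i] len_pos[of j] by (auto simp: seg_overlap_def max_def min_def)

lemma mass_nonneg: "mass ov \<ge> 0" by (cases ov) (simp add: area_nonneg)

lemma finite_children: "finite (children ov)" by (cases ov) simp

lemma compact_tile_translate: "compact ((\<lambda>z. z + c) ` tile j)"
  by (intro compact_continuous_image compact_tile continuous_intros)

lemma compact_tile_Int: "compact (tile i \<inter> (\<lambda>z. z + c) ` tile j)"
  by (intro compact_Int compact_tile compact_tile_translate)

text \<open>By \<open>tile_subset\<close> a point of the intersection is the image of points of two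
  parent pieces under maps with the same factor \<open>bet\<close>. Subtracting the two addresses
  shows that these points differ by the parent displacement, and the factor contracts areas by
  |bet|^2 = 1 / lam.\<close>

lemma mass_le:
  "mass (g', x, y) \<le> (1 / lam) * (\<Sum>((i, p), (j, q))\<in>occs k x \<times> occs k y.
      mass (dec k (g' - word_vec p + word_vec q), i, j))"
proof -
  let ?I = "occs k x \<times> occs k y"
  define F where "F = (\<lambda>((i, p), (j, q)). (\<lambda>z. bet * z + zt (word_vec p)) `
      (tile i \<inter> (\<lambda>z. z + zt (dec k (g' - word_vec p + word_vec q))) ` tile j))"
  have cF: "compact (F a)" for a
    unfolding F_def by (cases a) (auto simp: split_beta intro!: compact_continuous_image compact_tile_Int continuous_intros)
  have sub: "tile x \<inter> (\<lambda>z. z + zt g') ` tile y \<subseteq> (\<Union>a\<in>?I. F a)"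
  proof
    fix z assume z: "z \<in> tile x \<inter> (\<lambda>z. z + zt g') ` tile y"
    then obtain z' where z': "z' \<in> tile y" "z = z' + zt g'" by auto
    from z tile_subset[of x] obtain i p w where w: "(p, x) \<in> splits (sk k i)" "w \<in> tile i" "z = bet * w + zt (word_vec p)"
      by fastforce
    from z' tile_subset[of y] obtain j q w' where w': "(q, y) \<in> splits (sk k j)" "w' \<in> tile j" "z' = bet * w' + zt (word_vec q)"
      by fastforce
    let ?g = "dec k (g' - word_vec p + word_vec q)"
    have "bet * zt ?g = zt g' - zt (word_vec p) + zt (word_vec q)"
      by (simp add: zt_add zt_diff flip: zt_inc)
    also have "\<dots> = bet * (w - w')" using w(3) w'(3) z'(2) by (simp add: algebra_simps)
    finally have "zt ?g = w - w'" using norm_bet_pos by simp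
    then have "w = w' + zt ?g" by simp
    then have "w \<in> tile i \<inter> (\<lambda>z. z + zt ?g) ` tile j" using w(2) w'(2) by blast
    then have "z \<in> F ((i, p), (j, q))" unfolding F_def using w(3) by auto
    moreover have "((i, p), (j, q)) \<in> ?I" using w w' by (simp add: occs_def)
    ultimately show "z \<in> (\<Union>a\<in>?I. F a)" by blast
  qed
  have "mass (g', x, y) \<le> area (\<Union>a\<in>?I. F a)"
    unfolding mass.simps by (intro area_mono compact_tile_Int compact_UN sub cF) auto
  also have "\<dots> \<le> (\<Sum>a\<in>?I. area (F a))" by (intro area_UN_le cF) auto
  also have "\<dots> = (\<Sum>((i, p), (j, q))\<in>?I. (1 / lam) * mass (dec k (g' - word_vec p + word_vec q), i, j))"
    by (intro sum.cong) (auto simp: F_def area_scale compact_tile_Int norm_bet_square)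
  finally show ?thesis by (simp add: sum_distrib_left split_beta)
qed

lemma sum_splits_overlap:
  assumes "c \<le> d"
  shows "(\<Sum>(p, x)\<in>splits w. seg_overlap (a + el (word_vec p)) (a + el (word_vec p) + len x) c d)
    = seg_overlap a (a + el (word_vec w)) c d"
proof (induction w arbitrary: a)
  case (Cons y w)
  let ?f = "\<lambda>a (p, x). seg_overlap (a + el (word_vec p)) (a + el (word_vec p) + len x) c d"
  let ?h = "\<lambda>(p, x). (y # p, x)"
  have "sum (?f a) (splits (y # w)) = ?f a ([], y) + sum (?f a) (?h ` splits w)"
    unfolding splits.simps by (subst sum.insert) auto
  also have "sum (?f a) (?h ` splits w) = sum (?f a \<circ> ?h) (splits w)"
    by (rule sum.reindex) (auto intro: inj_onI)
  also have "\<dots> = sum (?f (a + len y)) (splits w)"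
    by (intro sum.cong) (auto simp: el_add add.assoc)
  also have "\<dots> = seg_overlap (a + len y) (a + len y + el (word_vec w)) c d" by (rule Cons.IH)
  also have "?f a ([], y) + \<dots> = seg_overlap a (a + el (word_vec (y # w))) c d"
    using seg_overlap_split[OF assms, of a "a + len y" "a + el (word_vec (y # w))"] len_pos[of y] el_word_nonneg[of w]
    by (simp add: el_add add.assoc)
  finally show ?case .
qed (simp add: seg_overlap_def)

text \<open>The tiles of each inflated tile subdivide it, so the lengths of the overlaps add up to
  that of the inflated overlap.\<close>

lemma sum_olen_children: "(\<Sum>c\<in>children ov. olen (child ov c)) = lam * olen ov"
proof (cases ov)
  case (fields g i j)
  let ?a = "lam * el g"
  have "(\<Sum>c\<in>children ov. olen (child ov c)) =
    (\<Sum>(p, x)\<in>splits (sk k i). \<Sum>(q, y)\<in>splits (sk k j). olen (inc k g + word_vec p - word_vec q, x, y))"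
    unfolding fields children.simps split_beta sum.cartesian_product
    by (intro sum.cong refl) (auto simp del: olen.simps)
  also have "\<dots> = (\<Sum>(p, x)\<in>splits (sk k i). \<Sum>(q, y)\<in>splits (sk k j).
      seg_overlap (0 + el (word_vec q)) (0 + el (word_vec q) + len y) (?a + el (word_vec p)) (?a + el (word_vec p) + len x))"
  proof (intro sum.cong refl, clarify, intro sum.cong refl, clarify)
    fix p x q y
    show "olen (inc k g + word_vec p - word_vec q, x, y) =
      seg_overlap (0 + el (word_vec q)) (0 + el (word_vec q) + len y) (?a + el (word_vec p)) (?a + el (word_vec p) + len x)"
      by (simp add: el_add el_diff el_inc seg_overlap_def max_def min_def)
  qed
  also have "\<dots> = (\<Sum>(p, x)\<in>splits (sk k i). seg_overlap 0 (0 + el (word_vec (sk k j))) (?a + el (word_vec p)) (?a + el (word_vec p) + len x))"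
    using len_pos by (intro sum.cong refl) (auto simp: less_imp_le intro!: sum_splits_overlap[of _ _ 0, simplified])
  also have "\<dots> = (\<Sum>(p, x)\<in>splits (sk k i). seg_overlap (?a + el (word_vec p)) (?a + el (word_vec p) + len x) 0 (el (word_vec (sk k j))))"
    by (intro sum.cong refl) (auto simp: seg_overlap_commute)
  also have "\<dots> = seg_overlap ?a (?a + el (word_vec (sk k i))) 0 (el (word_vec (sk k j)))"
    by (rule sum_splits_overlap) (rule el_word_nonneg)
  also have "\<dots> = seg_overlap (lam * el g) (lam * (el g + len i)) (lam * 0) (lam * len j)"
    by (simp add: len_subst algebra_simps)
  also have "\<dots> = lam * olen ov"
  proof -
    have "max (lam * a) (lam * b) = lam * max a b" "min (lam * a) (lam * b) = lam * min a b"
      "max 0 (lam * a) = lam * max 0 a" for a b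
      using lam_pos by (simp_all add: max_def min_def zero_le_mult_iff)
    then show ?thesis
      unfolding fields olen.simps seg_overlap_def by (simp only: flip: right_diff_distrib)
  qed
  finally show ?thesis .
qed

text \<open>The pair (\<open>el\<close>, \<open>zt\<close>) is a linear isomorphism from real
  3-space to R x C, so a bounded region contains finitely many integer vectors. The constants below
  invert it explicitly.\<close>

lemma finite_bounded_vectors: "finite {g. cmod (zt g) \<le> a \<and> \<bar>el g\<bar> \<le> b}"
proof -
  define s where "s = lam - real k"
  have s: "s > 0" using lam_pos unfolding s_def lam_minus_k by (auto intro: add_pos_pos)
  define C1 where "C1 = a / Im bet"
  define C2 where "C2 = a + C1"
  define C3 where "C3 = b + C2 + lam * C1"
  define R where "R = C3 + C2 + C1 + (s + 1) * C3"
  define n where "n = \<lceil>R\<rceil>"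
  have "\<bar>x\<bar> \<le> n \<and> \<bar>y\<bar> \<le> n \<and> \<bar>z\<bar> \<le> n" if g: "cmod (zt (x, y, z)) \<le> a" "\<bar>el (x, y, z)\<bar> \<le> b" for x y z
  proof -
    \<comment> \<open>\<open>A\<close> and \<open>B\<close> are the real coordinates of
      \<open>zt (x, y, z)\<close> in the basis 1, bet. The imaginary part bounds \<open>B\<close>,
      then the modulus bounds \<open>A\<close>.\<close>
    define A where "A = of_int y - of_int x / lam"
    define B where "B = of_int z - of_int x * s"
    have zt: "zt (x, y, z) = of_real A + of_real B * bet"
      by (simp add: A_def B_def s_def bet_square algebra_simps)
    have a0: "a \<ge> 0" using g(1) norm_ge_zero order_trans by blast
    have "\<bar>B\<bar> * Im bet = \<bar>Im (zt (x, y, z))\<bar>" using Im_bet by (simp add: zt abs_mult del: zt.simps)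
    also have "\<dots> \<le> a" using g(1) abs_Im_le_cmod order_trans by blast
    finally have B: "\<bar>B\<bar> \<le> C1" using Im_bet by (simp add: C1_def field_simps)
    have "\<bar>A\<bar> = cmod (zt (x, y, z) - of_real B * bet)" by (simp add: zt del: zt.simps)
    also have "\<dots> \<le> cmod (zt (x, y, z)) + \<bar>B\<bar> * cmod bet"
      using norm_triangle_ineq4[of "zt (x, y, z)" "of_real B * bet"] by (simp add: norm_mult)
    also have "\<dots> \<le> a + C1 * 1" using g(1) B norm_bet_less_1 by (intro add_mono mult_mono) auto
    finally have A: "\<bar>A\<bar> \<le> C2" by (simp add: C2_def)
    \<comment> \<open>Subtracting from \<open>el\<close> its analogue A + lam B leaves a multiple of
      x whose factor is at least 1.\<close>
    have "of_int x * (lam ^ 2 + 1 / lam + lam * s) = el (x, y, z) - A - lam * B"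
      by (simp add: A_def B_def algebra_simps)
    then have "\<bar>of_int x\<bar> * \<bar>lam ^ 2 + 1 / lam + lam * s\<bar> = \<bar>el (x, y, z) - A - lam * B\<bar>"
      by (metis abs_mult)
    also have "\<dots> \<le> \<bar>el (x, y, z)\<bar> + \<bar>A\<bar> + \<bar>lam * B\<bar>" by linarith
    also have "\<dots> \<le> C3" unfolding C3_def using g(2) A B lam_pos by (intro add_mono) (auto simp: abs_mult)
    finally have le: "\<bar>real_of_int x\<bar> * \<bar>lam ^ 2 + 1 / lam + lam * s\<bar> \<le> C3" .
    have "1 \<le> lam ^ 2" using lam_gt_1 by simp
    moreover have "0 \<le> 1 / lam" "0 \<le> lam * s" using lam_pos s by auto
    ultimately have ge: "1 \<le> \<bar>lam ^ 2 + 1 / lam + lam * s\<bar>" by linarith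
    have "\<bar>real_of_int x\<bar> * 1 \<le> \<bar>real_of_int x\<bar> * \<bar>lam ^ 2 + 1 / lam + lam * s\<bar>"
      by (intro mult_left_mono ge) auto
    with le have X: "\<bar>real_of_int x\<bar> \<le> C3" by linarith
    have "\<bar>real_of_int x\<bar> * 1 \<le> \<bar>real_of_int x\<bar> * lam" using lam_gt_1 by (intro mult_left_mono) auto
    then have "\<bar>real_of_int x / lam\<bar> \<le> \<bar>real_of_int x\<bar>" using lam_pos by (simp add: field_simps)
    then have Y: "\<bar>real_of_int y\<bar> \<le> C2 + C3" using A X unfolding A_def by linarith
    have "\<bar>real_of_int x * s\<bar> \<le> s * C3" using X s by (simp add: abs_mult mult.commute)
    then have Z: "\<bar>real_of_int z\<bar> \<le> C1 + s * C3" using B by (simp add: B_def)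
    have C: "0 \<le> C1" "0 \<le> C2" "0 \<le> C3" "0 \<le> s * C3" using B A X s by (auto intro: order_trans[OF abs_ge_zero])
    have R: "R = C3 + C2 + C1 + s * C3 + C3" by (simp add: R_def algebra_simps)
    have "\<bar>real_of_int x\<bar> \<le> R" "\<bar>real_of_int y\<bar> \<le> R" "\<bar>real_of_int z\<bar> \<le> R"
      using X Y Z C R by linarith+
    moreover have "R \<le> of_int n" by (simp add: n_def)
    ultimately show ?thesis by linarith
  qed
  then have "{g. cmod (zt g) \<le> a \<and> \<bar>el g\<bar> \<le> b} \<subseteq> {-n..n} \<times> {-n..n} \<times> {-n..n}"
    by (auto simp: abs_le_iff simp del: zt.simps el.simps) (smt (verit) abs_le_iff)+
  then show ?thesis by (rule finite_subset) auto
qed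

section \<open>The matrix of heavy overlaps\<close>

definition heavy :: "overlap set" where
  "heavy = {ov. olen ov > 0 \<and> \<not> coincident ov \<and> mass ov > 0}"

lemma len_le: "len i \<le> lam ^ 2"
  using lam_gt_1 by (cases i) (auto simp: power2_eq_square intro: order_trans[OF less_imp_le])

text \<open>Positive area makes the two pieces meet, which bounds \<open>zt g\<close>; positive
  overlap length bounds \<open>el g\<close>.\<close>

lemma finite_heavy: "finite heavy"
proof -
  have "cmod (zt g) \<le> 2 * bound \<and> \<bar>el g\<bar> \<le> lam ^ 2" if "(g, i, j) \<in> heavy" for g i j
  proof -
    have "tile i \<inter> (\<lambda>z. z + zt g) ` tile j \<noteq> {}"
      using that by (auto simp: heavy_def area_def)
    then obtain z w where "z \<in> tile i" "w \<in> tile j" "z = w + zt g" by auto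
    then have "cmod (zt g) \<le> 2 * bound"
      using norm_tile[of z i] norm_tile[of w j] norm_triangle_ineq4[of z w] by simp
    moreover have "- len i < el g" "el g < len j"
      using that olen_pos_iff[of g i j] by (auto simp: heavy_def simp del: olen.simps)
    ultimately show ?thesis using len_le[of i] len_le[of j] by linarith
  qed
  then have "heavy \<subseteq> {g. cmod (zt g) \<le> 2 * bound \<and> \<bar>el g\<bar> \<le> lam ^ 2} \<times> UNIV \<times> UNIV" by auto
  then show ?thesis by (rule finite_subset) (auto intro: finite_bounded_vectors)
qed

text \<open>Exchange of the two strands; it allows the displacement to be taken nonnegative.\<close>

lemma heavy_uminus:
  assumes "(g, i, j) \<in> heavy"
  shows "(- g, j, i) \<in> heavy"
proof -
  have "(\<lambda>z. z + zt (- g)) ` (tile i \<inter> (\<lambda>z. z + zt g) ` tile j) = tile j \<inter> (\<lambda>z. z + zt (- g)) ` tile i"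
    by (force simp: zt_uminus image_iff)
  then have "mass (- g, j, i) = mass (g, i, j)" by (metis area_translate mass.simps)
  moreover have "olen (- g, j, i) > 0" using assms olen_pos_iff[of g i j] olen_pos_iff[of "- g" j i]
    by (auto simp: heavy_def el_uminus simp del: olen.simps)
  ultimately show ?thesis using assms by (auto simp: heavy_def)
qed

definition mult :: "overlap \<Rightarrow> overlap \<Rightarrow> nat" where
  "mult ov ov' = card {c \<in> children ov. child ov c = ov'}"

lemma sum_mult_olen:
  assumes "finite O'"
  shows "(\<Sum>ov'\<in>O'. real (mult ov ov') * olen ov') \<le> lam * olen ov"
proof -
  let ?C = "{c \<in> children ov. child ov c \<in> O'}"
  have "(\<Sum>ov'\<in>O'. real (mult ov ov') * olen ov') = (\<Sum>ov'\<in>O'. \<Sum>c\<in>{c \<in> ?C. child ov c = ov'}. olen (child ov c))"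
  proof (intro sum.cong refl)
    fix ov' assume "ov' \<in> O'"
    then have "{c \<in> ?C. child ov c = ov'} = {c \<in> children ov. child ov c = ov'}" by auto
    then show "real (mult ov ov') * olen ov' = (\<Sum>c\<in>{c \<in> ?C. child ov c = ov'}. olen (child ov c))"
      by (simp add: mult_def)
  qed
  also have "\<dots> = (\<Sum>c\<in>?C. olen (child ov c))"
    using assms finite_children by (intro sum.group) auto
  also have "\<dots> \<le> (\<Sum>c\<in>children ov. olen (child ov c))"
    by (intro sum_mono2 finite_children olen_nonneg) auto
  finally show ?thesis by (simp add: sum_olen_children)
qed

text \<open>The inflated parent contains the overlap of its child, so its own length is positive. A
  coincident parent is impossible: two tiles in one inflated tile overlap only if they are the same
  tile.\<close>

lemma parent_heavy:
  assumes ov': "(g', x, y) \<in> heavy" and px: "(p, x) \<in> splits (sk k i)" and qy: "(q, y) \<in> splits (sk k j)"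
    and pos: "mass (dec k (g' - word_vec p + word_vec q), i, j) > 0"
  shows "(dec k (g' - word_vec p + word_vec q), i, j) \<in> heavy"
proof -
  let ?g = "dec k (g' - word_vec p + word_vec q)"
  have ch: "child (?g, i, j) ((p, x), (q, y)) = (g', x, y)" by simp
  have "olen (g', x, y) \<le> (\<Sum>c\<in>children (?g, i, j). olen (child (?g, i, j) c))"
    unfolding ch[symmetric] by (intro member_le_sum olen_nonneg finite_children) (use px qy in auto)
  moreover have "olen (g', x, y) > 0" using ov' by (simp add: heavy_def del: olen.simps)
  ultimately have "0 < lam * olen (?g, i, j)" unfolding sum_olen_children by linarith
  then have "olen (?g, i, j) > 0" using lam_pos by (simp add: zero_less_mult_iff del: olen.simps)
  moreover have "\<not> coincident (?g, i, j)"
  proof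
    assume c: "coincident (?g, i, j)"
    then have ij: "i = j" and "inc k ?g = 0" by auto
    then have g': "g' = word_vec p - word_vec q" by (simp only: inc_dec) (simp add: algebra_simps)
    have o: "- len x < el g'" "el g' < len y"
      using ov' olen_pos_iff[of g' x y] by (auto simp: heavy_def simp del: olen.simps)
    \<comment> \<open>In one word, the tile at the shorter prefix ends before the tile at the longer
      prefix begins.\<close>
    have nested: "el (word_vec v) + len a \<le> el (word_vec w)"
      if vw: "(v, a) \<in> splits u" "(w, b) \<in> splits u" "length v < length w" for u v w a b
    proof -
      obtain r where "u = v @ a # r" using vw(1) by (auto simp: splits_iff)
      moreover obtain r' where "u = w @ b # r'" using vw(2) by (auto simp: splits_iff)
      ultimately have "v @ [a] @ r = w @ (b # r')" by simp
      then obtain t where "w = v @ [a] @ t"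
        using vw(3) by (auto simp: append_eq_append_conv2 Cons_eq_append_conv)
      then show ?thesis using el_word_nonneg[of t] by (simp add: el_add)
    qed
    have "length p = length q"
    proof (rule ccontr)
      assume "length p \<noteq> length q"
      then consider "length p < length q" | "length q < length p" by linarith
      then show False
      proof cases
        case 1
        then show ?thesis using nested[OF px qy[folded ij]] o by (simp add: g' el_diff)
      next
        case 2
        then show ?thesis using nested[OF qy[folded ij] px] o by (simp add: g' el_diff)
      qed
    qed
    then have "p = q \<and> x = y" using px qy ij by (auto simp: splits_iff)
    then show False using ov' g' by (auto simp: heavy_def)
  qed
  ultimately show ?thesis using pos by (simp add: heavy_def)
qed

text \<open>Grouping the sum of \<open>mass_le\<close> by parents gives an inequality for the vector
  of areas. Parents outside \<open>heavy\<close> have area 0 by \<open>parent_heavy\<close>, so the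
  inequality closes up on the finite set.\<close>

lemma mass_heavy_le:
  assumes "ov' \<in> heavy"
  shows "lam * mass ov' \<le> (\<Sum>ov\<in>heavy. real (mult ov ov') * mass ov)"
proof (cases ov')
  case (fields g' x y)
  let ?A = "occs k x \<times> occs k y"
  define h where "h = (\<lambda>((i, p), (j, q)). (dec k (g' - word_vec p + word_vec q), i, j) :: overlap)"
  let ?B = "{a \<in> ?A. h a \<in> heavy}"
  have "lam * mass ov' \<le> (\<Sum>a\<in>?A. mass (h a))"
    using mass_le[of g' x y] lam_pos by (simp add: fields h_def split_beta field_simps)
  also have "\<dots> = (\<Sum>a\<in>?B. mass (h a))"
  proof (rule sum.mono_neutral_right)
    show "\<forall>a\<in>?A - ?B. mass (h a) = 0"
    proof
      fix a assume a: "a \<in> ?A - ?B"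
      obtain i p j q where e: "a = ((i, p), (j, q))" by (metis surj_pair)
      have "h a \<notin> heavy" "(p, x) \<in> splits (sk k i)" "(q, y) \<in> splits (sk k j)" using a by (auto simp: e occs_def)
      then have "\<not> mass (h a) > 0" using parent_heavy[OF assms[unfolded fields]] by (auto simp: e h_def)
      then show "mass (h a) = 0" using mass_nonneg[of "h a"] by simp
    qed
  qed auto
  also have "\<dots> = (\<Sum>ov\<in>heavy. \<Sum>a\<in>{a \<in> ?B. h a = ov}. mass (h a))"
    by (intro sum.group[symmetric] finite_heavy) auto
  also have "\<dots> = (\<Sum>ov\<in>heavy. real (mult ov ov') * mass ov)"
  proof (intro sum.cong refl)
    fix ov assume ov: "ov \<in> heavy"
    obtain g i j where ovf: "ov = (g, i, j)" by (metis surj_pair)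
    have e: "dec k (g' - word_vec p + word_vec q) = g" if "inc k g + word_vec p - word_vec q = g'" for p q
      using that[symmetric] by simp
    \<comment> \<open>For a fixed parent, a child with its two letters corresponds to a pair of
      incoming edges with the two parent letters.\<close>
    have "card {c \<in> children ov. child ov c = ov'} = card {a \<in> ?B. h a = ov}"
    proof (rule bij_betw_same_card[of "\<lambda>((p, x), (q, y)). ((i, p), (j, q))"],
        rule bij_betwI[of _ _ _ "\<lambda>((i, p), (j, q)). ((p, x), (q, y))"])
      show "(\<lambda>((p, x), (q, y)). ((i, p), (j, q))) \<in> {c \<in> children ov. child ov c = ov'} \<rightarrow> {a \<in> ?B. h a = ov}"
        using ov by (auto simp: ovf fields occs_def h_def e)
      show "(\<lambda>((i, p), (j, q)). ((p, x), (q, y))) \<in> {a \<in> ?B. h a = ov} \<rightarrow> {c \<in> children ov. child ov c = ov'}"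
        by (auto simp: ovf fields occs_def h_def)
    qed (auto simp: ovf fields h_def)
    then show "(\<Sum>a\<in>{a \<in> ?B. h a = ov}. mass (h a)) = real (mult ov ov') * mass ov" by (simp add: mult_def)
  qed
  finally show ?thesis .
qed

text \<open>Total length-weighted mass is preserved only if no overlapping child of a heavy overlap is lost.\<close>

lemma heavy_child:
  assumes ov: "ov \<in> heavy" and c: "c \<in> children ov" and pos: "olen (child ov c) > 0"
  shows "child ov c \<in> heavy"
proof (rule ccontr)
  assume nh: "child ov c \<notin> heavy"
  let ?w = "child ov c"
  have m1: "mult ov ?w \<ge> 1"
  proof -
    have "{c' \<in> children ov. child ov c' = ?w} \<noteq> {}" using c by blast
    then have "card {c' \<in> children ov. child ov c' = ?w} > 0" using finite_children by (simp add: card_gt_0_iff)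
    then show ?thesis by (simp add: mult_def)
  qed
  \<comment> \<open>The areas satisfy lam * mass <= mult * mass and the lengths mult * olen <= lam *
    olen. Evaluating the double sum in both orders leaves no room for strictness, but the lost child
    makes the second inequality strict at \<open>ov\<close>.\<close>
  have "lam * (\<Sum>ov'\<in>heavy. olen ov' * mass ov') = (\<Sum>ov'\<in>heavy. olen ov' * (lam * mass ov'))"
    by (simp add: sum_distrib_left algebra_simps)
  also have "\<dots> \<le> (\<Sum>ov'\<in>heavy. olen ov' * (\<Sum>ov\<in>heavy. real (mult ov ov') * mass ov))"
    by (intro sum_mono mult_left_mono mass_heavy_le olen_nonneg)
  also have "\<dots> = (\<Sum>ov'\<in>heavy. \<Sum>ov\<in>heavy. mass ov * (real (mult ov ov') * olen ov'))"
    by (simp add: sum_distrib_left algebra_simps)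
  also have "\<dots> = (\<Sum>ov\<in>heavy. mass ov * (\<Sum>ov'\<in>heavy. real (mult ov ov') * olen ov'))"
    by (subst sum.swap) (simp add: sum_distrib_left)
  also have "\<dots> < (\<Sum>ov\<in>heavy. mass ov * (lam * olen ov))"
  proof (rule sum_strict_mono_ex1)
    show "\<forall>ov\<in>heavy. mass ov * (\<Sum>ov'\<in>heavy. real (mult ov ov') * olen ov') \<le> mass ov * (lam * olen ov)"
      by (intro ballI mult_left_mono sum_mult_olen finite_heavy mass_nonneg)
    have "(\<Sum>ov'\<in>insert ?w heavy. real (mult ov ov') * olen ov') \<le> lam * olen ov"
      by (intro sum_mult_olen) (simp add: finite_heavy)
    then have "real (mult ov ?w) * olen ?w + (\<Sum>ov'\<in>heavy. real (mult ov ov') * olen ov') \<le> lam * olen ov"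
      using nh finite_heavy by simp
    moreover have "real (mult ov ?w) * olen ?w > 0" using m1 pos by simp
    ultimately have "(\<Sum>ov'\<in>heavy. real (mult ov ov') * olen ov') < lam * olen ov" by linarith
    moreover have "mass ov > 0" using ov by (simp add: heavy_def)
    ultimately show "\<exists>ov\<in>heavy. mass ov * (\<Sum>ov'\<in>heavy. real (mult ov ov') * olen ov') < mass ov * (lam * olen ov)"
      using ov by (intro bexI[of _ ov] mult_strict_left_mono)
  qed (rule finite_heavy)
  also have "\<dots> = lam * (\<Sum>ov'\<in>heavy. olen ov' * mass ov')"
    by (simp add: sum_distrib_left algebra_simps)
  finally show False by simp
qed

end

section \<open>Every overlap leads to a coincidence\<close>

text \<open>Following the left end of the first tile: \<open>(g', j')\<close> in the list means that, after one inflation, the left end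
  may lie in a tile \<open>j'\<close> of the second strand, at displacement \<open>g'\<close> from its left end.\<close>

fun vertex_succs :: "nat \<Rightarrow> vec3 \<Rightarrow> letter \<Rightarrow> (vec3 \<times> letter) list" where
  "vertex_succs k (x, y, z) La = map (\<lambda>m. ((int k * x + z - int m, x, x + y), La)) [0..<k] @
     [((int k * x + z - int k, x, x + y), Lb), ((int k * x + z - int k, x - 1, x + y), Lc)]"
| "vertex_succs k (x, y, z) Lb = [((int k * x + z, x, x + y), Lc)]"
| "vertex_succs k (x, y, z) Lc = [((int k * x + z, x, x + y), La)]"

text \<open>An invariant nonempty subset of least cardinality is mapped onto itself. Thus every
  element has a predecessor, which will give infinite histories.\<close>

lemma finite_invariant_subset:
  assumes "finite V" "V \<noteq> {}" "f ` V \<subseteq> V"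
  obtains K where "K \<subseteq> V" "K \<noteq> {}" "f ` K = K"
proof -
  let ?P = "\<lambda>K. K \<subseteq> V \<and> K \<noteq> {} \<and> f ` K \<subseteq> K"
  obtain K where K: "?P K" "\<And>K'. card K' < card K \<Longrightarrow> \<not> ?P K'"
    using exists_least_iff[of "\<lambda>n. \<exists>K. ?P K \<and> card K = n"] assms by (metis order_refl)
  have fin: "finite K" using K(1) assms(1) finite_subset by blast
  have "?P (f ` K)" using K(1) by auto
  then have "\<not> card (f ` K) < card K" using K(2) by blast
  then have "f ` K = K" using K(1) fin by (meson card_seteq linorder_not_less)
  with K(1) that show ?thesis by blast
qed

context pisot begin

lemma heavy_step:
  assumes "(g, i, j) \<in> heavy" "sk k i = p @ x # r" "sk k j = q @ y # r'"
    "g' = inc k g + word_vec p - word_vec q" "- len x < el g'" "el g' < len y"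
  shows "(g', x, y) \<in> heavy"
proof -
  let ?c = "((p, x), (q, y))"
  have e: "child (g, i, j) ?c = (g', x, y)" using assms(4) by simp
  have "?c \<in> children (g, i, j)" using assms(2,3) by (auto simp: splits_iff)
  moreover have "olen (child (g, i, j) ?c) > 0" unfolding e olen_pos_iff using assms(5,6) by simp
  ultimately show ?thesis using heavy_child[OF assms(1), of ?c] unfolding e by blast
qed

lemma heavy_range: "(g, i, j) \<in> heavy \<Longrightarrow> - len i < el g \<and> el g < len j"
  unfolding heavy_def using olen_pos_iff by (auto simp del: olen.simps)

lemma not_heavy_coincident: "(0, i, i) \<notin> heavy"
  by (simp add: heavy_def)

text \<open>After inflation the left end lies in the inflated tile j, hence in exactly one half-open
  tile of its subdivision. That tile overlaps the first tile of the other strand, so the new overlap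
  is heavy by \<open>heavy_child\<close>.\<close>

lemma vertex_step:
  assumes h: "(g, i, j) \<in> heavy" and nn: "el g \<ge> 0"
  shows "\<exists>g' j'. (g', hd (sk k i), j') \<in> heavy \<and> el g' \<ge> 0 \<and> (g', j') \<in> set (vertex_succs k g j)"
proof -
  obtain x y z where g: "g = (x, y, z)" by (cases g)
  let ?i = "hd (sk k i)"
  have i: "sk k i = [] @ ?i # tl (sk k i)" by simp
  have lt: "el g < len j" using heavy_range[OF h] by simp
  have lt': "lam * el g < lam * len j" and nn': "0 \<le> lam * el g" using lt nn lam_pos by simp_all
  have step: "(inc k g - word_vec q, ?i, y') \<in> heavy \<and> el (inc k g - word_vec q) \<ge> 0"
    if "sk k j = q @ y' # r" "el (word_vec q) \<le> lam * el g" "lam * el g < el (word_vec q) + len y'" for q y' r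
  proof -
    have "el (inc k g - word_vec q) = lam * el g - el (word_vec q)" by (simp add: el_diff el_inc)
    then show ?thesis using heavy_step[OF h i that(1), of "inc k g - word_vec q"] that(2,3) len_pos[of ?i] by simp
  qed
  show ?thesis
  proof (cases j)
    case Lb
    have "len Lc = lam * len Lb" by simp
    then show ?thesis using step[of "[]" Lc "[]"] lt' nn' Lb by (auto simp: g simp del: el.simps)
  next
    case Lc
    have "len La = lam * len Lc" by (simp add: power2_eq_square)
    then show ?thesis using step[of "[]" La "[]"] lt' nn' Lc by (auto simp: g simp del: el.simps)
  next
    case La
    have "lam * len La = lam ^ 3" by (simp add: power2_eq_square power3_eq_cube)
    then have top: "lam * el g < real k * lam ^ 2 + 1 + lam"
      using lt' lam_eq unfolding La by linarith
    have lenw: "el (word_vec (replicate m La)) = real m * lam ^ 2" for m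
      by (simp add: word_vec_replicate)
    consider "lam * el g < real k * lam ^ 2"
      | "real k * lam ^ 2 \<le> lam * el g" "lam * el g < real k * lam ^ 2 + 1"
      | "real k * lam ^ 2 + 1 \<le> lam * el g" by linarith
    then show ?thesis
    proof cases
      case 1
      \<comment> \<open>The index of the a-tile that contains the point at distance lam * el g, all
        a-tiles having length lam^2.\<close>
      define m where "m = nat \<lfloor>lam * el g / lam ^ 2\<rfloor>"
      have q0: "0 \<le> lam * el g / lam ^ 2" using nn' by simp
      have "real m \<le> lam * el g / lam ^ 2" "lam * el g / lam ^ 2 < real m + 1"
        using q0 unfolding m_def by (simp_all add: of_nat_floor)
      then have m: "real m * lam ^ 2 \<le> lam * el g" "lam * el g < real m * lam ^ 2 + lam ^ 2"
        using lam_pos by (simp_all add: pos_le_divide_eq pos_divide_less_eq distrib_right)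
      have "real m * lam ^ 2 < real k * lam ^ 2" using m(1) 1 by linarith
      then have mk: "m < k" using lam_pos by simp
      then obtain d where d: "k = m + Suc d" using less_imp_Suc_add by fastforce
      have "sk k j = replicate m La @ La # (replicate d La @ [Lb, Lc])"
        unfolding La d by (simp add: replicate_add replicate_app_Cons_same)
      from step[OF this] m have "(inc k g - word_vec (replicate m La), ?i, La) \<in> heavy"
        "el (inc k g - word_vec (replicate m La)) \<ge> 0" by (simp_all add: lenw del: el.simps) (simp_all)
      moreover have "inc k g - word_vec (replicate m La) = (int k * x + z - int m, x, x + y)"
        by (simp add: g word_vec_replicate)
      moreover have "((int k * x + z - int m, x, x + y), La) \<in> set (vertex_succs k g j)"
        using mk by (simp add: g La)
      ultimately show ?thesis by metis
    next
      case 2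
      have "sk k j = replicate k La @ Lb # [Lc]" unfolding La by simp
      from step[OF this] 2 have "(inc k g - word_vec (replicate k La), ?i, Lb) \<in> heavy"
        "el (inc k g - word_vec (replicate k La)) \<ge> 0" by (simp_all add: lenw del: el.simps) (simp_all)
      moreover have "inc k g - word_vec (replicate k La) = (int k * x + z - int k, x, x + y)"
        by (simp add: g word_vec_replicate)
      moreover have "((int k * x + z - int k, x, x + y), Lb) \<in> set (vertex_succs k g j)"
        by (simp add: g La)
      ultimately show ?thesis by metis
    next
      case 3
      let ?q = "replicate k La @ [Lb]"
      have "sk k j = ?q @ Lc # []" unfolding La by simp
      moreover have "el (word_vec ?q) = real k * lam ^ 2 + 1" by (simp add: word_vec_replicate zero_prod_def)
      ultimately have "(inc k g - word_vec ?q, ?i, Lc) \<in> heavy" "el (inc k g - word_vec ?q) \<ge> 0"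
        using step[of ?q Lc "[]"] 3 top by (simp_all del: el.simps word_vec_simps) (simp_all)
      moreover have "inc k g - word_vec ?q = (int k * x + z - int k, x - 1, x + y)"
        by (simp add: g word_vec_replicate zero_prod_def)
      moreover have "((int k * x + z - int k, x - 1, x + y), Lc) \<in> set (vertex_succs k g j)"
        by (simp add: g La)
      ultimately show ?thesis by metis
    qed
  qed
qed

text \<open>Successors are what the finite search follows; predecessors provide histories reaching
  arbitrarily far back.\<close>

definition vertex_set :: "overlap set \<Rightarrow> bool" where
  "vertex_set K \<longleftrightarrow> K \<noteq> {} \<and> finite K \<and> K \<subseteq> heavy \<and> (\<forall>(g, i, j)\<in>K. el g \<ge> 0) \<and>
     (\<forall>(g, i, j)\<in>K. \<exists>g' j'. (g', hd (sk k i), j') \<in> K \<and> (g', j') \<in> set (vertex_succs k g j)) \<and>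
     (\<forall>(g', i', j')\<in>K. \<exists>g i j. (g, i, j) \<in> K \<and> i' = hd (sk k i) \<and> (g', j') \<in> set (vertex_succs k g j))"

text \<open>By \<open>heavy_uminus\<close> some heavy overlap has nonnegative displacement. Choosing
  one successor for each such overlap gives a self-map of a finite set, to which
  \<open>finite_invariant_subset\<close> applies.\<close>

lemma vertex_set_exists:
  assumes "heavy \<noteq> {}"
  shows "\<exists>K. vertex_set K"
proof -
  define V where "V = {(g, i, j) \<in> heavy. el g \<ge> 0}"
  define R where "R = (\<lambda>(g, i, j) (g', i', j'). i' = hd (sk k i) \<and> (g', j') \<in> set (vertex_succs k g j))"
  have neV: "V \<noteq> {}"
  proof -
    obtain g i j where h: "(g, i, j) \<in> heavy" using assms by auto
    then have "(- g, j, i) \<in> heavy" by (rule heavy_uminus)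
    then have "(g, i, j) \<in> V \<or> (- g, j, i) \<in> V" using h by (auto simp: V_def el_uminus simp del: el.simps)
    then show ?thesis by blast
  qed
  have finV: "finite V" unfolding V_def by (rule finite_subset[OF _ finite_heavy]) auto
  have "\<exists>w. w \<in> V \<and> R v w" if "v \<in> V" for v
  proof -
    obtain g i j where v: "v = (g, i, j)" by (cases v)
    then show ?thesis using vertex_step[of g i j] that by (fastforce simp: V_def R_def)
  qed
  then obtain f where f: "\<And>v. v \<in> V \<Longrightarrow> f v \<in> V \<and> R v (f v)" by metis
  then have "f ` V \<subseteq> V" by blast
  then obtain K where K: "K \<subseteq> V" "K \<noteq> {}" "f ` K = K"
    by (rule finite_invariant_subset[OF finV neV])
  have 1: "\<exists>w\<in>K. R v w" if v: "v \<in> K" for v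
  proof (intro bexI[of _ "f v"])
    show "f v \<in> K" using v K(3) by blast
    show "R v (f v)" using f[of v] v K(1) by blast
  qed
  have 2: "\<exists>v\<in>K. R v w" if "w \<in> K" for w
  proof -
    have "w \<in> f ` K" using that K by simp
    then obtain v where v: "v \<in> K" "w = f v" by (elim imageE)
    then show ?thesis using f[of v] K(1) by (intro bexI[of _ v]) auto
  qed
  have "\<forall>(g, i, j)\<in>K. \<exists>g' j'. (g', hd (sk k i), j') \<in> K \<and> (g', j') \<in> set (vertex_succs k g j)"
    using 1 by (fastforce simp: R_def)
  moreover have "\<forall>(g', i', j')\<in>K. \<exists>g i j. (g, i, j) \<in> K \<and> i' = hd (sk k i) \<and> (g', j') \<in> set (vertex_succs k g j)"
    using 2 by (fastforce simp: R_def)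
  moreover have "K \<subseteq> heavy" "\<forall>(g, i, j)\<in>K. el g \<ge> 0" "finite K"
    using K(1) finV finite_subset by (auto simp: V_def)
  ultimately show ?thesis unfolding vertex_set_def using K(2) by blast
qed

text \<open>The second and third coordinates are copied from the step before, up to a correction
  when c follows a. A vertex is therefore determined by first coordinates at successive times and
  these corrections.\<close>

lemma vertex_succs_shape:
  assumes "((x', y', z'), j') \<in> set (vertex_succs k (x, y, z) j)"
  shows "y' = x - (if j = La \<and> j' = Lc then 1 else 0) \<and> z' = x + y \<and>
    (j = La \<and> j' = Lc \<longrightarrow> x' = int k * x + z - int k) \<and> (j = Lc \<longrightarrow> j' = La)"
  using assms by (cases j) auto

text \<open>The history of a vertex, with time running backwards: \<open>x n\<close> is the first coordinate \<open>n\<close> steps ago.\<close>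

definition history :: "overlap set \<Rightarrow> vec3 \<Rightarrow> (nat \<Rightarrow> int) \<Rightarrow> (nat \<Rightarrow> int) \<Rightarrow> (nat \<Rightarrow> letter) \<Rightarrow> bool" where
  "history K g x e j \<longleftrightarrow> g = (x 0, x 1 - e 0, x 1 + x 2 - e 1) \<and>
     (\<forall>n. \<exists>y z i. ((x n, y, z), i, j n) \<in> K) \<and>
     (\<forall>n. 0 \<le> el (x n, x (n + 1) - e n, x (n + 1) + x (n + 2) - e (n + 1))) \<and>
     (\<forall>n. el (x n, x (n + 1) - e n, x (n + 1) + x (n + 2) - e (n + 1)) < len (j n)) \<and>
     (\<forall>n. j (n + 1) = Lc \<longrightarrow> j n = La) \<and>
     (\<forall>n. e n = 0 \<or> e n = 1 \<and> j n = Lc \<and> j (n + 1) = La \<and>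
       x n = int k * x (n + 1) + x (n + 2) + x (n + 3) - e (n + 2) - int k)"

lemma historyD:
  assumes "history K g x e j"
  shows "g = (x 0, x 1 - e 0, x 1 + x 2 - e 1)"
    "\<exists>y z i. ((x n, y, z), i, j n) \<in> K"
    "0 \<le> el (x n, x (n + 1) - e n, x (n + 1) + x (n + 2) - e (n + 1))"
    "el (x n, x (n + 1) - e n, x (n + 1) + x (n + 2) - e (n + 1)) < len (j n)"
    "e n = 0 \<or> e n = 1 \<and> j n = Lc \<and> j (n + 1) = La \<and>
       x n = int k * x (n + 1) + x (n + 2) + x (n + 3) - e (n + 2) - int k"
    "j (n + 1) = Lc \<Longrightarrow> j n = La"
  using assms unfolding history_def by blast+

lemma vertex_history:
  assumes K: "vertex_set K" and v: "(g, i, j0) \<in> K"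
  shows "\<exists>x e j. history K g x e j \<and> j 0 = j0"
proof -
  define R where "R = (\<lambda>(g, i :: letter, j) (g', i' :: letter, j'). (g', j') \<in> set (vertex_succs k g j))"
  have "\<exists>v\<in>K. R v w" if "w \<in> K" for w
    using K that by (fastforce simp: vertex_set_def R_def)
  then obtain f where f: "\<And>w. w \<in> K \<Longrightarrow> f w \<in> K \<and> R (f w) w" by metis
  define w where "w n = (f ^^ n) (g, i, j0)" for n
  have wK: "w n \<in> K" for n by (induction n) (use v f in \<open>auto simp: w_def\<close>)
  have R: "R (w (Suc n)) (w n)" for n using f[OF wK[of n]] by (simp add: w_def)
  define x where "x n = fst (fst (w n))" for n
  define y where "y n = fst (snd (fst (w n)))" for n
  define z where "z n = snd (snd (fst (w n)))" for n
  define ii where "ii n = fst (snd (w n))" for n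
  define j where "j n = snd (snd (w n))" for n
  define e where "e n = (if j (Suc n) = La \<and> j n = Lc then 1 else 0 :: int)" for n
  have w: "w n = ((x n, y n, z n), ii n, j n)" for n by (simp add: x_def y_def z_def ii_def j_def)
  have s: "y n = x (Suc n) - e n \<and> z n = x (Suc n) + y (Suc n) \<and>
      (j (Suc n) = La \<and> j n = Lc \<longrightarrow> x n = int k * x (Suc n) + z (Suc n) - int k) \<and> (j (Suc n) = Lc \<longrightarrow> j n = La)" for n
    using R[of n] vertex_succs_shape unfolding w R_def e_def by auto
  have yz: "y n = x (n + 1) - e n" "z n = x (n + 1) + x (n + 2) - e (n + 1)" for n
    using s[of n] s[of "Suc n"] by simp_all
  have "history K g x e j" unfolding history_def
  proof (intro conjI allI)
    show "g = (x 0, x 1 - e 0, x 1 + x 2 - e 1)"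
      using w[of 0] yz[of 0] by (simp add: w_def numeral_2_eq_2)
    fix n
    show "\<exists>y z i. ((x n, y, z), i, j n) \<in> K" using wK[of n] unfolding w by blast
    show "0 \<le> el (x n, x (n + 1) - e n, x (n + 1) + x (n + 2) - e (n + 1))"
      using K wK[of n] unfolding w yz vertex_set_def by blast
    have "((x n, y n, z n), ii n, j n) \<in> heavy" using K wK[of n] unfolding w vertex_set_def by blast
    from heavy_range[OF this] show "el (x n, x (n + 1) - e n, x (n + 1) + x (n + 2) - e (n + 1)) < len (j n)"
      unfolding yz by blast
    show "j (n + 1) = Lc \<longrightarrow> j n = La" using s[of n] by simp
    show "e n = 0 \<or> e n = 1 \<and> j n = Lc \<and> j (n + 1) = La \<and>
       x n = int k * x (n + 1) + x (n + 2) + x (n + 3) - e (n + 2) - int k"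
      using s[of n] yz(2)[of "Suc n"] by (auto simp: e_def numeral_2_eq_2 numeral_3_eq_3)
  qed
  moreover have "j 0 = j0" by (simp add: j_def w_def)
  ultimately show ?thesis by blast
qed

lemma first_coordinates_bounded:
  assumes "vertex_set K"
  obtains L U :: int where "\<forall>x y z i j. ((x, y, z), i, j) \<in> K \<longrightarrow> L \<le> x \<and> x \<le> U"
    "\<exists>y z i j. ((U, y, z), i, j) \<in> K" "\<exists>y z i j. ((L, y, z), i, j) \<in> K"
proof -
  let ?X = "(\<lambda>((x, y, z), i, j). x) ` K"
  have X: "finite ?X" "?X \<noteq> {}" using assms by (auto simp: vertex_set_def)
  have mem: "\<exists>y z i j. ((x, y, z), i, j) \<in> K" if "x \<in> ?X" for x using that by auto
  show ?thesis
  proof (rule that[of "Min ?X" "Max ?X"]; (intro allI impI)?)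
    fix x y z i j assume "((x, y, z), i, j) \<in> K"
    then have "x \<in> ?X" by force
    then show "Min ?X \<le> x \<and> x \<le> Max ?X" using X by auto
  qed (use mem Max_in[OF X] Min_in[OF X] in blast)+
qed

section \<open>The maximum argument for k >= 2\<close>

text \<open>Extreme first coordinates are confined to 0 and 1 by comparing displacements at
  successive times. The value 1 is then excluded by the exact relation that accompanies a
  correction, and with all first coordinates 0 the displacement can only be 0.\<close>

lemma vertex_displacement_zero:
  assumes K: "vertex_set K" and k: "k \<ge> 2" and v: "(g, i, j0) \<in> K"
  shows "g = 0"
proof -
  have lam2: "lam ^ 2 > 2 * lam + 1"
  proof -
    have "2 * lam ^ 2 \<le> real k * lam ^ 2" using k by (intro mult_right_mono) auto
    then have *: "lam ^ 3 \<ge> 2 * lam ^ 2 + lam + 1" using lam_eq by linarith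
    show ?thesis
    proof (rule ccontr)
      assume "\<not> lam ^ 2 > 2 * lam + 1"
      then have "lam * lam ^ 2 \<le> lam * (2 * lam + 1)" using lam_pos by (intro mult_left_mono) auto
      then have "lam ^ 3 \<le> 2 * lam ^ 2 + lam" by (simp add: power2_eq_square power3_eq_cube algebra_simps)
      with * show False by simp
    qed
  qed
  obtain L U :: int where UL': "\<forall>x y z i j. ((x, y, z), i, j) \<in> K \<longrightarrow> L \<le> x \<and> x \<le> U"
    "\<exists>y z i j. ((U, y, z), i, j) \<in> K" "\<exists>y z i j. ((L, y, z), i, j) \<in> K"
    by (rule first_coordinates_bounded[OF K])
  note UL = UL'(1)[rule_format] UL'(2,3)
  have LU: "L \<le> U" using UL(1,2) by blast
  have lenLa: "len La = lam ^ 2" and lenLc: "len Lc = lam" by simp_all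
  note mono = mult_right_mono[OF _ less_imp_le[OF lam_pos]]
  have lamle: "lam \<le> lam ^ 2" using lam_gt_1 by (simp add: power2_eq_square)
  \<comment> \<open>If all first coordinates were negative, all three coordinates of a displacement
    would be, contradicting \<open>el g >= 0\<close>.\<close>
  have U0: "U \<ge> 0"
  proof (rule ccontr)
    assume neg: "\<not> U \<ge> 0"
    obtain y z i j where w: "((U, y, z), i, j) \<in> K" using UL(2) by blast
    obtain x e jj where hh: "history K (U, y, z) x e jj" using vertex_history[OF K w] by blast
    note h = historyD[OF hh]
    have b: "x n \<le> U" for n using h(2)[of n] UL(1) by blast
    have "e 0 \<ge> 0" "e 1 \<ge> 0" using h(5)[of 0] h(5)[of 1] by auto
    then have neg1: "x 0 < 0" "x 1 - e 0 < 0" "x 1 + x 2 - e 1 < 0" using b[of 0] b[of 1] b[of 2] neg by linarith+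
    have "real_of_int (x 0) * lam ^ 2 < 0" "real_of_int (x 1 + x 2 - e 1) * lam < 0"
      using neg1 lam_pos by (auto simp: mult_neg_pos simp flip: of_int_add of_int_diff)
    then show False using h(3)[of 0] neg1(2) by (simp add: numeral_2_eq_2)
  qed
  \<comment> \<open>At the minimum, nonnegativity of the displacement gives 0 <= L lam^2 + U (2 lam
    + 1), and 2 lam + 1 < lam^2.\<close>
  have Lge: "L > - U \<or> U = 0 \<and> L = 0"
  proof (rule ccontr)
    assume neg: "\<not> (L > - U \<or> U = 0 \<and> L = 0)"
    obtain y z i j where w: "((L, y, z), i, j) \<in> K" using UL(3) by blast
    obtain x e jj where hh: "history K (L, y, z) x e jj" using vertex_history[OF K w] by blast
    note h = historyD[OF hh]
    have b: "x n \<le> U" for n using h(2)[of n] UL(1) by blast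
    have e: "e 0 \<ge> 0" "e 1 \<ge> 0" using h(5)[of 0] h(5)[of 1] by auto
    have "real_of_int (x 1 + x 2 - e 1) * lam \<le> real_of_int (2 * U) * lam"
      using b[of 1] b[of 2] e by (intro mono) (simp flip: of_int_add of_int_diff)
    moreover have "real_of_int (x 1 - e 0) \<le> real_of_int U" using b[of 1] e by simp
    ultimately have ge: "0 \<le> real_of_int L * lam ^ 2 + real_of_int U + real_of_int (2 * U) * lam"
      using h(3)[of 0] h(1) by (simp add: numeral_2_eq_2)
    moreover have "real_of_int L * lam ^ 2 \<le> real_of_int (- U) * lam ^ 2"
      using neg LU U0 by (intro mult_right_mono) auto
    ultimately have *: "0 \<le> real_of_int U * (2 * lam + 1 - lam ^ 2)" by (simp add: algebra_simps)
    have "U \<noteq> 0"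
    proof
      assume "U = 0"
      then have "0 \<le> real_of_int L * lam ^ 2" using ge by simp
      then have "L \<ge> 0" using lam_pos by (simp add: zero_le_mult_iff)
      then show False using neg LU \<open>U = 0\<close> by simp
    qed
    then have "real_of_int U > 0" using U0 by simp
    then have "real_of_int U * (2 * lam + 1 - lam ^ 2) < 0" using lam2 by (intro mult_pos_neg) auto
    with * show False by simp
  qed
  have U1: "U \<le> 1"
  proof (rule ccontr)
    assume "\<not> U \<le> 1"
    define u where "u = real_of_int U - 1"
    have u: "u \<ge> 1" using \<open>\<not> U \<le> 1\<close> by (simp add: u_def)
    have L: "real_of_int L \<ge> - u" using Lge \<open>\<not> U \<le> 1\<close> by (auto simp: u_def)
    obtain y z i j where w: "((U, y, z), i, j) \<in> K" using UL(2) by blast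
    obtain x e jj where hh: "history K (U, y, z) x e jj" using vertex_history[OF K w] by blast
    note h = historyD[OF hh]
    have b: "x n \<le> U" "L \<le> x n" for n using h(2)[of n] UL(1) by blast+
    define X1 X2 X3 where "X1 = real_of_int (x 1)" and "X2 = real_of_int (x 2)" and "X3 = real_of_int (x 3)"
    have X3: "X3 \<le> u + 1" using b(1)[of 3] by (simp add: X3_def u_def)
    have X2: "X2 \<ge> - u" using b(2)[of 2] L by (simp add: X2_def)
    have up: "u * lam ^ 2 + X1 * (1 + lam) + X2 * lam < lam"
    proof -
      have "e 0 = 1 \<Longrightarrow> e 1 = 0" using h(5)[of 0] h(5)[of 1] by auto
      then consider "e 0 = 0" "e 1 = 0" | "e 0 = 0" "e 1 = 1" | "e 0 = 1" "e 1 = 0" "jj 0 = Lc"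
        using h(5)[of 0] h(5)[of 1] by auto
      moreover have "(u + 1) * lam ^ 2 + X1 - real_of_int (e 0) + (X1 + X2 - real_of_int (e 1)) * lam < len (jj 0)"
        using h(4)[of 0] h(1) by (simp add: u_def X1_def X2_def numeral_2_eq_2)
      moreover have "len (jj 0) \<le> lam ^ 2" by (rule len_le)
      ultimately show ?thesis using lam2 lam_gt_1 by cases (simp_all add: algebra_simps)
    qed
    have low: "X1 * lam ^ 2 + X2 * (1 + lam) + X3 * lam \<ge> 0"
    proof -
      have "real_of_int (e 1) \<ge> 0" "real_of_int (e 2) \<ge> 0" using h(5)[of 1] h(5)[of 2] by auto
      then have "real_of_int (e 2) * lam \<ge> 0" using lam_pos by simp
      moreover have "0 \<le> X1 * lam ^ 2 + (X2 - real_of_int (e 1)) + (X2 + X3 - real_of_int (e 2)) * lam"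
        using h(3)[of 1] by (simp add: X1_def X2_def X3_def numeral_2_eq_2 numeral_3_eq_3)
      ultimately show ?thesis using \<open>real_of_int (e 1) \<ge> 0\<close> by (simp add: algebra_simps)
    qed
    define Q R where "Q = lam ^ 4 - lam ^ 3 + 1 + lam" and "R = lam ^ 3 + lam ^ 2 + lam"
    \<comment> \<open>\<open>up\<close> bounds the displacement at the maximum from above,
      \<open>low\<close> the one a step earlier from below. The multipliers lam^2 and 1 + lam
      eliminate \<open>X1\<close>; the extreme values replace \<open>X2\<close> and
      \<open>X3\<close>.\<close>
    have "u * (lam ^ 4 - lam ^ 3 + 1 + lam) < lam ^ 3 + lam ^ 2 + lam"
    proof -
      have "lam ^ 2 * (u * lam ^ 2 + X1 * (1 + lam) + X2 * lam) < lam ^ 2 * lam"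
        using up lam_pos by (intro mult_strict_left_mono) auto
      moreover have "0 \<le> (1 + lam) * (X1 * lam ^ 2 + X2 * (1 + lam) + X3 * lam)" using low lam_pos by simp
      ultimately have 1: "u * lam ^ 4 + X2 * (lam ^ 3 - (1 + lam) ^ 2) - X3 * lam * (1 + lam) < lam ^ 3"
        by (simp add: power2_eq_square power3_eq_cube power4_eq_xxxx algebra_simps)
      have c: "lam ^ 3 - (1 + lam) ^ 2 \<ge> 0"
      proof -
        have "lam * (2 * lam + 1) \<le> lam * lam ^ 2" using lam2 lam_pos by (intro mult_left_mono) auto
        then show ?thesis using lam2 lam_pos by (simp add: power2_eq_square power3_eq_cube algebra_simps)
      qed
      have "- u * (lam ^ 3 - (1 + lam) ^ 2) \<le> X2 * (lam ^ 3 - (1 + lam) ^ 2)" by (rule mult_right_mono[OF X2 c])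
      moreover have "X3 * (lam * (1 + lam)) \<le> (u + 1) * (lam * (1 + lam))" using X3 lam_pos by (intro mult_right_mono) auto
      ultimately show ?thesis using 1 by (simp add: power2_eq_square power3_eq_cube power4_eq_xxxx algebra_simps)
    qed
    then have 1: "u * Q < R" unfolding Q_def R_def .
    have 2: "R \<le> Q"
    proof -
      have "lam ^ 2 * (2 * lam + 1) \<le> lam ^ 2 * lam ^ 2" using lam2 by (intro mult_left_mono) auto
      then show ?thesis by (simp add: Q_def R_def power2_eq_square power3_eq_cube power4_eq_xxxx algebra_simps)
    qed
    have "0 \<le> R" using lam_pos by (simp add: R_def)
    then have "1 * Q \<le> u * Q" using u 2 by (intro mult_right_mono) linarith+
    then show False using 1 2 by linarith
  qed
  then have L0: "L \<ge> 0" using Lge U0 by auto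
  have range: "x = 0 \<or> x = 1" if "((x, y, z), i, j) \<in> K" for x y z i j
    using UL(1)[OF that] U1 L0 by auto
  \<comment> \<open>The summand lam^2 already exhausts the length of the longest tile, so the rest
    must be negative; among coordinates 0 and 1 only e1 = 1 with x1 = x2 = 0 achieves this. The
    other correction needs j = c and would give lam^2 - 1 < lam.\<close>
  have one: "e1 = 1 \<and> x1 = 0 \<and> x2 = 0"
    if x: "x0 = 1" "x1 = 0 \<or> x1 = 1" "x2 = 0 \<or> x2 = 1"
      and lt: "el (x0, x1 - e0, x1 + x2 - e1) < len j"
      and e: "e0 = 0 \<or> e0 = 1 \<and> j = Lc \<and> e1 = 0" "e1 = 0 \<or> e1 = 1" for x0 x1 x2 e0 e1 j
  proof -
    have "e0 = 0"
    proof (rule ccontr)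
      assume "e0 \<noteq> 0"
      then have a: "e0 = 1" "j = Lc" "e1 = 0" using e(1) by auto
      have "real_of_int (x1 + x2) * lam \<ge> 0" using x lam_pos by auto
      then have "lam ^ 2 - 1 < lam" using lt a x(1,2) by auto
      then show False using lam2 lam_gt_1 by simp
    qed
    moreover have "len j \<le> lam ^ 2" by (rule len_le)
    ultimately have "real_of_int x1 + real_of_int (x1 + x2 - e1) * lam < 0"
      using lt x(1) by simp
    then show ?thesis using x(2,3) e(2) lam_gt_1 by auto
  qed
  have no_one: "((1, y, z), i, j) \<notin> K" for y z i j
  proof
    assume w: "((1, y, z), i, j) \<in> K"
    obtain x e jj where hh: "history K (1, y, z) x e jj" using vertex_history[OF K w] by blast
    note h = historyD[OF hh]
    have r: "x n = 0 \<or> x n = 1" for n using h(2)[of n] range by blast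
    have e01: "e n = 0 \<or> e n = 1 \<and> jj n = Lc \<and> e (n + 1) = 0" for n using h(5)[of n] h(5)[of "n + 1"] by auto
    have step: "e (n + 1) = 1 \<and> x (n + 1) = 0 \<and> x (n + 2) = 0" if "x n = 1" for n
    proof -
      have "e (n + 1) = 0 \<or> e (n + 1) = 1" using h(5)[of "n + 1"] by blast
      then show ?thesis by (rule one[OF that r r h(4) e01])
    qed
    have s0: "e 1 = 1" "x 1 = 0" "x 2 = 0" using step[of 0] h(1) by (auto simp: numeral_2_eq_2)
    have e2: "e 2 = 0" using e01[of 1] s0 by (simp add: numeral_2_eq_2)
    have "0 \<le> - 1 + real_of_int (x 3) * lam"
      using h(3)[of 1] s0 e2 by (simp add: numeral_2_eq_2 numeral_3_eq_3)
    then have x3: "x 3 = 1" using r[of 3] by auto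
    from step[OF x3] have s3: "e 4 = 1" "x 4 = 0" by auto
    have e3: "e 3 = 0" using e01[of 3] s3 by auto
    \<comment> \<open>The relation that accompanies the correction e 1 = 1; with the values found it
      reads 0 = 1 - k.\<close>
    have "x 1 = int k * x 2 + x 3 + x 4 - e 3 - int k"
      using h(5)[of 1] s0 by (auto simp: numeral_eq_Suc)
    then show False using s0 x3 s3 e3 k by simp
  qed
  obtain x e jj where hh: "history K g x e jj" using vertex_history[OF K v] by blast
  note h = historyD[OF hh]
  have x0: "x n = 0" for n
  proof -
    obtain y z i where "((x n, y, z), i, jj n) \<in> K" using h(2) by blast
    then show ?thesis using range no_one by metis
  qed
  have "0 \<le> - real_of_int (e 0) - real_of_int (e 1) * lam" using h(3)[of 0] x0 by simp
  then have "e 0 = 0 \<and> e 1 = 0" using h(5)[of 0] h(5)[of 1] lam_gt_1 by auto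
  then show ?thesis using h(1) x0 by (simp add: zero_prod_def)
qed

lemma heavy_first_letters:
  assumes "(0, i, j) \<in> heavy"
  shows "(0, hd (sk k i), hd (sk k j)) \<in> heavy"
  using heavy_step[OF assms, of "[]" "hd (sk k i)" "tl (sk k i)" "[]" "hd (sk k j)" "tl (sk k j)" 0] len_pos by simp

text \<open>For k >= 1 the second image of every letter begins with a, so tiles with a common left
  end coincide after two inflations.\<close>

lemma heavy_zero_pos: "k \<ge> 1 \<Longrightarrow> (0, i, j) \<notin> heavy"
proof
  assume k: "k \<ge> 1" and h: "(0, i, j) \<in> heavy"
  have "hd (sk k (hd (sk k x))) = La" for x using k by (cases x; cases k) auto
  then show False using heavy_first_letters[OF heavy_first_letters[OF h]] not_heavy_coincident by simp
qed

lemma heavy_empty_ge_2: "k \<ge> 2 \<Longrightarrow> heavy = {}"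
proof (rule ccontr)
  assume k: "k \<ge> 2" and "heavy \<noteq> {}"
  then obtain K where K: "vertex_set K" using vertex_set_exists by blast
  then obtain g i j where v: "(g, i, j) \<in> K" by (auto simp: vertex_set_def)
  then have "(0, i, j) \<in> heavy" using vertex_displacement_zero[OF K k v] K by (auto simp: vertex_set_def)
  then show False using heavy_zero_pos[of i j] k by simp
qed

end

subsection \<open>The cases \<open>k = 0\<close> and \<open>k = 1\<close>\<close>

text \<open>A finite search in integers; \<open>l0 \<le> 10000 lam \<le> l1\<close> and \<open>q0 \<le> 10000 lam\<^sup>2 \<le> q1\<close> make \<open>disp_le\<close>
  and \<open>disp_ge\<close> bounds for \<open>10000 el g\<close>.\<close>

fun disp_le :: "int \<times> int \<times> int \<times> int \<Rightarrow> vec3 \<Rightarrow> int" where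
  "disp_le (l0, l1, q0, q1) (x, y, z) =
     (if 0 \<le> x then x * q1 else x * q0) + (if 0 \<le> z then z * l1 else z * l0) + y * 10000"

fun disp_ge :: "int \<times> int \<times> int \<times> int \<Rightarrow> vec3 \<Rightarrow> int" where
  "disp_ge (l0, l1, q0, q1) (x, y, z) =
     (if 0 \<le> x then x * q0 else x * q1) + (if 0 \<le> z then z * l0 else z * l1) + y * 10000"

text \<open>Conditions on a vertex that integer arithmetic can test. Enclosures cannot separate the
  tie \<open>el g = len j\<close> in which g is the vector of j itself, so the last clause removes
  it.\<close>

definition admissible :: "int \<times> int \<times> int \<times> int \<Rightarrow> int \<Rightarrow> int \<Rightarrow> vec3 \<Rightarrow> letter \<Rightarrow> bool" where
  "admissible b X0 X1 g j \<longleftrightarrow> X0 \<le> fst g \<and> fst g \<le> X1 \<and> 0 \<le> disp_le b g \<and>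
     disp_ge b g < disp_le b (letter_vec j) \<and> g \<noteq> letter_vec j"

primrec reaches :: "(vec3 \<Rightarrow> letter \<Rightarrow> bool) \<Rightarrow> (vec3 \<Rightarrow> letter \<Rightarrow> bool) \<Rightarrow> nat \<Rightarrow> nat \<Rightarrow> vec3 \<Rightarrow> letter \<Rightarrow> bool" where
  "reaches ok tgt k 0 g j \<longleftrightarrow> tgt g j"
| "reaches ok tgt k (Suc n) g j \<longleftrightarrow> tgt g j \<or>
     list_all (\<lambda>(g', j'). \<not> ok g' j' \<or> reaches ok tgt k n g' j') (vertex_succs k g j)"

text \<open>Starting vertices are enumerated by three successive first coordinates and two
  corrections. A correction e0 = 1 forces j = c; e1 = 1 makes the preceding letter c and hence j =
  a.\<close>

definition search :: "(vec3 \<Rightarrow> letter \<Rightarrow> bool) \<Rightarrow> (vec3 \<Rightarrow> letter \<Rightarrow> bool) \<Rightarrow> nat \<Rightarrow> nat \<Rightarrow> int \<Rightarrow> int \<Rightarrow> bool" where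
  "search ok tgt k n X0 X1 \<longleftrightarrow>
     list_all (\<lambda>x. list_all (\<lambda>x1. list_all (\<lambda>x2. list_all (\<lambda>(e0, e1, js).
       list_all (\<lambda>j. \<not> ok (x, x1 - e0, x1 + x2 - e1) j \<or> reaches ok tgt k n (x, x1 - e0, x1 + x2 - e1) j) js)
       [(0, 0, [La, Lb, Lc]), (1, 0, [Lc]), (0, 1, [La])])
       [X0..X1]) [X0..X1]) [X0..X1]"

text \<open>For k = 0 and k = 1 the displacement (1, 0, -1) in a tile a lies on a cycle of the
  left-end walk that avoids 0. The search stops there, and this displacement is refuted through
  other children.\<close>

definition target :: "vec3 \<Rightarrow> letter \<Rightarrow> bool" where
  "target g j \<longleftrightarrow> g = (0, 0, 0) \<or> g = (1, 0, - 1) \<and> j = La"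

text \<open>The numbers enclose 10000 lam and 10000 lam^2 for lam = 1.3247...; the range -7..7 is
  that derived from the extremal histories in \<open>heavy_empty_0\<close>, and 26 is a sufficient
  search depth.\<close>

lemma search_0: "search (admissible (13247, 13248, 17548, 17551) (- 7) 7) target 0 26 (- 7) 7"
  by code_simp

text \<open>Here lam = 1.8392..., the range -3..4 is the one obtained in
  \<open>heavy_empty_1\<close>, and 12 steps suffice.\<close>

lemma search_1: "search (admissible (18392, 18393, 33826, 33831) (- 3) 4) target 1 12 (- 3) 4"
  by code_simp

context pisot begin

text \<open>\<open>lam\<close> is where the increasing function x - k meets the decreasing function
  1/x + 1/x^2, so one evaluation decides on which side a number lies.\<close>

lemma lam_gt:
  assumes "a > 0" "a - real k < 1 / a + 1 / a ^ 2"
  shows "lam > a"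
proof (rule ccontr)
  assume "\<not> lam > a"
  then have "1 / a \<le> 1 / lam" "1 / a ^ 2 \<le> 1 / lam ^ 2"
    using lam_pos by (auto intro!: divide_left_mono power_mono mult_pos_pos)
  then show False using assms(2) lam_minus_k \<open>\<not> lam > a\<close> by linarith
qed

lemma lam_lt:
  assumes "a > 0" "a - real k > 1 / a + 1 / a ^ 2"
  shows "lam < a"
proof (rule ccontr)
  assume "\<not> lam < a"
  then have "1 / lam \<le> 1 / a" "1 / lam ^ 2 \<le> 1 / a ^ 2"
    using assms(1) lam_pos by (auto intro!: divide_left_mono power_mono mult_pos_pos)
  then show False using assms(2) lam_minus_k \<open>\<not> lam < a\<close> by linarith
qed

lemma disp_bounds:
  assumes "real_of_int l0 \<le> 10000 * lam" "10000 * lam \<le> real_of_int l1"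
    "real_of_int q0 \<le> 10000 * lam ^ 2" "10000 * lam ^ 2 \<le> real_of_int q1"
  shows "10000 * el g \<le> of_int (disp_le (l0, l1, q0, q1) g)" "of_int (disp_ge (l0, l1, q0, q1) g) \<le> 10000 * el g"
proof -
  obtain x y z where g: "g = (x, y, z)" by (cases g)
  have m: "real_of_int n * b \<le> real_of_int n * c" if "0 \<le> n \<and> b \<le> c \<or> n < 0 \<and> c \<le> b" for n :: int and b c :: real
    using that by (auto intro: mult_left_mono mult_left_mono_neg)
  have "real_of_int x * (10000 * lam ^ 2) \<le> of_int (if 0 \<le> x then x * q1 else x * q0)"
    "real_of_int z * (10000 * lam) \<le> of_int (if 0 \<le> z then z * l1 else z * l0)"
    "of_int (if 0 \<le> x then x * q0 else x * q1) \<le> real_of_int x * (10000 * lam ^ 2)"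
    "of_int (if 0 \<le> z then z * l0 else z * l1) \<le> real_of_int z * (10000 * lam)"
    using assms by (auto intro!: m)
  then show "10000 * el g \<le> of_int (disp_le (l0, l1, q0, q1) g)" "of_int (disp_ge (l0, l1, q0, q1) g) \<le> 10000 * el g"
    unfolding g by (simp_all add: algebra_simps split del: if_split)
qed

text \<open>A history places a vertex of K among the enumerated starting points. Every vertex of K
  is admissible and has a successor in K, so the recursion of \<open>reaches\<close> can be followed
  inside K until it meets the target.\<close>

lemma search_sound:
  assumes K: "vertex_set K" and X: "\<And>x y z i j. ((x, y, z), i, j) \<in> K \<Longrightarrow> X0 \<le> x \<and> x \<le> X1"
    and b: "real_of_int l0 \<le> 10000 * lam" "10000 * lam \<le> real_of_int l1"
      "real_of_int q0 \<le> 10000 * lam ^ 2" "10000 * lam ^ 2 \<le> real_of_int q1"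
    and s: "search (admissible (l0, l1, q0, q1) X0 X1) tgt k n X0 X1"
  shows "\<exists>g i j. (g, i, j) \<in> K \<and> tgt g j"
proof -
  let ?ok = "admissible (l0, l1, q0, q1) X0 X1"
  note disp = disp_bounds[OF b]
  have adm: "?ok g j" if v: "(g, i, j) \<in> K" for g i j
  proof -
    have nn: "el g \<ge> 0" and h: "(g, i, j) \<in> heavy" using K v by (auto simp: vertex_set_def)
    have lt: "el g < len j" using heavy_range[OF h] by simp
    obtain x y z where g: "g = (x, y, z)" by (cases g)
    have "X0 \<le> fst g \<and> fst g \<le> X1" using X[OF v[unfolded g]] by (simp add: g)
    moreover have "0 \<le> disp_le (l0, l1, q0, q1) g" using disp(1)[of g] nn by linarith
    moreover have "disp_ge (l0, l1, q0, q1) g < disp_le (l0, l1, q0, q1) (letter_vec j)"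
      using disp(2)[of g] disp(1)[of "letter_vec j"] lt by linarith
    moreover have "g \<noteq> letter_vec j" using lt by auto
    ultimately show ?thesis by (simp add: admissible_def)
  qed
  have reach: "\<exists>g i j. (g, i, j) \<in> K \<and> tgt g j" if "(g, i, j) \<in> K" "reaches ?ok tgt k n g j" for g i j n
    using that
  proof (induction n arbitrary: g i j)
    case (Suc n)
    obtain g' j' where w: "(g', hd (sk k i), j') \<in> K" "(g', j') \<in> set (vertex_succs k g j)"
      using K Suc.prems(1) unfolding vertex_set_def by blast
    show ?case
    proof (cases "tgt g j")
      case False
      then have "reaches ?ok tgt k n g' j'" using Suc.prems(2) w(2) adm[OF w(1)] by (auto simp: list_all_iff)
      then show ?thesis using Suc.IH[OF w(1)] by blast
    qed (use Suc.prems(1) in blast)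
  next
    case 0
    then have "tgt g j" by simp
    with 0(1) show ?case by blast
  qed
  obtain g i j where v: "(g, i, j) \<in> K" using K by (auto simp: vertex_set_def)
  obtain x e jj where hh: "history K g x e jj" and j: "jj 0 = j" using vertex_history[OF K v] by blast
  note h = historyD[OF hh]
  have r: "x n \<in> set [X0..X1]" for n
  proof -
    obtain y z i where "((x n, y, z), i, jj n) \<in> K" using h(2) by blast
    from X[OF this] show ?thesis by simp
  qed
  have "e 0 = 0 \<and> e 1 = 0 \<or> e 0 = 1 \<and> e 1 = 0 \<and> j = Lc \<or> e 0 = 0 \<and> e 1 = 1 \<and> j = La"
    using h(5)[of 0] h(5)[of 1] h(6)[of 0] j by auto
  moreover have "j \<in> set [La, Lb, Lc]" by (cases j) auto
  ultimately have "(e 0, e 1, [La, Lb, Lc]) \<in> set [(0, 0, [La, Lb, Lc]), (1, 0, [Lc]), (0, 1, [La])] \<and> j \<in> set [La, Lb, Lc] \<or>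
      (e 0, e 1, [j]) \<in> set [(0, 0, [La, Lb, Lc]), (1, 0, [Lc]), (0, 1, [La])]" by auto
  then obtain js where js: "(e 0, e 1, js) \<in> set [(0, 0, [La, Lb, Lc]), (1, 0, [Lc]), (0, 1, [La])]" "j \<in> set js"
    by (metis list.set_intros(1))
  have "\<not> ?ok (x 0, x 1 - e 0, x 1 + x 2 - e 1) j \<or> reaches ?ok tgt k n (x 0, x 1 - e 0, x 1 + x 2 - e 1) j"
    using s r[of 0] r[of 1] r[of 2] js unfolding search_def list_all_iff by fast
  then have "reaches ?ok tgt k n g j" using adm[OF v] h(1) by simp
  with reach[OF v] show ?thesis by blast
qed

definition recurrence :: "(nat \<Rightarrow> int) \<Rightarrow> nat \<Rightarrow> real" where
  "recurrence x n = real_of_int (x n) * lam ^ 2 + real_of_int (x (n + 1)) * (1 + lam) + real_of_int (x (n + 2)) * lam"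

text \<open>\<open>recurrence\<close> is the displacement without its corrections. Corrections only
  lower the displacement, and adding them to the tile length gives at most lam^2 + lam.\<close>

lemma history_bounds:
  assumes "history K g x e j"
  shows "0 \<le> recurrence x n" "recurrence x n < lam ^ 2 + lam"
proof -
  note h = historyD[OF assms]
  have e: "0 \<le> real_of_int (e n)" "0 \<le> real_of_int (e (n + 1)) * lam"
    using h(5)[of n] h(5)[of "n + 1"] lam_pos by auto
  have eq: "el (x n, x (n + 1) - e n, x (n + 1) + x (n + 2) - e (n + 1)) = recurrence x n - real_of_int (e n) - real_of_int (e (n + 1)) * lam"
    by (simp add: recurrence_def algebra_simps)
  then show "0 \<le> recurrence x n" using h(3)[of n] e by linarith
  have "len (j n) + real_of_int (e n) + real_of_int (e (n + 1)) * lam \<le> lam ^ 2 + lam"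
  proof (cases "e n = 0")
    case True
    have "real_of_int (e (n + 1)) \<le> 1" using h(5)[of "n + 1"] by auto
    then have "real_of_int (e (n + 1)) * lam \<le> 1 * lam" using lam_pos by (intro mult_right_mono) auto
    then show ?thesis using True len_le[of "j n"] by simp
  next
    case False
    then have "e n = 1" "j n = Lc" "e (n + 1) = 0" using h(5)[of n] h(5)[of "n + 1"] by auto
    moreover have "1 \<le> lam ^ 2" using lam_gt_1 by simp
    ultimately show ?thesis by simp
  qed
  then show "recurrence x n < lam ^ 2 + lam" using h(4)[of n] eq by linarith
qed

lemma extremal_histories:
  assumes K: "vertex_set K"
  obtains x x' :: "nat \<Rightarrow> int" where
    "\<forall>a b c i j. ((a, b, c), i, j) \<in> K \<longrightarrow> x' 0 \<le> a \<and> a \<le> x 0"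
    "\<forall>y\<in>{x, x'}. \<forall>n. x' 0 \<le> y n \<and> y n \<le> x 0 \<and> 0 \<le> recurrence y n \<and> recurrence y n < lam ^ 2 + lam"
proof -
  obtain L U :: int where LU: "\<forall>x y z i j. ((x, y, z), i, j) \<in> K \<longrightarrow> L \<le> x \<and> x \<le> U"
    "\<exists>y z i j. ((U, y, z), i, j) \<in> K" "\<exists>y z i j. ((L, y, z), i, j) \<in> K"
    by (rule first_coordinates_bounded[OF K])
  obtain y z i j where "((U, y, z), i, j) \<in> K" using LU(2) by blast
  then obtain x e jj where hU: "history K (U, y, z) x e jj" using vertex_history[OF K] by blast
  obtain y' z' i' j' where "((L, y', z'), i', j') \<in> K" using LU(3) by blast
  then obtain x' e' jj' where hL: "history K (L, y', z') x' e' jj'" using vertex_history[OF K] by blast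
  have 0: "x 0 = U" "x' 0 = L" using historyD(1)[OF hU] historyD(1)[OF hL] by auto
  have b: "L \<le> x n \<and> x n \<le> U" if h: "history K g x e jj" for g x e jj n
  proof -
    obtain y z i where "((x n, y, z), i, jj n) \<in> K" using historyD(2)[OF h] by blast
    then show ?thesis using LU(1) by blast
  qed
  show ?thesis
    by (rule that[of x' x]) (use LU(1) b[OF hU] b[OF hL] history_bounds[OF hU] history_bounds[OF hL] in \<open>auto simp: 0\<close>)
qed

lemma vertex_set_first_letter:
  assumes "vertex_set K" "(g, i, j) \<in> K" "k \<ge> 1"
  shows "i = La"
proof -
  obtain g1 i1 j1 where 1: "(g1, i1, j1) \<in> K" "i = hd (sk k i1)" using assms(1,2) unfolding vertex_set_def by blast
  obtain g2 i2 j2 where 2: "(g2, i2, j2) \<in> K" "i1 = hd (sk k i2)" using assms(1) 1 unfolding vertex_set_def by blast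
  show ?thesis unfolding 1 2 using assms(3) by (cases i2; cases k) auto
qed

lemma heavy_empty_1: "k = 1 \<Longrightarrow> heavy = {}"
proof (rule ccontr)
  assume k: "k = 1" and "heavy \<noteq> {}"
  then obtain K where K: "vertex_set K" using vertex_set_exists by blast
  have l3: "lam ^ 3 = lam ^ 2 + lam + 1" using lam_eq k by simp
  have low: "lam > 18392 / 10000" using k by (intro lam_gt) (simp_all add: power2_eq_square)
  have upp: "lam < 18393 / 10000" using k by (intro lam_lt) (simp_all add: power2_eq_square)
  have sq: "(18392 / 10000) ^ 2 \<le> lam ^ 2" "lam ^ 2 \<le> (18393 / 10000) ^ 2"
    using low upp by (auto intro!: power_mono)
  obtain x x' :: "nat \<Rightarrow> int" where X: "\<forall>a b c i j. ((a, b, c), i, j) \<in> K \<longrightarrow> x' 0 \<le> a \<and> a \<le> x 0"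
    and r: "\<forall>y\<in>{x, x'}. \<forall>n. x' 0 \<le> y n \<and> y n \<le> x 0 \<and> 0 \<le> recurrence y n \<and> recurrence y n < lam ^ 2 + lam"
    by (rule extremal_histories[OF K])
  have 4: "lam * lam ^ 3 = 2 * lam ^ 2 + 2 * lam + 1"
  proof -
    have "lam * lam ^ 3 = lam ^ 3 + lam ^ 2 + lam"
      by (subst l3) (simp add: power2_eq_square power3_eq_cube algebra_simps)
    then show ?thesis using l3 by simp
  qed
  have e: "lam ^ 3 - (1 + lam) ^ 2 = - lam" unfolding l3 by (simp add: power2_eq_square algebra_simps)
  \<comment> \<open>The combination eliminates y 1. The coefficients of y 2 and y 3 are nonnegative,
    so bounding both by the extreme value y 0 leaves the factor lam^2 + 1 in front of it.\<close>
  have id: "(2 * lam ^ 2 + 2 * lam + 1) * real_of_int (y 0) = lam ^ 2 * recurrence y 0 - (1 + lam) * recurrence y 1 +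
      lam * real_of_int (y 2) + (lam + lam ^ 2) * real_of_int (y 3)" for y
  proof -
    have "lam ^ 2 * recurrence y 0 - (1 + lam) * recurrence y 1 = (lam * lam ^ 3) * real_of_int (y 0) +
        (lam ^ 3 - (1 + lam) ^ 2) * real_of_int (y 2) - (1 + lam) * lam * real_of_int (y 3)"
      by (simp add: recurrence_def numeral_2_eq_2 numeral_3_eq_3 power2_eq_square power3_eq_cube algebra_simps)
    then show ?thesis unfolding 4 e by (simp add: power2_eq_square algebra_simps)
  qed
  have F: "lam ^ 2 * (lam ^ 2 + lam) = 3 * lam ^ 2 + 3 * lam + 2" "(1 + lam) * (lam ^ 2 + lam) = 3 * lam ^ 2 + 2 * lam + 1"
  proof -
    have "lam ^ 2 * (lam ^ 2 + lam) = lam * lam ^ 3 + lam ^ 3" by (simp add: power2_eq_square power3_eq_cube algebra_simps)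
    then show "lam ^ 2 * (lam ^ 2 + lam) = 3 * lam ^ 2 + 3 * lam + 2" unfolding 4 using l3 by simp
    have "(1 + lam) * (lam ^ 2 + lam) = lam ^ 3 + 2 * lam ^ 2 + lam" by (simp add: power2_eq_square power3_eq_cube algebra_simps)
    then show "(1 + lam) * (lam ^ 2 + lam) = 3 * lam ^ 2 + 2 * lam + 1" using l3 by simp
  qed
  have c: "0 < lam ^ 2" "0 < 1 + lam" "0 \<le> lam" "0 \<le> lam + lam ^ 2" using lam_pos by auto
  have "lam ^ 2 * recurrence x 0 < lam ^ 2 * (lam ^ 2 + lam)" "0 \<le> (1 + lam) * recurrence x 1"
    "lam * real_of_int (x 2) \<le> lam * real_of_int (x 0)" "(lam + lam ^ 2) * real_of_int (x 3) \<le> (lam + lam ^ 2) * real_of_int (x 0)"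
    using r c by (auto intro: mult_strict_left_mono mult_left_mono)
  then have key1: "(lam ^ 2 + 1) * real_of_int (x 0) < 3 * lam ^ 2 + 3 * lam + 2"
    using id[of x] unfolding F by (simp add: algebra_simps)
  have "0 \<le> lam ^ 2 * recurrence x' 0" "(1 + lam) * recurrence x' 1 < (1 + lam) * (lam ^ 2 + lam)"
    "lam * real_of_int (x' 0) \<le> lam * real_of_int (x' 2)" "(lam + lam ^ 2) * real_of_int (x' 0) \<le> (lam + lam ^ 2) * real_of_int (x' 3)"
    using r c by (auto intro: mult_strict_left_mono mult_left_mono)
  then have key2: "- (3 * lam ^ 2 + 2 * lam + 1) < (lam ^ 2 + 1) * real_of_int (x' 0)"
    using id[of x'] unfolding F by (simp add: algebra_simps)
  have U: "x 0 \<le> 4"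
  proof (rule ccontr)
    assume "\<not> x 0 \<le> 4"
    then have "(lam ^ 2 + 1) * 5 \<le> (lam ^ 2 + 1) * real_of_int (x 0)" by (intro mult_left_mono) auto
    then show False using key1 low upp sq by (simp add: power2_eq_square)
  qed
  have L: "x' 0 \<ge> - 3"
  proof (rule ccontr)
    assume "\<not> x' 0 \<ge> - 3"
    then have "(lam ^ 2 + 1) * real_of_int (x' 0) \<le> (lam ^ 2 + 1) * (- 4)" by (intro mult_left_mono) auto
    then show False using key2 low upp sq by (simp add: power2_eq_square)
  qed
  have "\<exists>g i j. (g, i, j) \<in> K \<and> target g j"
  proof (rule search_sound[OF K, of "- 3" 4 18392 18393 33826 33831])
    show "- 3 \<le> a \<and> a \<le> 4" if "((a, b, c), i, j) \<in> K" for a b c i j using X that U L by force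
    show "search (admissible (18392, 18393, 33826, 33831) (- 3) 4) target k 12 (- 3) 4" unfolding k by (rule search_1)
  qed (use low upp sq in \<open>auto simp: power2_eq_square\<close>)
  then obtain g i j where w: "(g, i, j) \<in> K" "target g j" by blast
  have i: "i = La" using vertex_set_first_letter[OF K w(1)] k by simp
  have h: "(g, La, j) \<in> heavy" using w(1) K i by (auto simp: vertex_set_def)
  show False
  proof (cases "g = (0, 0, 0)")
    case True
    then show ?thesis using h heavy_zero_pos[of La j] k by (simp add: zero_prod_def)
  next
    case False
    then have "((1, 0, - 1), La, La) \<in> heavy" using h w(2) by (simp add: target_def)
    \<comment> \<open>The left-end walk would return to its start; the child in the b-tile of the
      second strand leads to displacement 0 in four steps instead.\<close>
    then have "((- 1, 1, 1), La, Lb) \<in> heavy"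
      by (rule heavy_step[where p = "[]" and q = "[La]" and r = "[Lb, Lc]" and r' = "[Lc]"]) (use k low upp sq in \<open>auto simp: power2_eq_square\<close>)
    then have "((0, - 1, 0), La, Lc) \<in> heavy"
      by (rule heavy_step[where p = "[]" and q = "[]" and r = "[Lb, Lc]" and r' = "[]"]) (use k low upp sq in \<open>auto simp: power2_eq_square\<close>)
    then have "((0, 0, - 1), La, La) \<in> heavy"
      by (rule heavy_step[where p = "[]" and q = "[]" and r = "[Lb, Lc]" and r' = "[]"]) (use k low upp sq in \<open>auto simp: power2_eq_square\<close>)
    then have "((0, 0, 0), Lb, La) \<in> heavy"
      by (rule heavy_step[where p = "[La]" and q = "[]" and r = "[Lc]" and r' = "[Lb, Lc]"]) (use k low upp sq in \<open>auto simp: power2_eq_square\<close>)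
    then show ?thesis using heavy_zero_pos[of Lb La] k by (simp add: zero_prod_def)
  qed
qed

lemma heavy_empty_0: "k = 0 \<Longrightarrow> heavy = {}"
proof (rule ccontr)
  assume k: "k = 0" and "heavy \<noteq> {}"
  then obtain K where K: "vertex_set K" using vertex_set_exists by blast
  have l3: "lam ^ 3 = lam + 1" using lam_eq k by simp
  have low: "lam > 13247 / 10000" using k by (intro lam_gt) (simp_all add: power2_eq_square)
  have upp: "lam < 13248 / 10000" using k by (intro lam_lt) (simp_all add: power2_eq_square)
  have sq: "(13247 / 10000) ^ 2 \<le> lam ^ 2" "lam ^ 2 \<le> (13248 / 10000) ^ 2"
    using low upp by (auto intro!: power_mono)
  have sq': "lam ^ 2 > 17548 / 10000" "lam ^ 2 < 17551 / 10000" using sq by (simp_all add: power2_eq_square)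
  obtain x x' :: "nat \<Rightarrow> int" where X: "\<forall>a b c i j. ((a, b, c), i, j) \<in> K \<longrightarrow> x' 0 \<le> a \<and> a \<le> x 0"
    and r: "\<forall>y\<in>{x, x'}. \<forall>n. x' 0 \<le> y n \<and> y n \<le> x 0 \<and> 0 \<le> recurrence y n \<and> recurrence y n < lam ^ 2 + lam"
    by (rule extremal_histories[OF K])
  \<comment> \<open>The multipliers 1, -lam, 1, -(lam - 1) eliminate y 1, y 2 and y 3 in turn, by
    lam^3 = lam + 1.\<close>
  have id: "lam ^ 2 * real_of_int (y 0) = recurrence y 0 - lam * recurrence y 1 + recurrence y 2 - (lam - 1) * recurrence y 3 -
      lam ^ 2 * ((lam - 1) * real_of_int (y 4)) + lam ^ 2 * ((2 - lam ^ 2) * real_of_int (y 5))" for y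
    unfolding recurrence_def
    using arg_cong[OF l3, of "\<lambda>t. t * real_of_int (y 0)"] arg_cong[OF l3, of "\<lambda>t. t * real_of_int (y 1)"]
      arg_cong[OF l3, of "\<lambda>t. t * real_of_int (y 2)"] arg_cong[OF l3, of "\<lambda>t. t * real_of_int (y 3)"]
      arg_cong[OF l3, of "\<lambda>t. t * real_of_int (y 4)"] arg_cong[OF l3, of "\<lambda>t. t * real_of_int (y 5)"]
      arg_cong[OF l3, of "\<lambda>t. lam * t * real_of_int (y 2)"] arg_cong[OF l3, of "\<lambda>t. lam * t * real_of_int (y 3)"]
      arg_cong[OF l3, of "\<lambda>t. lam * t * real_of_int (y 4)"] arg_cong[OF l3, of "\<lambda>t. lam * t * real_of_int (y 5)"]
    by (simp add: power2_eq_square power3_eq_cube numeral_eq_Suc algebra_simps)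
  have "lam ^ 2 * lam ^ 2 = lam * lam ^ 3" by (simp add: power2_eq_square power3_eq_cube)
  then have F: "lam ^ 2 + lam = lam ^ 2 * lam ^ 2" unfolding l3 by (simp add: power2_eq_square algebra_simps)
  have f: "0 \<le> recurrence y n" "recurrence y n < lam ^ 2 * lam ^ 2" "real_of_int (x' 0) \<le> real_of_int (y n)"
    "real_of_int (y n) \<le> real_of_int (x 0)" if "y = x \<or> y = x'" for y n
    using r that unfolding F by auto
  note fx = f[OF disjI1[OF refl]] and fx' = f[OF disjI2[OF refl]]
  have c: "0 < lam ^ 2" "0 < lam - 1" "0 < lam" "0 \<le> 2 - lam ^ 2" using lam_gt_1 sq' by auto
  define u m where "u = real_of_int (x 0)" and "m = - real_of_int (x' 0)"
  \<comment> \<open>Since y 4 enters with a negative sign, the bound for the maximum u involves the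
    minimum -m and conversely. The two inequalities together give u < 8 and m < 8.\<close>
  have key1: "(lam ^ 2 - 1) * u < 2 * lam ^ 2 + (lam - 1) * m"
  proof -
    have a: "0 \<le> lam * recurrence x 1" "0 \<le> (lam - 1) * recurrence x 3"
      "lam ^ 2 * ((lam - 1) * (- m)) \<le> lam ^ 2 * ((lam - 1) * real_of_int (x 4))"
      "lam ^ 2 * ((2 - lam ^ 2) * real_of_int (x 5)) \<le> lam ^ 2 * ((2 - lam ^ 2) * u)"
      using fx c by (auto intro!: mult_left_mono simp: u_def m_def simp del: mult_minus_right)
    have "lam ^ 2 * u < 2 * (lam ^ 2 * lam ^ 2) - lam ^ 2 * ((lam - 1) * (- m)) + lam ^ 2 * ((2 - lam ^ 2) * u)"
      using a id[of x, folded u_def] fx(2)[of 0] fx(2)[of 2] by linarith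
    also have "\<dots> = lam ^ 2 * (2 * lam ^ 2 + (lam - 1) * m + (2 - lam ^ 2) * u)"
      by (simp add: algebra_simps)
    finally have "u < 2 * lam ^ 2 + (lam - 1) * m + (2 - lam ^ 2) * u" using c(1) by (simp only: mult_less_cancel_left_pos)
    then show ?thesis by (simp add: algebra_simps)
  qed
  have key2: "(lam ^ 2 - 1) * m < 2 * lam + 2 - lam ^ 2 + (lam - 1) * u"
  proof -
    have a: "lam * recurrence x' 1 < lam * (lam ^ 2 * lam ^ 2)" "(lam - 1) * recurrence x' 3 < (lam - 1) * (lam ^ 2 * lam ^ 2)"
      "lam ^ 2 * ((lam - 1) * real_of_int (x' 4)) \<le> lam ^ 2 * ((lam - 1) * u)"
      "lam ^ 2 * ((2 - lam ^ 2) * (- m)) \<le> lam ^ 2 * ((2 - lam ^ 2) * real_of_int (x' 5))"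
      using fx' c by (auto intro!: mult_left_mono mult_strict_left_mono simp: u_def m_def simp del: mult_minus_right)
    have "lam ^ 2 * (- m) > - (lam * (lam ^ 2 * lam ^ 2)) - (lam - 1) * (lam ^ 2 * lam ^ 2) - lam ^ 2 * ((lam - 1) * u) +
        lam ^ 2 * ((2 - lam ^ 2) * (- m))"
      using a id[of x'] fx'(1)[of 0] fx'(1)[of 2] unfolding m_def minus_minus by linarith
    moreover have "lam * (lam ^ 2 * lam ^ 2) + (lam - 1) * (lam ^ 2 * lam ^ 2) = lam ^ 2 * (2 * lam + 2 - lam ^ 2)"
    proof -
      have "lam * (lam ^ 2 * lam ^ 2) + (lam - 1) * (lam ^ 2 * lam ^ 2) = lam ^ 2 * (2 * lam ^ 3 - lam ^ 2)"
        by (simp add: power2_eq_square power3_eq_cube algebra_simps)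
      then show ?thesis unfolding l3 by (simp add: algebra_simps)
    qed
    ultimately have "lam ^ 2 * m < lam ^ 2 * (2 * lam + 2 - lam ^ 2) + lam ^ 2 * ((lam - 1) * u) + lam ^ 2 * ((2 - lam ^ 2) * m)"
      by simp
    then have "lam ^ 2 * m < lam ^ 2 * (2 * lam + 2 - lam ^ 2 + (lam - 1) * u + (2 - lam ^ 2) * m)"
      by (simp only: distrib_left)
    then have "m < 2 * lam + 2 - lam ^ 2 + (lam - 1) * u + (2 - lam ^ 2) * m" using c(1) by (simp only: mult_less_cancel_left_pos)
    then show ?thesis by (simp add: algebra_simps)
  qed
  have lo: "7548 / 10000 * t \<le> (lam ^ 2 - 1) * t" if "t \<ge> 0" for t
    by (rule mult_right_mono) (use that sq' in auto)
  have hi: "(lam - 1) * t \<le> 3248 / 10000 * t" if "t \<ge> 0" for t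
    by (rule mult_right_mono) (use that upp in auto)
  have neg: "(lam ^ 2 - 1) * t \<le> 0" "(lam - 1) * t \<le> 0" if "t \<le> 0" for t
    using that sq' lam_gt_1 by (auto simp: mult_le_0_iff)
  have U: "x 0 \<le> 7"
  proof (rule ccontr)
    assume "\<not> x 0 \<le> 7"
    then have "u \<ge> 8" by (simp add: u_def)
    then have u: "u \<ge> 8" "u \<ge> 0" by simp_all
    show False
    proof (cases "m \<ge> 0")
      case True
      then show ?thesis using u(1) key1 key2 lo[OF u(2)] hi[OF u(2)] lo[OF True] hi[OF True] sq' upp by linarith
    next
      case False
      then have "(lam - 1) * m \<le> 0" using neg(2)[of m] by simp
      then show ?thesis using u(1) key1 lo[OF u(2)] sq' by linarith
    qed
  qed
  have L: "x' 0 \<ge> - 7"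
  proof (rule ccontr)
    assume "\<not> x' 0 \<ge> - 7"
    then have "m \<ge> 8" by (simp add: m_def)
    then have m: "m \<ge> 8" "m \<ge> 0" by simp_all
    show False
    proof (cases "u \<ge> 0")
      case True
      then show ?thesis using m(1) key1 key2 lo[OF m(2)] hi[OF m(2)] lo[OF True] hi[OF True] sq' upp by linarith
    next
      case False
      then have "(lam - 1) * u \<le> 0" using neg(2)[of u] by simp
      then show ?thesis using m(1) key2 lo[OF m(2)] sq' upp by linarith
    qed
  qed
  have "\<exists>g i j. (g, i, j) \<in> K \<and> target g j"
  proof (rule search_sound[OF K, of "- 7" 7 13247 13248 17548 17551])
    show "- 7 \<le> a \<and> a \<le> 7" if "((a, b, c), i, j) \<in> K" for a b c i j using X that U L by force
    show "search (admissible (13247, 13248, 17548, 17551) (- 7) 7) target k 26 (- 7) 7" unfolding k by (rule search_0)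
  qed (use low upp sq' in auto)
  then obtain g i j where w: "(g, i, j) \<in> K" "target g j" by blast
  have h: "(g, i, j) \<in> heavy" using w(1) K by (auto simp: vertex_set_def)
  note num = k low upp sq'
  \<comment> \<open>In the left-end walk this displacement recurs after five steps; the child in the
    c-tile of the second strand reaches a coincidence in four.\<close>
  have aa: "((1, 0, - 1), La, La) \<notin> heavy"
  proof
    assume "((1, 0, - 1), La, La) \<in> heavy"
    then have "((- 1, 0, 1), Lb, Lc) \<in> heavy"
      by (rule heavy_step[where p = "[]" and q = "[Lb]" and r = "[Lc]" and r' = "[]"]) (use num in auto)
    then have "((1, - 1, - 1), Lc, La) \<in> heavy"
      by (rule heavy_step[where p = "[]" and q = "[]" and r = "[]" and r' = "[]"]) (use num in auto)
    then have "((- 1, 1, 0), La, Lb) \<in> heavy"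
      by (rule heavy_step[where p = "[]" and q = "[]" and r = "[]" and r' = "[Lc]"]) (use num in auto)
    then have "((0, 0, 0), Lc, Lc) \<in> heavy"
      by (rule heavy_step[where p = "[Lb]" and q = "[]" and r = "[]" and r' = "[]"]) (use num in auto)
    then show False using not_heavy_coincident by (simp add: zero_prod_def)
  qed
  have ba': "((1, 0, - 1), Lb, La) \<notin> heavy"
  proof
    assume "((1, 0, - 1), Lb, La) \<in> heavy"
    then have "((- 1, 1, 1), Lc, Lb) \<in> heavy"
      by (rule heavy_step[where p = "[]" and q = "[]" and r = "[]" and r' = "[Lc]"]) (use num in auto)
    then have "((1, - 1, 0), La, Lc) \<in> heavy"
      by (rule heavy_step[where p = "[]" and q = "[]" and r = "[]" and r' = "[]"]) (use num in auto)
    then have "((0, 1, 0), Lb, La) \<in> heavy"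
      by (rule heavy_step[where p = "[]" and q = "[]" and r = "[Lc]" and r' = "[]"]) (use num in auto)
    then have "((0, - 1, 1), Lc, Lc) \<in> heavy"
      by (rule heavy_step[where p = "[]" and q = "[Lb]" and r = "[]" and r' = "[]"]) (use num in auto)
    then have "((1, 0, - 1), La, La) \<in> heavy"
      by (rule heavy_step[where p = "[]" and q = "[]" and r = "[]" and r' = "[]"]) (use num in auto)
    then show False using aa by simp
  qed
  have ca': "((0, 1, 0), Lc, La) \<notin> heavy"
  proof
    assume "((0, 1, 0), Lc, La) \<in> heavy"
    then have "((0, - 1, 1), La, Lc) \<in> heavy"
      by (rule heavy_step[where p = "[]" and q = "[Lb]" and r = "[]" and r' = "[]"]) (use num in auto)
    then have "((1, 0, - 1), Lb, La) \<in> heavy"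
      by (rule heavy_step[where p = "[]" and q = "[]" and r = "[Lc]" and r' = "[]"]) (use num in auto)
    then show False using ba' by simp
  qed
  have cc: "((1, 0, - 1), Lc, La) \<notin> heavy"
  proof
    assume "((1, 0, - 1), Lc, La) \<in> heavy"
    then have "((- 1, 1, 1), La, Lb) \<in> heavy"
      by (rule heavy_step[where p = "[]" and q = "[]" and r = "[]" and r' = "[Lc]"]) (use num in auto)
    then have "((1, - 1, 0), Lb, Lc) \<in> heavy"
      by (rule heavy_step[where p = "[]" and q = "[]" and r = "[Lc]" and r' = "[]"]) (use num in auto)
    then have "((0, 1, 0), Lc, La) \<in> heavy"
      by (rule heavy_step[where p = "[]" and q = "[]" and r = "[]" and r' = "[]"]) (use num in auto)
    then show False using ca' by simp
  qed
  have ac: "(0, La, Lc) \<notin> heavy"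
  proof
    assume "(0, La, Lc) \<in> heavy"
    then have "((0, 1, 0), Lc, La) \<in> heavy"
      by (rule heavy_step[where p = "[Lb]" and q = "[]" and r = "[]" and r' = "[]"]) (use num in \<open>auto simp: zero_prod_def\<close>)
    then show False using ca' by simp
  qed
  have sym: "(0, j, i) \<in> heavy" if "(0, i, j) \<in> heavy" for i j using heavy_uminus[OF that] by simp
  have rot: "(0, hd (sk 0 i), hd (sk 0 j)) \<in> heavy" if "(0, i, j) \<in> heavy" for i j
    using heavy_first_letters[OF that] k by simp
  have ca: "(0, Lc, La) \<notin> heavy" using ac sym by blast
  have bc: "(0, Lb, Lc) \<notin> heavy" "(0, Lc, Lb) \<notin> heavy" using ca ac rot[of Lb Lc] rot[of Lc Lb] by auto
  have ab: "(0, La, Lb) \<notin> heavy" "(0, Lb, La) \<notin> heavy" using bc rot[of La Lb] rot[of Lb La] by auto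
  have zero: "(0, i, j) \<notin> heavy" for i j
    using ac ca bc ab not_heavy_coincident by (cases i; cases j) auto
  show False
  proof (cases "g = (0, 0, 0)")
    case True
    then show ?thesis using h zero[of i j] by (simp add: zero_prod_def)
  next
    case False
    then have "g = (1, 0, - 1)" "j = La" using w(2) by (auto simp: target_def)
    then show ?thesis using h aa ba' cc by (cases i) auto
  qed
qed

theorem heavy_empty: "heavy = {}"
  using heavy_empty_0 heavy_empty_1 heavy_empty_ge_2 by (cases "k = 0"; cases "k = 1") auto

end

section \<open>Rotations of the torus\<close>

definition int_lattice :: "(real^2) set" where
  "int_lattice = {z. \<forall>i. z $ i \<in> \<int>}"

definition unit_square :: "(real^2) set" where
  "unit_square = {x. \<forall>i. 0 \<le> x $ i \<and> x $ i < 1}"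

definition vec_frac :: "real^2 \<Rightarrow> real^2" where
  "vec_frac x = (\<chi> i. frac (x $ i))"

text \<open>The section of the projection with values in the half-open unit square; unlike
  \<open>rep_torus2\<close> it is a definite representative and will be measurable.\<close>

definition torus_frac :: "torus2 \<Rightarrow> real^2" where
  "torus_frac t = vec_frac (rep_torus2 t)"

lemma lattice_equiv_iff: "lattice_equiv x y \<longleftrightarrow> x - y \<in> int_lattice"
  by (simp add: lattice_equiv_def int_lattice_def)

lemma int_lattice_closed_ops:
  "0 \<in> int_lattice" "x \<in> int_lattice \<Longrightarrow> - x \<in> int_lattice"
  "x \<in> int_lattice \<Longrightarrow> y \<in> int_lattice \<Longrightarrow> x + y \<in> int_lattice"
  "x \<in> int_lattice \<Longrightarrow> y \<in> int_lattice \<Longrightarrow> x - y \<in> int_lattice"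
  by (auto simp: int_lattice_def)

lemma closed_int_lattice: "closed int_lattice"
proof -
  have "int_lattice = (\<Inter>i. (\<lambda>z. z $ i) -` \<int>)" by (auto simp: int_lattice_def)
  also have "closed \<dots>" by (intro closed_INT ballI closed_vimage closed_Ints continuous_intros)
  finally show ?thesis .
qed

lemma countable_int_lattice: "countable int_lattice"
proof -
  have "int_lattice \<subseteq> (\<lambda>(a, b). vector [a, b]) ` (\<int> \<times> \<int>)"
  proof
    fix z assume "z \<in> int_lattice"
    moreover have "z = vector [z $ 1, z $ 2]" by (simp add: vec_eq_iff forall_2)
    ultimately show "z \<in> (\<lambda>(a, b). vector [a, b]) ` (\<int> \<times> \<int>)"
      by (intro image_eqI[of _ _ "(z $ 1, z $ 2)"]) (auto simp: int_lattice_def)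
  qed
  moreover have "countable ((\<lambda>(a, b). vector [a, b] :: real^2) ` (\<int> \<times> \<int>))"
    by (intro countable_image countable_SIGMA) (auto simp: Ints_def)
  ultimately show ?thesis by (rule countable_subset)
qed

lemma torus2_proj_eq_iff: "torus2_proj x = torus2_proj y \<longleftrightarrow> x - y \<in> int_lattice"
  by (simp add: torus2.abs_eq_iff lattice_equiv_iff)

lemma torus2_proj_add: "torus2_proj (x + y) = torus2_proj x + torus2_proj y"
  by (simp add: plus_torus2.abs_eq)

lemma torus2_proj_uminus: "torus2_proj (- x) = - torus2_proj x"
  by (simp add: uminus_torus2.abs_eq)

lemma torus2_proj_zero: "torus2_proj 0 = 0"
  by (simp add: zero_torus2.abs_eq)

lemma torus2_proj_rep [simp]: "torus2_proj (rep_torus2 t) = t"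
  by (simp add: Quotient_abs_rep[OF Quotient_torus2])

lemma torus2_proj_frac [simp]: "torus2_proj (vec_frac x) = torus2_proj x"
  by (simp add: torus2_proj_eq_iff int_lattice_def vec_frac_def frac_def)

lemma torus2_proj_torus_frac [simp]: "torus2_proj (torus_frac t) = t"
  by (simp add: torus_frac_def)

lemma vec_frac_in_unit_square: "vec_frac x \<in> unit_square"
  by (simp add: vec_frac_def unit_square_def frac_lt_1)

lemma unit_square_unique:
  assumes "x \<in> unit_square" "y \<in> unit_square" "x - y \<in> int_lattice"
  shows "x = y"
proof -
  have "x $ i = y $ i" for i
  proof -
    obtain n where n: "x $ i - y $ i = of_int n" using assms(3) by (auto simp: int_lattice_def elim: Ints_cases)
    moreover have "\<bar>x $ i - y $ i\<bar> < 1" using assms(1,2) by (auto simp: unit_square_def abs_less_iff) (smt (verit) assms)+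
    ultimately have "n = 0" by linarith
    then show ?thesis using n by simp
  qed
  then show ?thesis by (simp add: vec_eq_iff)
qed

lemma vec_frac_unit_square: "x \<in> unit_square \<Longrightarrow> vec_frac x = x"
  by (simp add: vec_frac_def unit_square_def vec_eq_iff frac_eq)

lemma torus_frac_in_unit_square: "torus_frac t \<in> unit_square"
  by (simp add: torus_frac_def vec_frac_in_unit_square)

lemma torus_frac_proj: "torus_frac (torus2_proj x) = vec_frac x"
  by (intro unit_square_unique torus_frac_in_unit_square vec_frac_in_unit_square)
    (simp flip: torus2_proj_eq_iff)

lemma open_torus2_iff: "open U \<longleftrightarrow> open (torus2_proj -` U)"
  by (simp add: open_torus2_def)

lemma closed_torus2_iff: "closed S \<longleftrightarrow> closed (torus2_proj -` S)"
  by (simp add: closed_def open_torus2_iff vimage_Compl)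

lemma continuous_on_torus2_proj: "continuous_on A torus2_proj"
  by (rule continuous_on_subset[OF _ subset_UNIV]) (auto simp: continuous_on_open_vimage open_torus2_iff)

lemma vimage_torus2_proj_image: "torus2_proj -` (torus2_proj ` K) = (\<Union>x\<in>int_lattice. \<Union>y\<in>K. {x + y})"
proof (intro set_eqI iffI)
  fix v assume "v \<in> torus2_proj -` (torus2_proj ` K)"
  then obtain y where "y \<in> K" "v - y \<in> int_lattice" by (auto simp: torus2_proj_eq_iff)
  then show "v \<in> (\<Union>x\<in>int_lattice. \<Union>y\<in>K. {x + y})" by (intro UN_I[of "v - y"] UN_I[of y]) auto
next
  fix v assume "v \<in> (\<Union>x\<in>int_lattice. \<Union>y\<in>K. {x + y})"
  then obtain x y where "x \<in> int_lattice" "y \<in> K" "v = x + y" by auto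
  then show "v \<in> torus2_proj -` (torus2_proj ` K)" by (auto simp: torus2_proj_eq_iff intro!: image_eqI[of _ _ y])
qed

text \<open>The full preimage is the sum of the closed lattice and a compact set.\<close>

lemma closed_torus2_proj_image: "compact K \<Longrightarrow> closed (torus2_proj ` K)"
  unfolding closed_torus2_iff vimage_torus2_proj_image by (intro closed_compact_sums closed_int_lattice)

lemma torus2_translation_continuous: "continuous_on A (\<lambda>x :: torus2. x + t)"
proof (rule continuous_on_subset[OF _ subset_UNIV])
  have "open ((\<lambda>x. x + t) -` U)" if "open U" for U
  proof -
    have "torus2_proj -` ((\<lambda>x. x + t) -` U) = (\<lambda>v. v + rep_torus2 t) -` (torus2_proj -` U)"
      by (auto simp: torus2_proj_add)
    also have "open \<dots>"
      by (rule open_vimage) (use that in \<open>simp add: open_torus2_iff\<close>, intro continuous_intros)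
    finally show ?thesis by (simp add: open_torus2_iff)
  qed
  then show "continuous_on UNIV (\<lambda>x :: torus2. x + t)" by (simp add: continuous_on_open_vimage)
qed

lemma torus2_translation_measurable [measurable]: "(\<lambda>x :: torus2. x + t) \<in> borel_measurable borel"
  by (intro borel_measurable_continuous_onI torus2_translation_continuous)

lemma torus_frac_measurable [measurable]: "torus_frac \<in> borel_measurable borel"
proof -
  have "(\<lambda>t. torus_frac t $ i) \<in> borel_measurable borel" for i
  proof (rule borel_measurable_iff_le[THEN iffD2], intro allI)
    fix c :: real
    \<comment> \<open>Compact boxes exhaust the half-open square from inside, so the sublevel set
      becomes a countable union of closed images.\<close>
    define K where "K n = {v :: real^2. (\<forall>j. 0 \<le> v $ j \<and> v $ j \<le> 1 - 1 / real (Suc n)) \<and> v $ i \<le> c}" for n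
    have "K n = cbox 0 (\<chi> j. 1 - 1 / real (Suc n)) \<inter> {v. v $ i \<le> c}" for n
      by (auto simp: K_def mem_box_cart)
    then have "compact (K n)" for n
      by (auto intro!: compact_Int_closed compact_cbox closed_Collect_le continuous_intros)
    then have "torus2_proj ` K n \<in> sets borel" for n
      by (intro borel_closed closed_torus2_proj_image)
    moreover have "{t. torus_frac t $ i \<le> c} = (\<Union>n. torus2_proj ` K n)"
    proof (intro set_eqI iffI)
      fix t assume t: "t \<in> {t. torus_frac t $ i \<le> c}"
      let ?v = "torus_frac t"
      define m where "m = max (?v $ 1) (?v $ 2)"
      have "m < 1" using torus_frac_in_unit_square[of t] by (simp add: m_def unit_square_def)
      then obtain n where n: "inverse (real (Suc n)) < 1 - m" using reals_Archimedean[of "1 - m"] by auto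
      have "?v $ j \<le> m" for j using exhaust_2[of j] by (auto simp: m_def)
      then have "?v \<in> K n" using t torus_frac_in_unit_square[of t] n
        by (auto simp: K_def unit_square_def inverse_eq_divide) (smt (verit))
      then show "t \<in> (\<Union>n. torus2_proj ` K n)" by (intro UN_I[of n] image_eqI[of _ _ ?v]) auto
    next
      fix t assume "t \<in> (\<Union>n. torus2_proj ` K n)"
      then obtain n v where v: "v \<in> K n" "t = torus2_proj v" by auto
      have "1 - 1 / real (Suc n) < 1" by simp
      with v(1) have "v \<in> unit_square" unfolding K_def unit_square_def by (auto intro: le_less_trans)
      then show "t \<in> {t. torus_frac t $ i \<le> c}" using v by (simp add: torus_frac_proj vec_frac_unit_square K_def)
    qed
    ultimately show "{t \<in> space borel. torus_frac t $ i \<le> c} \<in> sets borel" by auto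
  qed
  then show ?thesis
    by (subst borel_measurable_euclidean_space) (auto simp: Basis_vec_def inner_axis)
qed

lemma unit_square_borel [measurable]: "unit_square \<in> sets borel"
proof -
  have "unit_square = (\<Inter>i. {x. 0 \<le> x $ i} \<inter> {x. x $ i < 1})" by (auto simp: unit_square_def)
  also have "\<dots> \<in> sets borel"
    by (intro sets.finite_INT sets.Int borel_closed borel_open closed_Collect_le open_Collect_less continuous_intros) auto
  finally show ?thesis .
qed

lemma emeasure_unit_square: "emeasure lborel unit_square = 1"
proof -
  have "emeasure lborel unit_square = emeasure lborel (cbox (0 :: real^2) (\<chi> i. 1))"
  proof (rule emeasure_eq_AE)
    have "frontier (cbox (0 :: real^2) (\<chi> i. 1)) \<in> null_sets lborel"
      using negligible_convex_frontier[OF convex_box(1)[of "0 :: real^2" "\<chi> i. 1"]]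
      by (simp add: negligible_iff_null_sets null_sets_completion_iff)
    moreover have "x \<in> unit_square \<longleftrightarrow> x \<in> cbox 0 (\<chi> i. 1)" if "x \<notin> frontier (cbox (0 :: real^2) (\<chi> i. 1))" for x
      using that by (auto simp: unit_square_def mem_box_cart frontier_cbox less_imp_le)
    ultimately show "AE x in lborel. x \<in> unit_square \<longleftrightarrow> x \<in> cbox (0 :: real^2) (\<chi> i. 1)"
      by (intro AE_I'[of "frontier (cbox (0 :: real^2) (\<chi> i. 1))"]) auto
  qed auto
  also have "\<dots> = 1" by (simp add: emeasure_lborel_cbox_eq Basis_vec_def inner_axis axis_eq_axis prod.UNION_disjoint)
  finally show ?thesis .
qed

lemma sets_lebesgue_torus2 [measurable_cong]: "sets lebesgue_torus2 = sets borel"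
  by (simp add: lebesgue_torus2_def)

lemma space_lebesgue_torus2 [simp]: "space lebesgue_torus2 = UNIV"
  by (simp add: lebesgue_torus2_def)

lemma emeasure_lebesgue_torus2:
  assumes "U \<in> sets borel"
  shows "emeasure lebesgue_torus2 U = emeasure lborel (torus2_proj -` U \<inter> unit_square)"
proof -
  have D: "{x. \<forall>i. 0 \<le> x $ i \<and> x $ i < 1} = unit_square" by (simp add: unit_square_def)
  have "torus2_proj \<in> measurable (restrict_space lborel unit_square) borel"
    by (intro measurable_restrict_space1) (simp add: torus2_proj_measurable)
  then show ?thesis unfolding lebesgue_torus2_def D
    using assms by (simp add: emeasure_distr emeasure_restrict_space)
qed

lemma prob_space_lebesgue_torus2: "prob_space lebesgue_torus2"
  by (rule prob_spaceI) (simp add: emeasure_lebesgue_torus2 emeasure_unit_square)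

text \<open>The translated square is cut along the lattice translates of the unit square. Each piece
  is moved back by its lattice vector, under which E is invariant, and the pieces reassemble to the
  unit square.\<close>

lemma emeasure_periodic_translate:
  assumes E: "E \<in> sets borel" and per: "\<And>x y. x - y \<in> int_lattice \<Longrightarrow> x \<in> E \<Longrightarrow> y \<in> E"
  shows "emeasure lborel ((\<lambda>v. v + t) -` E \<inter> unit_square) = emeasure lborel (E \<inter> unit_square)"
proof -
  define D where "D s = (\<lambda>v. v + s) -` unit_square" for s :: "real^2"
  have D [measurable]: "D s \<in> sets borel" for s
    unfolding D_def using measurable_sets[of "\<lambda>v. v + s" borel borel unit_square] by simp
  have vim [measurable]: "A \<in> sets borel \<Longrightarrow> (\<lambda>v. v + s) -` A \<in> sets borel" for s :: "real^2" and A
    using measurable_sets[of "\<lambda>v :: real^2. v + s" borel borel A] by simp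
  have shift: "emeasure lborel ((\<lambda>v. v + s) -` A) = emeasure lborel A" if "A \<in> sets borel" for s :: "real^2" and A
  proof -
    have "emeasure lborel A = emeasure (distr lborel borel ((+) s)) A" by (simp add: lborel_distr_plus)
    also have "(+) s = (\<lambda>v. v + s)" by (auto simp: add.commute)
    also have "emeasure (distr lborel borel (\<lambda>v. v + s)) A = emeasure lborel ((\<lambda>v. v + s) -` A)"
      using that by (simp add: emeasure_distr)
    finally show ?thesis ..
  qed
  have disj: "disjoint_family_on (\<lambda>z. B \<inter> D (s + z)) int_lattice" for B s
  proof (unfold disjoint_family_on_def, intro ballI impI)
    fix y z assume yz: "y \<in> int_lattice" "z \<in> int_lattice" "y \<noteq> z"
    have False if "v + (s + y) \<in> unit_square" "v + (s + z) \<in> unit_square" for v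
      using unit_square_unique[OF that] yz int_lattice_closed_ops(4)[OF yz(1,2)] by simp
    then show "(B \<inter> D (s + y)) \<inter> (B \<inter> D (s + z)) = {}" by (auto simp: D_def)
  qed
  have cover: "B = (\<Union>z\<in>int_lattice. B \<inter> D (s + z))" for B s
  proof -
    have "\<exists>z\<in>int_lattice. v \<in> D (s + z)" for v
    proof (intro bexI)
      show "v \<in> D (s + (vec_frac (v + s) - (v + s)))" using vec_frac_in_unit_square[of "v + s"] by (simp add: D_def algebra_simps)
      show "vec_frac (v + s) - (v + s) \<in> int_lattice"
        by (auto simp: int_lattice_def vec_frac_def frac_def)
    qed
    then show ?thesis by blast
  qed
  have "emeasure lborel ((\<lambda>v. v + t) -` E \<inter> unit_square) =
      emeasure lborel ((\<lambda>v. v + (- t)) -` ((\<lambda>v. v + t) -` E \<inter> unit_square))"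
    using E by (intro shift[symmetric]) (auto intro!: vim)
  also have "(\<lambda>v. v + (- t)) -` ((\<lambda>v. v + t) -` E \<inter> unit_square) = E \<inter> D (- t)"
    by (auto simp: D_def)
  also have "emeasure lborel (E \<inter> D (- t)) = emeasure lborel (\<Union>z\<in>int_lattice. (E \<inter> D (- t)) \<inter> D (0 + z))"
    using cover[of "E \<inter> D (- t)" 0] by simp
  also have "\<dots> = (\<integral>\<^sup>+z. emeasure lborel ((E \<inter> D (- t)) \<inter> D (0 + z)) \<partial>count_space int_lattice)"
    by (intro emeasure_UN_countable countable_int_lattice disj) (use E in \<open>auto intro!: D\<close>)
  also have "\<dots> = (\<integral>\<^sup>+z. emeasure lborel ((E \<inter> unit_square) \<inter> D (- t + (- z))) \<partial>count_space int_lattice)"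
  proof (intro nn_integral_cong)
    fix z assume "z \<in> space (count_space int_lattice)"
    then have z: "z \<in> int_lattice" by simp
    have "(\<lambda>v. v + (- z)) -` ((E \<inter> D (- t)) \<inter> D (0 + z)) = (E \<inter> unit_square) \<inter> D (- t + (- z))"
    proof -
      have "v - z \<in> E \<longleftrightarrow> v \<in> E" for v
        using per[of "v - z" v] per[of v "v - z"] z int_lattice_closed_ops(2)[OF z] by auto
      then show ?thesis by (auto simp: D_def algebra_simps)
    qed
    then show "emeasure lborel ((E \<inter> D (- t)) \<inter> D (0 + z)) = emeasure lborel ((E \<inter> unit_square) \<inter> D (- t + (- z)))"
      using shift[of "(E \<inter> D (- t)) \<inter> D (0 + z)" "- z"] E by (simp add: D)
  qed
  also have "\<dots> = (\<integral>\<^sup>+z. emeasure lborel ((E \<inter> unit_square) \<inter> D (- t + z)) \<partial>count_space int_lattice)"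
    by (intro nn_integral_bij_count_space[of uminus] bij_betwI[of _ _ _ uminus]) (auto intro: int_lattice_closed_ops)
  also have "\<dots> = emeasure lborel (\<Union>z\<in>int_lattice. (E \<inter> unit_square) \<inter> D (- t + z))"
    by (intro emeasure_UN_countable[symmetric] countable_int_lattice disj) (use E in \<open>auto intro!: D\<close>)
  also have "\<dots> = emeasure lborel (E \<inter> unit_square)"
    using cover[of "E \<inter> unit_square" "- t"] by simp
  finally show ?thesis .
qed

lemma lebesgue_torus2_translate:
  assumes "U \<in> sets borel"
  shows "emeasure lebesgue_torus2 ((\<lambda>x. x + t) -` U) = emeasure lebesgue_torus2 U"
proof -
  have U: "torus2_proj -` U \<in> sets borel" using measurable_sets[OF torus2_proj_measurable assms] by simp
  have U': "(\<lambda>x. x + t) -` U \<in> sets borel" using measurable_sets[OF torus2_translation_measurable assms, of t] by simp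
  have "torus2_proj -` ((\<lambda>x. x + t) -` U) = (\<lambda>v. v + rep_torus2 t) -` (torus2_proj -` U)"
    by (auto simp: torus2_proj_add)
  then show ?thesis unfolding emeasure_lebesgue_torus2[OF assms] emeasure_lebesgue_torus2[OF U']
    using emeasure_periodic_translate[OF U, of "rep_torus2 t"] by (auto simp flip: torus2_proj_eq_iff)
qed

lemma measure_preserving_translation: "measure_preserving lebesgue_torus2 lebesgue_torus2 (\<lambda>x. x + t)"
proof -
  have m: "(\<lambda>x. x + t) \<in> measurable lebesgue_torus2 lebesgue_torus2"
    by (simp add: measurable_cong_sets[OF sets_lebesgue_torus2 sets_lebesgue_torus2])
  have "distr lebesgue_torus2 lebesgue_torus2 (\<lambda>x. x + t) = lebesgue_torus2"
    by (intro measure_eqI) (auto simp: emeasure_distr[OF m] sets_lebesgue_torus2 lebesgue_torus2_translate)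
  with m show ?thesis by (simp add: measure_preserving_def)
qed

text \<open>Density of Z a + Z^2 in the plane, that is, of the orbit of 0 under the rotation and its
  inverse.\<close>

definition dense_rotation :: "real^2 \<Rightarrow> bool" where
  "dense_rotation a \<longleftrightarrow> (\<forall>v e. e > 0 \<longrightarrow> (\<exists>n :: int. \<exists>z\<in>int_lattice. norm (of_int n *\<^sub>R a + z - v) < e))"

text \<open>Lower semicontinuity of indicators of open sets and Fatou's lemma extend the invariance under a
  dense set of translations to all translations.\<close>

theorem rotation_uniquely_ergodic:
  assumes "prob_space \<mu>" and sets: "sets \<mu> = sets borel"
    and inv: "distr \<mu> \<mu> (\<lambda>x. x + torus2_proj a) = \<mu>" and dense: "dense_rotation a"
  shows "\<mu> = lebesgue_torus2"
proof -
  interpret prob_space \<mu> by fact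
  have sp: "space \<mu> = UNIV" using sets_eq_imp_space_eq[OF sets] by simp
  have tr [measurable]: "(\<lambda>x. x + t) \<in> measurable \<mu> \<mu>" for t
    by (simp add: measurable_cong_sets[OF sets sets])
  have vs: "(\<lambda>x. x + t) -` U \<in> sets borel" if "U \<in> sets borel" for U and t :: torus2
    using measurable_sets[OF torus2_translation_measurable that, of t] by simp
  have inv1: "emeasure \<mu> ((\<lambda>x. x + torus2_proj a) -` U) = emeasure \<mu> U" if "U \<in> sets borel" for U
    using arg_cong[OF inv, of "\<lambda>M. emeasure M U"] that by (simp add: emeasure_distr sets sp)
  have invn: "emeasure \<mu> ((\<lambda>x. x + torus2_proj (of_nat n *\<^sub>R a)) -` U) = emeasure \<mu> U" if "U \<in> sets borel" for U n
    using that
  proof (induction n arbitrary: U)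
    case (Suc n)
    have "(\<lambda>x. x + torus2_proj (of_nat (Suc n) *\<^sub>R a)) -` U =
        (\<lambda>x. x + torus2_proj (of_nat n *\<^sub>R a)) -` ((\<lambda>x. x + torus2_proj a) -` U)"
      by (auto simp: torus2_proj_add algebra_simps)
    then show ?case using Suc.IH[OF vs[OF Suc.prems]] inv1[OF Suc.prems] by simp
  qed (simp add: torus2_proj_zero)
  have invi: "emeasure \<mu> ((\<lambda>x. x + torus2_proj (of_int n *\<^sub>R a)) -` U) = emeasure \<mu> U" if U: "U \<in> sets borel" for U n
  proof (cases "n \<ge> 0")
    case True
    then show ?thesis using invn[OF U, of "nat n"] by simp
  next
    case False
    have "(\<lambda>x. x + torus2_proj (of_nat (nat (- n)) *\<^sub>R a)) -` ((\<lambda>x. x + torus2_proj (of_int n *\<^sub>R a)) -` U) = U"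
    proof -
      have "torus2_proj (of_nat (nat (- n)) *\<^sub>R a) + torus2_proj (of_int n *\<^sub>R a) = 0"
        using False by (simp flip: torus2_proj_add add: torus2_proj_zero)
      then show ?thesis by (auto simp: add.assoc)
    qed
    then show ?thesis using invn[OF vs[OF U, of "torus2_proj (of_int n *\<^sub>R a)"], of "nat (- n)"] by simp
  qed
  have le: "emeasure \<mu> ((\<lambda>x. x + torus2_proj v) -` U) \<le> emeasure \<mu> U" if U: "open U" for U v
  proof -
    have "\<exists>n z. z \<in> int_lattice \<and> norm (of_int n *\<^sub>R a + z - v) < 1 / real (Suc j)" for j
      using dense[unfolded dense_rotation_def, rule_format, of "1 / real (Suc j)" v] by auto
    then obtain n z where nz: "\<And>j. z j \<in> int_lattice" "\<And>j. norm (of_int (n j) *\<^sub>R a + z j - v) < 1 / real (Suc j)"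
      by metis
    define w where "w j = of_int (n j) *\<^sub>R a + z j" for j
    note w = nz(1) w_def nz(2)[folded w_def]
    have "(\<lambda>j. norm (w j - v)) \<longlonglongrightarrow> 0"
      using w(3) by (intro tendsto_sandwich[OF _ _ tendsto_const LIMSEQ_inverse_real_of_nat])
        (auto simp: inverse_eq_divide less_imp_le)
    then have lim: "w \<longlonglongrightarrow> v" by (simp add: tendsto_norm_zero_iff LIM_zero_iff)
    have proj_w: "torus2_proj (w j) = torus2_proj (of_int (n j) *\<^sub>R a)" for j
      using w(1)[of j] by (simp add: w(2) torus2_proj_eq_iff)
    let ?A = "\<lambda>v. (\<lambda>x. x + torus2_proj v) -` U"
    have A: "?A v \<in> sets \<mu>" for v using vs[OF borel_open[OF U]] by (simp add: sets)
    have ind: "indicator (?A v) x \<le> liminf (\<lambda>j. indicator (?A (w j)) x :: ennreal)" for x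
    proof (cases "x \<in> ?A v")
      case True
      have o: "open (torus2_proj -` U)" using U by (simp add: open_torus2_iff)
      have m: "rep_torus2 x + v \<in> torus2_proj -` U" using True by (simp add: torus2_proj_add)
      have l: "(\<lambda>j. rep_torus2 x + w j) \<longlonglongrightarrow> rep_torus2 x + v" using lim by (intro tendsto_intros)
      from topological_tendstoD[OF l o m] have "\<forall>\<^sub>F j in sequentially. (1::ennreal) \<le> indicator (?A (w j)) x"
        by eventually_elim (simp add: torus2_proj_add)
      then show ?thesis using True by (auto intro!: Liminf_bounded)
    qed simp
    have "emeasure \<mu> (?A v) = (\<integral>\<^sup>+x. indicator (?A v) x \<partial>\<mu>)" using A by simp
    also have "\<dots> \<le> (\<integral>\<^sup>+x. liminf (\<lambda>j. indicator (?A (w j)) x) \<partial>\<mu>)" by (intro nn_integral_mono ind)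
    also have "\<dots> \<le> liminf (\<lambda>j. \<integral>\<^sup>+x. indicator (?A (w j)) x \<partial>\<mu>)"
      using A by (intro nn_integral_liminf) auto
    also have "(\<lambda>j. \<integral>\<^sup>+x. indicator (?A (w j)) x \<partial>\<mu>) = (\<lambda>j. emeasure \<mu> U)"
      using A invi[OF borel_open[OF U]] by (simp add: proj_w)
    finally show ?thesis by (simp add: Liminf_const)
  qed
  have eq: "emeasure \<mu> ((\<lambda>x. x + torus2_proj v) -` U) = emeasure \<mu> U" if U: "open U" for U v
  proof (rule antisym[OF le[OF U]])
    have o: "open ((\<lambda>x. x + torus2_proj v) -` U)"
      using U torus2_translation_continuous[of UNIV] by (intro open_vimage) auto
    have "(\<lambda>x. x + torus2_proj (- v)) -` ((\<lambda>x. x + torus2_proj v) -` U) = U"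
      by (auto simp: torus2_proj_uminus)
    then show "emeasure \<mu> U \<le> emeasure \<mu> ((\<lambda>x. x + torus2_proj v) -` U)" using le[OF o, of "- v"] by simp
  qed
  \<comment> \<open>Invariance under all translations is averaged over v in the unit square. After
    exchanging the integrals, the inner one is the Lebesgue measure of a translate of U, whatever x
    is.\<close>
  have main: "emeasure \<mu> U = emeasure lebesgue_torus2 U" if U: "open U" for U
  proof -
    define N where "N = restrict_space lborel unit_square"
    have Nsp: "space N = unit_square" by (simp add: N_def space_restrict_space)
    have "emeasure N (space N) = 1"
      unfolding Nsp by (simp add: N_def emeasure_restrict_space emeasure_unit_square)
    then interpret N: prob_space N by (rule prob_spaceI)
    interpret pair_sigma_finite \<mu> N ..
    \<comment> \<open>Adding on representatives in the plane reduces joint measurability to that of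
      vector addition.\<close>
    let ?f = "\<lambda>x v. indicator U (torus2_proj (torus_frac x + v)) :: ennreal"
    have tf [measurable]: "torus_frac \<in> borel_measurable \<mu>"
      using torus_frac_measurable by (simp add: measurable_cong_sets[OF sets refl])
    have idN [measurable]: "(\<lambda>v. v) \<in> borel_measurable N"
      unfolding N_def by (intro measurable_restrict_space1) auto
    have [measurable]: "U \<in> sets borel" using U by simp
    note torus2_proj_measurable [measurable]
    have "(\<lambda>p. torus_frac (fst p) + snd p) \<in> borel_measurable (\<mu> \<Otimes>\<^sub>M N)" by measurable
    then have meas: "case_prod ?f \<in> borel_measurable (\<mu> \<Otimes>\<^sub>M N)" by (simp add: split_beta') measurable
    have "emeasure \<mu> U = (\<integral>\<^sup>+v. emeasure \<mu> U \<partial>N)" by (simp add: N.emeasure_space_1)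
    also have "\<dots> = (\<integral>\<^sup>+v. (\<integral>\<^sup>+x. ?f x v \<partial>\<mu>) \<partial>N)"
    proof (intro nn_integral_cong)
      fix v
      have "?f x v = indicator ((\<lambda>x. x + torus2_proj v) -` U) x" for x
        by (simp add: torus2_proj_add indicator_def)
      then show "emeasure \<mu> U = (\<integral>\<^sup>+x. ?f x v \<partial>\<mu>)" using eq[OF U, of v] vs[OF borel_open[OF U]] by (simp add: sets)
    qed
    also have "\<dots> = (\<integral>\<^sup>+x. (\<integral>\<^sup>+v. ?f x v \<partial>N) \<partial>\<mu>)" by (rule Fubini'[OF meas])
    also have "\<dots> = (\<integral>\<^sup>+x. emeasure lebesgue_torus2 U \<partial>\<mu>)"
    proof (intro nn_integral_cong)
      fix x
      let ?B = "torus2_proj -` ((\<lambda>y. y + x) -` U)"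
      have B: "?B \<in> sets borel" using measurable_sets[OF torus2_proj_measurable vs[OF borel_open[OF U], of x]] by simp
      have "(\<integral>\<^sup>+v. ?f x v \<partial>N) = (\<integral>\<^sup>+v. indicator ?B v \<partial>N)"
        by (intro nn_integral_cong) (simp add: torus2_proj_add indicator_def add.commute)
      also have "\<dots> = (\<integral>\<^sup>+v. indicator (?B \<inter> unit_square) v \<partial>lborel)"
        unfolding N_def indicator_inter_arith using B by (subst nn_integral_restrict_space) auto
      also have "\<dots> = emeasure lebesgue_torus2 ((\<lambda>y. y + x) -` U)"
        using B by (simp add: emeasure_lebesgue_torus2 vs borel_open[OF U])
      finally show "(\<integral>\<^sup>+v. ?f x v \<partial>N) = emeasure lebesgue_torus2 U"
        using lebesgue_torus2_translate[of U x] by simp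
    qed
    also have "\<dots> = emeasure lebesgue_torus2 U" by (simp add: emeasure_space_1)
    finally show ?thesis .
  qed
  show ?thesis
  proof (rule measure_eqI_generator_eq[where E = "{U. open U}" and \<Omega> = UNIV and A = "\<lambda>_. UNIV"])
    show "Int_stable {U :: torus2 set. open U}" by (auto simp: Int_stable_def)
    show "sets \<mu> = sigma_sets UNIV {U. open U}" "sets lebesgue_torus2 = sigma_sets UNIV {U. open U}"
      by (simp_all add: sets sets_lebesgue_torus2 borel_def)
    show "emeasure \<mu> UNIV \<noteq> \<infinity>" using emeasure_space_1 by (simp add: sp)
  qed (use main in auto)
qed

section \<open>Conjugacy with a rotation from almost everywhere injectivity\<close>

lemma word_shift_continuous: "continuous_on A (word_shift :: (nat \<Rightarrow> 'a::topological_space) \<Rightarrow> _)"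
  unfolding word_shift_def
  by (intro continuous_on_coordinatewise_then_product continuous_on_subset[OF continuous_on_product_coordinates]) auto

text \<open>An abstract almost one-to-one extension of a rotation: \<open>f\<close> lifts the factor
  map to the plane, and the last assumption says that the points of the plane whose torus class has
  several preimages form a null set.\<close>

locale torus_factor =
  fixes X :: "(nat \<Rightarrow> 'a::discrete_topology) set" and f :: "(nat \<Rightarrow> 'a) \<Rightarrow> real^2" and a :: "real^2"
  assumes compact_X: "compact X" and X_nonempty: "X \<noteq> {}" and shift_X: "word_shift ` X = X"
    and f_continuous: "continuous_on X f"
    and f_shift: "x \<in> X \<Longrightarrow> f (word_shift x) - (f x + a) \<in> int_lattice"
    and dense: "dense_rotation a"
    and negligible_fibres:
      "negligible {v. \<exists>x\<in>X. \<exists>y\<in>X. x \<noteq> y \<and> f x - v \<in> int_lattice \<and> f y - v \<in> int_lattice}"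
begin

definition proj :: "(nat \<Rightarrow> 'a) \<Rightarrow> torus2" where
  "proj x = torus2_proj (f x)"

definition rot :: "torus2 \<Rightarrow> torus2" where
  "rot t = t + torus2_proj a"

definition bad :: "torus2 set" where
  "bad = {t. \<exists>x\<in>X. \<exists>y\<in>X. x \<noteq> y \<and> proj x = t \<and> proj y = t}"

definition good_pts :: "(nat \<Rightarrow> 'a) set" where
  "good_pts = {x \<in> X. proj x \<notin> bad}"

text \<open>On \<open>bad\<close> the value is one constant point of X, which keeps the section
  total and measurable.\<close>

definition sect :: "torus2 \<Rightarrow> (nat \<Rightarrow> 'a)" where
  "sect t = (if t \<in> bad then (SOME x. x \<in> X) else (SOME x. x \<in> X \<and> proj x = t))"

lemma proj_shift: "x \<in> X \<Longrightarrow> proj (word_shift x) = rot (proj x)"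
  using f_shift by (simp add: proj_def rot_def torus2_proj_eq_iff flip: torus2_proj_add)

lemma closed_proj_image:
  assumes "compact K" "K \<subseteq> X"
  shows "closed (proj ` K)"
proof -
  have "compact (f ` K)" using assms by (intro compact_continuous_image continuous_on_subset[OF f_continuous])
  then have "closed (torus2_proj ` (f ` K))" by (rule closed_torus2_proj_image)
  then show ?thesis by (simp add: image_image proj_def)
qed

text \<open>The set of points of the plane lying over the image is closed and invariant under the
  lattice and under both a and -a, the latter because the shift is onto X. Density of the rotation
  makes it everything.\<close>

lemma proj_surj: "\<exists>x\<in>X. proj x = t"
proof -
  define P where "P = torus2_proj -` (proj ` X)"
  have closed: "closed P" using closed_proj_image[OF compact_X] by (simp add: P_def closed_torus2_iff)
  have lat: "v + z \<in> P" if "v \<in> P" "z \<in> int_lattice" for v z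
  proof -
    have "torus2_proj (v + z) = torus2_proj v" using that by (simp add: torus2_proj_eq_iff)
    then show ?thesis using that by (simp add: P_def)
  qed
  have plus: "v + a \<in> P" if v: "v \<in> P" for v
  proof -
    obtain x where x: "x \<in> X" "torus2_proj v = proj x" using v by (auto simp: P_def)
    then have "torus2_proj (v + a) = proj (word_shift x)" by (simp add: proj_shift rot_def torus2_proj_add)
    moreover have "word_shift x \<in> X" using x shift_X by blast
    ultimately show ?thesis by (auto simp: P_def)
  qed
  have minus: "v - a \<in> P" if v: "v \<in> P" for v
  proof -
    obtain x where x: "x \<in> X" "torus2_proj v = proj x" using v by (auto simp: P_def)
    then obtain y where y: "y \<in> X" "x = word_shift y" using shift_X by blast
    have "torus2_proj (v - a) + torus2_proj a = proj y + torus2_proj a"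
      using x y proj_shift[OF y(1)] by (simp add: rot_def flip: torus2_proj_add)
    then show ?thesis using y by (simp add: P_def)
  qed
  have nat: "v + of_nat n *\<^sub>R a \<in> P \<and> v - of_nat n *\<^sub>R a \<in> P" if "v \<in> P" for v n
  proof (induction n)
    case (Suc n)
    then show ?case using plus[of "v + of_nat n *\<^sub>R a"] minus[of "v - of_nat n *\<^sub>R a"]
      by (simp add: algebra_simps)
  qed (use that in simp)
  have int: "v + of_int n *\<^sub>R a \<in> P" if "v \<in> P" for v n
    using nat[OF that, of "nat \<bar>n\<bar>"] by (cases "n \<ge> 0") auto
  obtain x0 where x0: "x0 \<in> X" using X_nonempty by blast
  have v0: "f x0 \<in> P" using x0 by (auto simp: P_def proj_def)
  have "v \<in> closure P" for v
    unfolding closure_approachable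
  proof (intro allI impI)
    fix e :: real assume "e > 0"
    then obtain n z where z: "z \<in> int_lattice" "norm (of_int n *\<^sub>R a + z - (v - f x0)) < e"
      using dense unfolding dense_rotation_def by blast
    have "f x0 + of_int n *\<^sub>R a + z \<in> P" by (intro lat int v0 z)
    moreover have "dist (f x0 + of_int n *\<^sub>R a + z) v < e" using z(2) by (simp add: dist_norm algebra_simps)
    ultimately show "\<exists>y\<in>P. dist y v < e" by blast
  qed
  then have "rep_torus2 t \<in> P" using closed by (simp add: closure_closed)
  then show ?thesis by (auto simp: P_def)
qed

text \<open>Two points of a fibre differ at some coordinate n. For fixed n such pairs form a compact
  set, so \<open>bad\<close> is a countable union of closed sets.\<close>

lemma bad_borel: "bad \<in> sets borel"
proof -
  define K where "K n = {p \<in> X \<times> X. fst p n \<noteq> snd p n \<and> f (fst p) - f (snd p) \<in> int_lattice}" for n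
  have compact_K: "compact (fst ` K n)" for n
  proof -
    have "closed {p :: (nat \<Rightarrow> 'a) \<times> (nat \<Rightarrow> 'a). fst p n \<noteq> snd p n}"
    proof -
      have c: "continuous_on UNIV (\<lambda>p :: (nat \<Rightarrow> 'a) \<times> (nat \<Rightarrow> 'a). (fst p n, snd p n))"
        by (intro continuous_on_Pair
            continuous_on_compose2[OF continuous_on_product_coordinates continuous_on_fst[OF continuous_on_id]]
            continuous_on_compose2[OF continuous_on_product_coordinates continuous_on_snd[OF continuous_on_id]]) auto
      have "open (UNIV :: 'a set)" by simp
      \<comment> \<open>The diagonal of a discrete space is open, so differing at n is a closed
        condition.\<close>
      have "open {q :: 'a \<times> 'a. fst q = snd q}"
      proof -
        have "{q :: 'a \<times> 'a. fst q = snd q} = (\<Union>x. {x} \<times> {x})" by auto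
        also have "open \<dots>" by (intro open_UN ballI open_Times Topological_Spaces.open_discrete)
        finally show ?thesis .
      qed
      then have "closed (- {q :: 'a \<times> 'a. fst q = snd q})" by auto
      from closed_vimage[OF this c] show ?thesis by (simp add: vimage_def)
    qed
    moreover have "compact {p \<in> X \<times> X. f (fst p) - f (snd p) \<in> int_lattice}"
    proof -
      have "continuous_on (X \<times> X) (\<lambda>p. f (fst p) - f (snd p))"
        by (intro continuous_intros continuous_on_compose2[OF f_continuous]) auto
      from continuous_closedin_preimage[OF this closed_int_lattice]
      have "closedin (top_of_set (X \<times> X)) (X \<times> X \<inter> (\<lambda>p. f (fst p) - f (snd p)) -` int_lattice)" .
      then have "compact (X \<times> X \<inter> (\<lambda>p. f (fst p) - f (snd p)) -` int_lattice)"
        by (rule closedin_compact[OF compact_Times[OF compact_X compact_X]])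
      moreover have "X \<times> X \<inter> (\<lambda>p. f (fst p) - f (snd p)) -` int_lattice = {p \<in> X \<times> X. f (fst p) - f (snd p) \<in> int_lattice}"
        by auto
      ultimately show ?thesis by simp
    qed
    ultimately have "compact ({p \<in> X \<times> X. f (fst p) - f (snd p) \<in> int_lattice} \<inter> {p. fst p n \<noteq> snd p n})"
      by (intro compact_Int_closed)
    also have "\<dots> = K n" by (auto simp: K_def)
    finally show ?thesis by (intro compact_continuous_image continuous_intros)
  qed
  have "bad = (\<Union>n. proj ` (fst ` K n))"
  proof (intro set_eqI iffI)
    fix t assume "t \<in> bad"
    then obtain x y where xy: "x \<in> X" "y \<in> X" "x \<noteq> y" "proj x = t" "proj y = t" by (auto simp: bad_def)
    then obtain n where "x n \<noteq> y n" by (auto simp: fun_eq_iff)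
    then have "(x, y) \<in> K n" using xy by (simp add: K_def proj_def flip: torus2_proj_eq_iff)
    then show "t \<in> (\<Union>n. proj ` (fst ` K n))" using xy by force
  next
    fix t assume "t \<in> (\<Union>n. proj ` (fst ` K n))"
    then obtain n x y where "(x, y) \<in> K n" "t = proj x" by auto
    then show "t \<in> bad" unfolding bad_def K_def
      by (intro CollectI bexI[of _ x] bexI[of _ y]) (auto simp: proj_def simp flip: torus2_proj_eq_iff)
  qed
  also have "\<dots> \<in> sets borel"
    by (intro sets.countable_UN image_subsetI borel_closed closed_proj_image compact_K) (auto simp: K_def)
  finally show ?thesis .
qed

lemma bad_null: "emeasure lebesgue_torus2 bad = 0"
proof -
  have sub: "torus2_proj -` bad \<subseteq> {v. \<exists>x\<in>X. \<exists>y\<in>X. x \<noteq> y \<and> f x - v \<in> int_lattice \<and> f y - v \<in> int_lattice}"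
    by (auto simp: bad_def proj_def torus2_proj_eq_iff)
  have b: "torus2_proj -` bad \<in> sets borel" using measurable_sets[OF torus2_proj_measurable bad_borel] by simp
  have "negligible (torus2_proj -` bad)" by (rule negligible_subset[OF negligible_fibres sub])
  then have "torus2_proj -` bad \<in> null_sets lborel"
    using b by (simp add: negligible_iff_null_sets null_sets_completion_iff)
  then have "torus2_proj -` bad \<inter> unit_square \<in> null_sets lborel" by (rule null_set_Int2) simp
  then show ?thesis by (simp add: emeasure_lebesgue_torus2 bad_borel null_setsD1)
qed

lemma sect_good:
  assumes "t \<notin> bad"
  shows "sect t \<in> X" "proj (sect t) = t" "\<And>x. x \<in> X \<Longrightarrow> proj x = t \<Longrightarrow> sect t = x"
proof -
  have "sect t \<in> X \<and> proj (sect t) = t"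
    using assms someI_ex[of "\<lambda>x. x \<in> X \<and> proj x = t"] proj_surj[of t] by (auto simp: sect_def)
  then show "sect t \<in> X" "proj (sect t) = t" "\<And>x. x \<in> X \<Longrightarrow> proj x = t \<Longrightarrow> sect t = x"
    using assms by (auto simp: bad_def)
qed

lemma sect_in_X: "sect t \<in> X"
  using sect_good(1) X_nonempty by (cases "t \<in> bad") (auto simp: sect_def some_in_eq)

abbreviation MX :: "(nat \<Rightarrow> 'a) measure" where
  "MX \<equiv> restrict_space borel X"

lemma space_MX: "space MX = X" by (simp add: space_restrict_space)

lemma proj_measurable: "proj \<in> measurable MX borel"
proof -
  have "continuous_on X proj" unfolding proj_def
    using continuous_on_compose2[OF continuous_on_torus2_proj f_continuous, of UNIV] by auto
  then show ?thesis by (rule borel_measurable_continuous_on_restrict)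
qed

lemma rot_measurable: "rot \<in> measurable borel borel"
  unfolding rot_def by simp

lemma shift_measurable: "word_shift \<in> measurable MX MX"
proof (rule measurable_restrict_space2)
  show "word_shift \<in> space MX \<rightarrow> X" using shift_X by (auto simp: space_MX)
  show "word_shift \<in> borel_measurable MX"
    by (intro borel_measurable_continuous_on_restrict word_shift_continuous)
qed

lemma sect_measurable: "sect \<in> measurable borel MX"
proof (rule measurable_restrict_space2)
  show "sect \<in> space borel \<rightarrow> X" by (simp add: sect_in_X)
  show "sect \<in> borel_measurable borel"
  proof (rule borel_measurableI)
    fix S :: "(nat \<Rightarrow> 'a) set" assume "open S"
    then have "compact (X \<inter> - S)" using compact_X by (intro compact_Int_closed) auto
    then have c: "closed (proj ` (X \<inter> - S))" by (rule closed_proj_image) simp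
    \<comment> \<open>Outside \<open>bad\<close> the section inverts \<open>proj\<close>, so the
      preimage of a closed set is the closed image of a compact set; on \<open>bad\<close> the
      constant value decides.\<close>
    have e: "sect -` (- S) = (proj ` (X \<inter> - S) - bad) \<union> (if (SOME x. x \<in> X) \<in> S then {} else bad)"
    proof (intro set_eqI)
      fix t
      show "t \<in> sect -` (- S) \<longleftrightarrow> t \<in> (proj ` (X \<inter> - S) - bad) \<union> (if (SOME x. x \<in> X) \<in> S then {} else bad)"
      proof (cases "t \<in> bad")
        case True
        then show ?thesis by (auto simp: sect_def)
      next
        case False
        have "sect t \<notin> S \<longleftrightarrow> t \<in> proj ` (X \<inter> - S)"
        proof
          assume "sect t \<notin> S"
          then show "t \<in> proj ` (X \<inter> - S)" using sect_good(1,2)[OF False] by (intro image_eqI[of _ _ "sect t"]) auto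
        next
          assume "t \<in> proj ` (X \<inter> - S)"
          then obtain x where "x \<in> X" "x \<notin> S" "proj x = t" by auto
          then show "sect t \<notin> S" using sect_good(3)[OF False] by simp
        qed
        then show ?thesis using False by simp
      qed
    qed
    have "sect -` (- S) \<in> sets borel" unfolding e using borel_closed[OF c] bad_borel by auto
    then have "- (sect -` (- S)) \<in> sets borel" by (rule borel_comp)
    moreover have "- (sect -` (- S)) = sect -` S \<inter> space borel" by auto
    ultimately show "sect -` S \<inter> space borel \<in> sets borel" by simp
  qed
qed

section \<open>The unique invariant measure and the conjugacy\<close>

definition mu :: "(nat \<Rightarrow> 'a) measure" where
  "mu = distr lebesgue_torus2 MX sect"

lemma sect_measurable': "sect \<in> measurable lebesgue_torus2 MX"
  using sect_measurable by (simp add: measurable_cong_sets[OF sets_lebesgue_torus2 refl])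

lemma sets_mu: "sets mu = sets MX" by (simp add: mu_def)

lemma space_mu: "space mu = X" by (simp add: mu_def space_MX)

lemma prob_space_mu: "prob_space mu"
  unfolding mu_def by (rule prob_space.prob_space_distr[OF prob_space_lebesgue_torus2 sect_measurable'])

lemma AE_good: "AE t in lebesgue_torus2. t \<notin> bad"
  by (rule AE_I[of _ _ bad]) (auto simp: bad_null bad_borel sets_lebesgue_torus2)

text \<open>The shift is onto X, so two points over \<open>rot t\<close> would have two distinct
  preimages over t. Hence the complement of \<open>bad\<close> is forward invariant.\<close>

lemma rot_good: "t \<notin> bad \<Longrightarrow> rot t \<notin> bad"
proof
  assume t: "t \<notin> bad" and "rot t \<in> bad"
  then obtain x y where xy: "x \<in> X" "y \<in> X" "x \<noteq> y" "proj x = rot t" "proj y = rot t" by (auto simp: bad_def)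
  then have "x \<in> word_shift ` X" "y \<in> word_shift ` X" by (simp_all add: shift_X)
  then obtain x' y' where xy': "x' \<in> X" "y' \<in> X" "x = word_shift x'" "y = word_shift y'" by (elim imageE)
  then have "proj x' = t" "proj y' = t" using xy proj_shift by (auto simp: rot_def)
  then show False using t xy xy' by (auto simp: bad_def)
qed

lemma sect_rot: "t \<notin> bad \<Longrightarrow> sect (rot t) = word_shift (sect t)"
  using sect_good(3)[OF rot_good, of t "word_shift (sect t)"] sect_good(1,2)[of t] shift_X proj_shift by auto

lemma distr_rot: "distr lebesgue_torus2 lebesgue_torus2 rot = lebesgue_torus2"
  using measure_preserving_translation unfolding rot_def measure_preserving_def by blast

lemma mu_invariant: "measure_preserving mu mu word_shift"
proof -
  have m: "word_shift \<in> measurable mu mu"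
    using shift_measurable by (simp add: measurable_cong_sets[OF sets_mu sets_mu])
  have rm: "rot \<in> measurable lebesgue_torus2 lebesgue_torus2"
    using rot_measurable by (simp add: measurable_cong_sets[OF sets_lebesgue_torus2 sets_lebesgue_torus2])
  have "distr mu mu word_shift = distr mu MX word_shift" by (rule distr_cong) (auto simp: sets_mu)
  also have "\<dots> = distr lebesgue_torus2 MX (word_shift \<circ> sect)"
    unfolding mu_def by (rule distr_distr[OF shift_measurable sect_measurable'])
  also have "\<dots> = distr lebesgue_torus2 MX (sect \<circ> rot)"
  proof (rule distr_cong_AE)
    show "AE t in lebesgue_torus2. (word_shift \<circ> sect) t = (sect \<circ> rot) t"
      using AE_good by eventually_elim (simp add: sect_rot)
  qed (use sect_measurable' shift_measurable rm in auto)
  also have "\<dots> = distr (distr lebesgue_torus2 lebesgue_torus2 rot) MX sect"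
    by (rule distr_distr[symmetric, OF sect_measurable' rm])
  also have "\<dots> = mu" by (simp add: distr_rot mu_def)
  finally show ?thesis using m by (simp add: measure_preserving_def)
qed

text \<open>The image of any shift-invariant measure is invariant under the rotation, hence Lebesgue
  measure by unique ergodicity.\<close>

lemma proj_distr:
  assumes "sets \<nu> = sets MX" "prob_space \<nu>" "measure_preserving \<nu> \<nu> word_shift"
  shows "distr \<nu> borel proj = lebesgue_torus2"
proof -
  have sp: "space \<nu> = X" using sets_eq_imp_space_eq[OF assms(1)] by (simp add: space_MX)
  have pm: "proj \<in> measurable \<nu> borel" using proj_measurable by (simp add: measurable_cong_sets[OF assms(1) refl])
  have sm: "word_shift \<in> measurable \<nu> \<nu>" "distr \<nu> \<nu> word_shift = \<nu>" using assms(3) by (auto simp: measure_preserving_def)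
  let ?m = "distr \<nu> borel proj"
  show ?thesis
  proof (rule rotation_uniquely_ergodic[where a = a])
    show "prob_space ?m" by (rule prob_space.prob_space_distr[OF assms(2) pm])
    have "distr ?m ?m (\<lambda>x. x + torus2_proj a) = distr ?m borel rot"
      by (rule distr_cong) (auto simp: rot_def)
    also have "\<dots> = distr \<nu> borel (rot \<circ> proj)" by (rule distr_distr[OF rot_measurable pm])
    also have "\<dots> = distr \<nu> borel (proj \<circ> word_shift)"
      by (rule distr_cong) (auto simp: sp proj_shift)
    also have "\<dots> = distr (distr \<nu> \<nu> word_shift) borel proj" by (rule distr_distr[symmetric, OF pm sm(1)])
    finally show "distr ?m ?m (\<lambda>x. x + torus2_proj a) = ?m" by (simp add: sm(2))
  qed (auto simp: dense)
qed

text \<open>As the image measure is Lebesgue, almost every point lies over a good t, where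
  \<open>sect\<close> recovers it from its projection. So the measure is the image of Lebesgue
  measure under \<open>sect\<close>.\<close>

lemma mu_unique:
  assumes "sets \<nu> = sets MX" "prob_space \<nu>" "measure_preserving \<nu> \<nu> word_shift"
  shows "\<nu> = mu"
proof -
  have sp: "space \<nu> = X" using sets_eq_imp_space_eq[OF assms(1)] by (simp add: space_MX)
  have pm: "proj \<in> measurable \<nu> borel" using proj_measurable by (simp add: measurable_cong_sets[OF assms(1) refl])
  note d = proj_distr[OF assms]
  have "AE t in distr \<nu> borel proj. t \<notin> bad" unfolding d by (rule AE_good)
  then have ae: "AE x in \<nu>. proj x \<notin> bad" by (rule AE_distrD[OF pm])
  have "\<nu> = distr \<nu> MX (\<lambda>x. x)" by (rule distr_id2[symmetric]) (simp add: assms(1))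
  also have "\<dots> = distr \<nu> MX (sect \<circ> proj)"
  proof (rule distr_cong_AE)
    show "AE x in \<nu>. x = (sect \<circ> proj) x"
    proof -
      have "AE x in \<nu>. x \<in> X" using AE_space[of \<nu>] by (simp add: sp)
      with ae show ?thesis by eventually_elim (simp add: sect_good(3))
    qed
    show "(\<lambda>x. x) \<in> measurable \<nu> MX" by (simp add: measurable_cong_sets[OF assms(1) refl])
    show "sect \<circ> proj \<in> measurable \<nu> MX" by (rule measurable_comp[OF pm sect_measurable])
  qed auto
  also have "\<dots> = distr (distr \<nu> borel proj) MX sect" by (rule distr_distr[symmetric, OF sect_measurable pm])
  also have "\<dots> = mu" by (simp add: d mu_def)
  finally show ?thesis .
qed

lemma invariant_measure_eq: "invariant_measure X = mu"
  unfolding invariant_measure_def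
proof (rule the_equality)
  show "sets mu = sets MX \<and> prob_space mu \<and> measure_preserving mu mu word_shift"
    by (intro conjI sets_mu prob_space_mu mu_invariant)
qed (elim conjE, rule mu_unique)

theorem conjugate_rotation:
  "measurably_conjugate (invariant_measure X) word_shift lebesgue_torus2 (\<lambda>x. x + torus2_proj a)"
proof -
  have pm: "proj \<in> measurable mu lebesgue_torus2"
    using proj_measurable by (simp add: measurable_cong_sets[OF sets_mu sets_lebesgue_torus2])
  have good_eq: "good_pts = proj -` (- bad) \<inter> space mu" by (auto simp: good_pts_def space_mu)
  have "- bad \<in> sets lebesgue_torus2" using bad_borel by (auto simp: sets_lebesgue_torus2)
  then have good_sets: "good_pts \<in> sets mu" unfolding good_eq by (rule measurable_sets[OF pm])
  have pd: "distr mu lebesgue_torus2 proj = lebesgue_torus2"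
  proof -
    have "distr mu lebesgue_torus2 proj = distr mu borel proj" by (rule distr_cong) (auto simp: sets_lebesgue_torus2)
    then show ?thesis using proj_distr[OF sets_mu prob_space_mu mu_invariant] by simp
  qed
  have good_null: "space mu - good_pts \<in> null_sets mu"
  proof (rule null_setsI)
    show "space mu - good_pts \<in> sets mu" using good_sets by auto
    have "space mu - good_pts = proj -` bad \<inter> space mu" by (auto simp: good_pts_def space_mu)
    then have "emeasure mu (space mu - good_pts) = emeasure (distr mu lebesgue_torus2 proj) bad"
      using bad_borel by (simp add: emeasure_distr[OF pm] sets_lebesgue_torus2)
    then show "emeasure mu (space mu - good_pts) = 0" by (simp add: pd bad_null)
  qed
  have bij: "bij_betw proj good_pts (- bad)"
  proof (rule bij_betwI[of _ _ _ sect])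
    show "proj \<in> good_pts \<rightarrow> - bad" by (simp add: good_pts_def)
    show "sect \<in> - bad \<rightarrow> good_pts" using sect_good(1,2) by (simp add: good_pts_def)
    show "sect (proj x) = x" if "x \<in> good_pts" for x using that sect_good(3)[of "proj x" x] by (simp add: good_pts_def)
    show "proj (sect t) = t" if "t \<in> - bad" for t using that sect_good(2) by simp
  qed
  have sect_in: "sect t \<in> good_pts" "proj (sect t) = t" if "t \<notin> bad" for t
    using sect_good(1,2)[OF that] that by (simp_all add: good_pts_def)
  \<comment> \<open>Identifying the inverse with \<open>sect\<close> transfers the measurability of
    the section to it.\<close>
  have inv_eq: "inv_into good_pts proj t = sect t" if "t \<notin> bad" for t
    using inv_into_f_f[OF bij_betw_imp_inj_on[OF bij] sect_in(1)[OF that]] sect_in(2)[OF that] by simp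
  have pres: "measure_preserving (restrict_space mu good_pts) (restrict_space lebesgue_torus2 (- bad)) proj"
  proof -
    have m: "proj \<in> measurable (restrict_space mu good_pts) (restrict_space lebesgue_torus2 (- bad))"
      by (intro measurable_restrict_space3 pm) (auto simp: good_pts_def)
    have "distr (restrict_space mu good_pts) (restrict_space lebesgue_torus2 (- bad)) proj = restrict_space lebesgue_torus2 (- bad)"
    proof (rule measure_eqI)
      fix B assume "B \<in> sets (distr (restrict_space mu good_pts) (restrict_space lebesgue_torus2 (- bad)) proj)"
      then have B: "B \<in> sets (restrict_space lebesgue_torus2 (- bad))" by simp
      have nb: "- bad \<in> sets lebesgue_torus2" by fact
      have B': "B \<subseteq> - bad" "B \<in> sets lebesgue_torus2" using B nb by (auto simp: sets_restrict_space_iff)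
      have "emeasure (distr (restrict_space mu good_pts) (restrict_space lebesgue_torus2 (- bad)) proj) B
        = emeasure (restrict_space mu good_pts) (proj -` B \<inter> space (restrict_space mu good_pts))"
        using m B by (rule emeasure_distr)
      also have "proj -` B \<inter> space (restrict_space mu good_pts) = proj -` B \<inter> space mu"
        using B' by (auto simp: space_restrict_space good_pts_def space_mu)
      also have "emeasure (restrict_space mu good_pts) (proj -` B \<inter> space mu) = emeasure mu (proj -` B \<inter> space mu)"
        by (rule emeasure_restrict_space)
          (rule sets.Int[OF good_sets sets.top], use B' in \<open>auto simp: good_pts_def space_mu\<close>)
      also have "\<dots> = emeasure (distr mu lebesgue_torus2 proj) B" using B' pm by (simp add: emeasure_distr)
      also have "\<dots> = emeasure (restrict_space lebesgue_torus2 (- bad)) B"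
        unfolding pd using B' nb by (intro emeasure_restrict_space[symmetric]) auto
      finally show "emeasure (distr (restrict_space mu good_pts) (restrict_space lebesgue_torus2 (- bad)) proj) B =
        emeasure (restrict_space lebesgue_torus2 (- bad)) B" .
    qed simp
    with m show ?thesis by (simp add: measure_preserving_def)
  qed
  have inv_meas: "inv_into good_pts proj \<in> measurable (restrict_space lebesgue_torus2 (- bad)) (restrict_space mu good_pts)"
  proof -
    have "sect \<in> measurable lebesgue_torus2 mu" using sect_measurable' by (simp add: measurable_cong_sets[OF refl sets_mu])
    then have "sect \<in> measurable (restrict_space lebesgue_torus2 (- bad)) (restrict_space mu good_pts)"
      by (rule measurable_restrict_space3) (simp add: sect_in)
    then show ?thesis
      by (rule measurable_cong[THEN iffD2, rotated]) (simp add: space_restrict_space inv_eq)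
  qed
  have shift_good: "word_shift ` good_pts \<subseteq> good_pts"
    using shift_X rot_good by (auto simp: good_pts_def proj_shift)
  have eqv: "\<forall>x\<in>good_pts. proj (word_shift x) = proj x + torus2_proj a"
    by (auto simp: good_pts_def proj_shift rot_def)
  have rot: "(\<lambda>x. x + torus2_proj a) ` (- bad) \<subseteq> - bad" using rot_good by (auto simp: rot_def)
  show ?thesis
    unfolding measurably_conjugate_def invariant_measure_eq
    by (intro conjI mu_invariant measure_preserving_translation exI[of _ good_pts] exI[of _ "- bad"] exI[of _ proj]
        good_sets good_null shift_good rot bij pres inv_meas eqv)
      (use bad_borel in \<open>auto simp: sets_lebesgue_torus2 bad_null null_setsI Compl_eq_Diff_UNIV double_diff\<close>)
qed

end

section \<open>Almost everywhere injectivity and conclusion\<close>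

text \<open>The number of letters of a word; displacements between two points of one torus fibre are
  the vectors of total 0.\<close>

fun total :: "vec3 \<Rightarrow> int" where
  "total (x, y, z) = x + y + z"

lemma total_add: "total (g + h) = total g + total h"
  by (cases g; cases h) simp

lemma total_diff: "total (g - h) = total g - total h"
  by (cases g; cases h) simp

lemma total_zero [simp]: "total 0 = 0" by (simp add: zero_prod_def)

lemma total_word_vec: "total (word_vec w) = int (length w)"
proof (induction w)
  case (Cons x w)
  have "total (letter_vec x) = 1" by (cases x) auto
  with Cons show ?case by (simp add: total_add)
qed simp

context pisot begin

text \<open>Real coordinates with respect to bet^2 - 1 and bet - 1, the differences of letter
  weights, so that their lattice becomes Z^2. Division by bet - 1 turns the basis into bet + 1 and
  1, where the imaginary part gives the first coordinate.\<close>

definition coord :: "complex \<Rightarrow> real^2" where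
  "coord z = (let w = z / (bet - 1); s = Im w / Im bet in vector [s, Re w - s * (Re bet + 1)])"

lemma bet_neq_1: "bet - 1 \<noteq> 0" using Im_bet by auto

lemma linear_coord: "linear coord"
proof (rule linearI)
  show "coord (z + w) = coord z + coord w" for z w
    by (simp add: coord_def Let_def vec_eq_iff forall_2 add_divide_distrib algebra_simps)
  show "coord (r *\<^sub>R z) = r *\<^sub>R coord z" for r z
  proof -
    have "(r *\<^sub>R z) / (bet - 1) = r *\<^sub>R (z / (bet - 1))" by (simp add: scaleR_conv_of_real)
    then show ?thesis by (simp add: coord_def Let_def vec_eq_iff forall_2 algebra_simps)
  qed
qed

lemma coord_inverse: "z = of_real (coord z $ 1) * (bet ^ 2 - 1) + of_real (coord z $ 2) * (bet - 1)"
proof -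
  define w where "w = z / (bet - 1)"
  have "z = w * (bet - 1)" using bet_neq_1 by (simp add: w_def)
  moreover have "w = of_real (coord z $ 1) * (bet + 1) + of_real (coord z $ 2)"
    using Im_bet by (intro complex_eqI) (simp_all add: coord_def Let_def flip: w_def)
  ultimately show ?thesis by (simp add: power2_eq_square algebra_simps)
qed

lemma coord_basis:
  "coord (of_real s * (bet ^ 2 - 1) + of_real t * (bet - 1)) = vector [s, t]"
proof -
  have "(of_real s * (bet ^ 2 - 1) + of_real t * (bet - 1)) = (of_real s * (bet + 1) + of_real t) * (bet - 1)"
    by (simp add: power2_eq_square algebra_simps)
  then have "(of_real s * (bet ^ 2 - 1) + of_real t * (bet - 1)) / (bet - 1) = of_real s * (bet + 1) + of_real t"
    using bet_neq_1 by simp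
  then show ?thesis unfolding coord_def Let_def using Im_bet by (simp add: vec_eq_iff forall_2)
qed

text \<open>Replacing each letter weight by 1 plus a lattice vector: a word with n letters moves the
  point by n times \<open>coord 1\<close> modulo the lattice.\<close>

lemma coord_zt: "coord (zt (x, y, z)) = of_int (x + y + z) *\<^sub>R coord 1 + vector [of_int x, of_int z]"
proof -
  have "zt (x, y, z) = of_int (x + y + z) *\<^sub>R 1 + (of_real (of_int x) * (bet ^ 2 - 1) + of_real (of_int z) * (bet - 1))"
    by (simp add: scaleR_conv_of_real algebra_simps)
  then show ?thesis
    unfolding linear_add[OF linear_coord, of "_ *\<^sub>R 1"] coord_basis linear_scale[OF linear_coord]
    by (simp only: linear_add[OF linear_coord, of "_ *\<^sub>R 1"] coord_basis linear_scale[OF linear_coord])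
qed

lemma vector_in_int_lattice: "vector [of_int x, of_int z] \<in> int_lattice"
  by (simp add: int_lattice_def forall_2)

lemma int_lattice_zt: "v \<in> int_lattice \<Longrightarrow> \<exists>g. total g = 0 \<and> v = coord (zt g)"
proof -
  assume "v \<in> int_lattice"
  then have "v $ 1 \<in> \<int>" "v $ 2 \<in> \<int>" by (simp_all add: int_lattice_def)
  then obtain x z where "v $ 1 = of_int x" "v $ 2 = of_int z" by (elim Ints_cases)
  then have "v = vector [of_int x, of_int z]" by (simp add: vec_eq_iff forall_2)
  then have "v = coord (zt (x, - x - z, z))" by (simp add: coord_zt del: zt.simps)
  then show ?thesis by (intro exI[of _ "(x, - x - z, z)"]) simp
qed

lemma inj_coord: "coord z = coord w \<Longrightarrow> z = w"
  by (metis coord_inverse)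

lemma zt_inc_pow: "zt ((inc k ^^ n) g) = bet ^ n * zt g"
  by (induction n) (simp_all add: zt_inc)

text \<open>The subring generated by \<open>bet\<close> contains the lattices spanned by \<open>bet ^ n\<close> and \<open>bet ^ (n + 1)\<close>, whose
  mesh tends to 0.\<close>

lemma zt_dense:
  assumes "e > 0"
  shows "\<exists>g. cmod (zt g - w) < e"
proof -
  obtain n where n: "2 * cmod bet ^ n < e" using bet_pow_small[of 2 e] assms by auto
  define u where "u = w / bet ^ n"
  define t where "t = Im u / Im bet"
  define s where "s = Re u - t * Re bet"
  have u: "u = of_real s + of_real t * bet"
    using Im_bet by (intro complex_eqI) (simp_all add: s_def t_def)
  have w: "w = bet ^ n * u" using norm_bet_pos by (simp add: u_def)
  define g where "g = (inc k ^^ n) (0, \<lfloor>s\<rfloor>, \<lfloor>t\<rfloor>)"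
  have "zt g - w = bet ^ n * ((of_int \<lfloor>s\<rfloor> - of_real s) + (of_int \<lfloor>t\<rfloor> - of_real t) * bet)"
    unfolding g_def zt_inc_pow w u by (simp add: algebra_simps)
  also have "cmod \<dots> = cmod bet ^ n * cmod (of_real (of_int \<lfloor>s\<rfloor> - s) + of_real (of_int \<lfloor>t\<rfloor> - t) * bet)"
    by (simp add: norm_mult norm_power)
  also have "\<dots> \<le> cmod bet ^ n * 2"
  proof (intro mult_left_mono)
    have "cmod (of_real (of_int \<lfloor>s\<rfloor> - s) + of_real (of_int \<lfloor>t\<rfloor> - t) * bet) \<le> \<bar>of_int \<lfloor>s\<rfloor> - s\<bar> + \<bar>of_int \<lfloor>t\<rfloor> - t\<bar> * cmod bet"
      using norm_triangle_ineq[of "of_real (of_int \<lfloor>s\<rfloor> - s)" "of_real (of_int \<lfloor>t\<rfloor> - t) * bet"]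
      by (simp only: norm_mult norm_of_real)
    also have "\<dots> \<le> 1 + 1 * 1" using norm_bet_less_1 by (intro add_mono mult_mono) (auto, linarith+)
    finally show "cmod (of_real (of_int \<lfloor>s\<rfloor> - s) + of_real (of_int \<lfloor>t\<rfloor> - t) * bet) \<le> 2" by simp
  qed simp
  finally show ?thesis using n by (intro exI[of _ g]) simp
qed

text \<open>By \<open>coord_zt\<close> the set in question contains the coordinates of all values of
  \<open>zt\<close>, which are dense by \<open>zt_dense\<close>.\<close>

lemma dense_rotation_coord: "dense_rotation (coord 1)"
  unfolding dense_rotation_def
proof (intro allI impI)
  fix v :: "real^2" and e :: real assume e: "e > 0"
  obtain B where B: "B > 0" "\<And>z. norm (coord z) \<le> norm z * B"
    using bounded_linear.pos_bounded[OF linear_coord[unfolded linear_conv_bounded_linear]] by blast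
  define w where "w = of_real (v $ 1) * (bet ^ 2 - 1) + of_real (v $ 2) * (bet - 1)"
  have v: "v = coord w" unfolding w_def coord_basis by (simp add: vec_eq_iff forall_2)
  obtain g where g: "cmod (zt g - w) < e / B" using zt_dense[of "e / B" w] e B by auto
  obtain x y z where g': "g = (x, y, z)" by (cases g)
  have "of_int (x + y + z) *\<^sub>R coord 1 + vector [of_int x, of_int z] - v = coord (zt g - w)"
    unfolding v g' by (simp only: linear_diff[OF linear_coord] coord_zt)
  also have "norm \<dots> < e" using B(2)[of "zt g - w"] g B(1) by (simp add: pos_less_divide_eq)
  finally show "\<exists>n :: int. \<exists>z\<in>int_lattice. norm (of_int n *\<^sub>R coord 1 + z - v) < e"
    using vector_in_int_lattice by blast
qed

lemma len_ge_1: "len i \<ge> 1"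
  using lam_gt_1 by (cases i) auto

abbreviation prefix_vec :: "(nat \<Rightarrow> letter) \<Rightarrow> nat \<Rightarrow> vec3" where
  "prefix_vec x n \<equiv> word_vec (map x [0..<n])"

lemma prefix_vec_Suc: "prefix_vec x (Suc n) = prefix_vec x n + letter_vec (x n)"
  by simp

lemma el_prefix_vec_ge: "el (prefix_vec x n) \<ge> real n"
proof (induction n)
  case (Suc n)
  then show ?case using len_ge_1[of "x n"] unfolding prefix_vec_Suc el_add by simp
qed simp

lemma tile_containing:
  assumes "c \<ge> 0"
  obtains n where "el (prefix_vec x n) \<le> c" "c < el (prefix_vec x n) + len (x n)"
proof -
  let ?P = "\<lambda>n. c < el (prefix_vec x (Suc n))"
  obtain N :: nat where "c < real N" using reals_Archimedean2 by blast
  then have "?P N" using el_prefix_vec_ge[of "Suc N" x] by linarith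
  then have P: "?P (LEAST n. ?P n)" by (rule LeastI)
  define n where "n = (LEAST n. ?P n)"
  have "el (prefix_vec x n) \<le> c"
  proof (cases n)
    case (Suc m)
    then have "\<not> ?P m" using not_less_Least[of m ?P] by (simp add: n_def)
    then show ?thesis using Suc by simp
  qed (use assms in simp)
  moreover have "c < el (prefix_vec x n) + len (x n)"
  proof -
    have "?P n" unfolding n_def by (rule P)
    then show ?thesis by (simp only: prefix_vec_Suc el_add)
  qed
  ultimately show ?thesis by (rule that)
qed

lemma rz_word_shift_pow:
  assumes "x \<in> language_shift k"
  shows "(word_shift ^^ n) x \<in> language_shift k \<and> rz ((word_shift ^^ n) x) = rz x + zt (prefix_vec x n)"
proof (induction n)
  case (Suc n)
  let ?y = "(word_shift ^^ n) x"
  have "?y 0 = x n" by (simp add: word_shift_pow)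
  then have "rz (word_shift ?y) = rz ?y + zt (letter_vec (x n))" using rz_word_shift Suc by simp
  moreover have "word_shift ?y \<in> language_shift k" using Suc word_shift_language_shift by blast
  ultimately show ?case using Suc unfolding prefix_vec_Suc zt_add by simp
qed (use assms in simp)

text \<open>Two points in one fibre of the torus map yield two tilings of the line; the left end of the later first
  tile lies in a tile of the other, and if these two coincide, the tilings start together, hence differ later.\<close>

lemma fibre_overlap:
  assumes ne: "x \<noteq> y" and g: "total g = 0"
  shows "\<exists>n m. olen (g + prefix_vec x n - prefix_vec y m, x n, y m) > 0 \<and>
     \<not> coincident (g + prefix_vec x n - prefix_vec y m, x n, y m)"
proof (rule ccontr)
  assume no: "\<not> ?thesis"
  have co: "g + prefix_vec x n - prefix_vec y m = 0 \<and> x n = y m"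
    if "- len (x n) < el (g + prefix_vec x n - prefix_vec y m)" "el (g + prefix_vec x n - prefix_vec y m) < len (y m)" for n m
    using no that olen_pos_iff[of "g + prefix_vec x n - prefix_vec y m" "x n" "y m"] by (auto simp del: olen.simps)
  have g0: "g = 0"
  proof (cases "el g \<le> 0")
    case True
    then obtain n where n: "el (prefix_vec x n) \<le> - el g" "- el g < el (prefix_vec x n) + len (x n)"
      using tile_containing[of "- el g" x] by auto
    have "g + prefix_vec x n - prefix_vec y 0 = 0" using co[of n 0] n len_pos[of "y 0"] by (simp add: el_add el_diff)
    then have e: "g + prefix_vec x n = 0" by simp
    \<comment> \<open>\<open>total\<close> counts letters and vanishes on g, so coincidence is
      possible only at the first tile.\<close>
    then have "total (g + prefix_vec x n) = 0" by simp
    then have "n = 0" unfolding total_add g total_word_vec by simp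
    then show ?thesis using e by simp
  next
    case False
    then obtain m where m: "el (prefix_vec y m) \<le> el g" "el g < el (prefix_vec y m) + len (y m)"
      using tile_containing[of "el g" y] by auto
    have "g + prefix_vec x 0 - prefix_vec y m = 0" using co[of 0 m] m len_pos[of "x 0"] by (simp add: el_add el_diff)
    then have e: "g - prefix_vec y m = 0" by simp
    then have "total (g - prefix_vec y m) = 0" by simp
    then have "m = 0" unfolding total_diff g total_word_vec by simp
    then show ?thesis using e by simp
  qed
  obtain N where N: "x N \<noteq> y N" "\<And>n. n < N \<Longrightarrow> x n = y n"
    using ne exists_least_iff[of "\<lambda>n. x n \<noteq> y n"] by (auto simp: fun_eq_iff)
  then have e: "map x [0..<N] = map y [0..<N]" by auto
  have "g + prefix_vec x N - prefix_vec y N = 0" unfolding e g0 by simp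
  then show False using co[of N N] N(1) len_pos by simp
qed

definition tile_meet :: "vec3 \<times> letter \<times> letter \<Rightarrow> complex set" where
  "tile_meet = (\<lambda>(g, i, j). tile i \<inter> (\<lambda>z. z + zt g) ` tile j)"

text \<open>As no overlap is heavy, a non-coincident overlap of positive length has area 0; the
  affine change of coordinates preserves null sets.\<close>

lemma negligible_tile_meet:
  assumes "olen ov > 0" "\<not> coincident ov"
  shows "negligible ((\<lambda>z. coord (z + c)) ` tile_meet ov)"
proof -
  obtain g i j where ov: "ov = (g, i, j)" by (cases ov)
  have "ov \<notin> heavy" by (simp add: heavy_empty)
  then have "\<not> mass ov > 0" unfolding heavy_def using assms by blast
  then have "area (tile_meet ov) = 0" using mass_nonneg[of ov] by (simp add: ov tile_meet_def)
  moreover have "plane ` tile_meet ov \<in> lmeasurable"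
    unfolding ov tile_meet_def by (simp add: lmeasurable_plane_image compact_tile_Int)
  ultimately have n: "negligible (plane ` tile_meet ov)" by (simp add: area_def negligible_iff_measure0)
  define h where "h v = coord (Complex (v $ 1) (v $ 2))" for v :: "real^2"
  have "linear (\<lambda>v :: real^2. Complex (v $ 1) (v $ 2))" by (rule linearI) (simp_all add: complex_eq_iff)
  then have "linear h" unfolding h_def using linear_compose[OF _ linear_coord] by (simp add: o_def)
  then have "(\<lambda>v. h v + coord c) differentiable_on plane ` tile_meet ov"
    by (intro differentiable_on_add linear_imp_differentiable_on differentiable_on_const)
  then have "negligible ((\<lambda>v. h v + coord c) ` (plane ` tile_meet ov))"
    by (intro negligible_differentiable_image_negligible n) auto
  moreover have "h (plane z) + coord c = coord (z + c)" for z
    by (simp add: h_def plane_def linear_add[OF linear_coord])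
  ultimately show ?thesis by (simp add: image_image)
qed

lemma negligible_fibres_coord:
  "negligible {v. \<exists>x\<in>language_shift k. \<exists>y\<in>language_shift k. x \<noteq> y \<and>
     coord (rz x) - v \<in> int_lattice \<and> coord (rz y) - v \<in> int_lattice}" (is "negligible ?N")
proof -
  let ?O = "{ov. olen ov > 0 \<and> \<not> coincident ov}"
  \<comment> \<open>Overlaps and translation vectors d range over countable sets. The translation
    undoes the passage to a later tile and the choice of representative of v.\<close>
  let ?S = "\<Union>(ov, d)\<in>?O \<times> UNIV. (\<lambda>z. coord (z + zt d)) ` tile_meet ov"
  have "negligible ?S"
    by (rule negligible_countable_Union) (auto intro: negligible_tile_meet)
  moreover have "?N \<subseteq> ?S"
  proof
    fix v assume "v \<in> ?N"
    then obtain x y where x: "x \<in> language_shift k" and y: "y \<in> language_shift k" and ne: "x \<noteq> y"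
      and vx: "coord (rz x) - v \<in> int_lattice" and vy: "coord (rz y) - v \<in> int_lattice" by blast
    have "(coord (rz x) - v) - (coord (rz y) - v) \<in> int_lattice" by (rule int_lattice_closed_ops(4)[OF vx vy])
    then obtain g where g: "total g = 0" "coord (rz x) - coord (rz y) = coord (zt g)"
      using int_lattice_zt by fastforce
    then have xy: "rz x = rz y + zt g"
      using inj_coord[of "rz x - rz y" "zt g"] by (simp add: linear_diff[OF linear_coord] algebra_simps)
    obtain d where d: "coord (rz x) - v = coord (zt d)" using int_lattice_zt[OF vx] by blast
    obtain n m where nm: "olen (g + prefix_vec x n - prefix_vec y m, x n, y m) > 0"
      "\<not> coincident (g + prefix_vec x n - prefix_vec y m, x n, y m)" using fibre_overlap[OF ne g(1)] by blast
    let ?g = "g + prefix_vec x n - prefix_vec y m"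
    let ?z = "rz ((word_shift ^^ n) x)"
    have X: "(word_shift ^^ n) x \<in> language_shift k" "?z = rz x + zt (prefix_vec x n)"
      using rz_word_shift_pow[OF x] by auto
    have Y: "(word_shift ^^ m) y \<in> language_shift k" "rz ((word_shift ^^ m) y) = rz y + zt (prefix_vec y m)"
      using rz_word_shift_pow[OF y] by auto
    have "?z \<in> tile (x n)" using rz_in_tile[OF X(1)] by (simp add: word_shift_pow)
    moreover have "rz ((word_shift ^^ m) y) \<in> tile (y m)" using rz_in_tile[OF Y(1)] by (simp add: word_shift_pow)
    moreover have "?z = rz ((word_shift ^^ m) y) + zt ?g"
      unfolding X(2) Y(2) xy by (simp add: zt_add zt_diff)
    ultimately have "?z \<in> tile_meet (?g, x n, y m)" by (auto simp: tile_meet_def)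
    moreover have "v = coord (?z + zt (- prefix_vec x n - d))"
    proof -
      have e: "?z + zt (- prefix_vec x n - d) = rz x - zt d" unfolding X(2) by (simp add: zt_diff zt_uminus)
      show ?thesis unfolding e linear_diff[OF linear_coord] using d by (simp add: algebra_simps)
    qed
    ultimately show "v \<in> ?S" using nm by blast
  qed
  ultimately show ?thesis by (rule negligible_subset)
qed

lemma torus_factor_coord: "torus_factor (language_shift k) (\<lambda>x. coord (rz x)) (coord 1)"
proof
  show "compact (language_shift k)" by (rule compact_language_shift)
  show "language_shift k \<noteq> {}" by (rule language_shift_nonempty)
  show "word_shift ` language_shift k = language_shift k" by (rule word_shift_language_shift)
  show "continuous_on (language_shift k) (\<lambda>x. coord (rz x))"
    by (rule continuous_on_compose2[OF linear_continuous_on continuous_on_rz])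
      (use linear_coord in \<open>auto simp: linear_conv_bounded_linear\<close>)
  show "coord (rz (word_shift x)) - (coord (rz x) + coord 1) \<in> int_lattice" if "x \<in> language_shift k" for x
  proof -
    obtain p q r where e: "letter_vec (x 0) = (p, q, r)" "p + q + r = 1" by (cases "x 0") auto
    have "coord (rz (word_shift x)) - (coord (rz x) + coord 1) = vector [of_int p, of_int r]"
      unfolding rz_word_shift[OF that] linear_add[OF linear_coord] e(1) coord_zt e(2) by simp
    then show ?thesis by (simp add: vector_in_int_lattice)
  qed
  show "dense_rotation (coord 1)" by (rule dense_rotation_coord)
qed (rule negligible_fibres_coord)

end

theorem theorem6p1:
  fixes k :: nat
  shows "\<exists>\<alpha> :: torus2.
    measurably_conjugate (invariant_measure (subshift_of (sk k))) word_shift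
      lebesgue_torus2 (\<lambda>x. x + \<alpha>)"
proof -
  obtain lam bet where "pisot k lam bet" using pisot_exists by blast
  then interpret pisot k lam bet .
  interpret torus_factor "language_shift k" "\<lambda>x. coord (rz x)" "coord 1" by (rule torus_factor_coord)
  show ?thesis unfolding subshift_of_sk using conjugate_rotation by blast
qed

end
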